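(* The operad $\mathcal{JJ}ss$ of the (commutative) Jacobi-Jordan algebras over $\mathbb{K}$ is not Koszul. In particular, the cohomology of deformations of a Jacobi-Jordan algebra is the cohomology of the minimal model.
   Context: $\mathbb{K}$ is a field of characteristic $0$. A Jacobi-Jordan algebra is a $\mathbb{K}$-vector space $A$ with a commutative bilinear product satisfying $x(yz)+y(zx)+z(xy)=0$ for all $x,y,z\in A$. $\mathcal{JJ}ss$ denotes the quadratic symmetric operad over $\mathbb{K}$ whose algebras are the Jacobi-Jordan algebras: it is generated by one commutative binary operation subject to the relation $x_1(x_2x_3)+x_2(x_3x_1)+x_3(x_1x_2)=0$. Koszulness is meant in the usual sense for quadratic operads. "The cohomology of the minimal model" is the deformation cohomology of an algebra (with coefficients in itself) computed by the deformation complex built from the minimal model (minimal cofibrant dg resolution) of the operad. *)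

theory Defs
  imports
    Complex_Main
    "HOL-Library.Poly_Mapping"
    "HOL-Library.Multiset"
    "HOL-Library.Nat_Bijection"
    "HOL-Library.FuncSet"
    "HOL-Library.Function_Algebras"
    "HOL-Library.Product_Plus"
    "HOL-Library.Infinite_Typeclass"
begin

section \<open>Symmetric dg operads\<close>

text \<open>
  Operads are given in the coordinate-free (species) form: inputs are labelled by finite nonempty
  sets of natural numbers.  \<open>ops M I d\<close> is the space of operations with input set \<open>I\<close> and
  homological degree \<open>d \<ge> 0\<close>; \<open>pcomp M i x y\<close> is the partial composition that
  plugs \<open>y\<close> into the input \<open>i\<close> of \<open>x\<close>; \<open>ren M f\<close> relabels the inputs along an injection
  (for \<open>I = {1..n}\<close> and \<open>f\<close> a permutation of \<open>I\<close> this is the action of the symmetric group);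
  \<open>idt M i\<close> is the identity operation with input \<open>i\<close>; \<open>dif M\<close> is the differential, of degree -1.
  An operad without grading is one that is concentrated in degree 0.  There are no operations
  without inputs.  All components live in one ambient vector space, in which two different
  components have only 0 in common, so that an operation determines its inputs and its degree.
\<close>

record ('k, 'v) operad =
  ops :: "nat set \<Rightarrow> nat \<Rightarrow> 'v set"
  scl :: "'k \<Rightarrow> 'v \<Rightarrow> 'v"
  pcomp :: "nat \<Rightarrow> 'v \<Rightarrow> 'v \<Rightarrow> 'v"
  ren :: "(nat \<Rightarrow> nat) \<Rightarrow> 'v \<Rightarrow> 'v"
  idt :: "nat \<Rightarrow> 'v"
  dif :: "'v \<Rightarrow> 'v"

locale dg_operad = vector_space "scl M"
  for M :: "('k::field, 'v::ab_group_add) operad" +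
  assumes ops_subspace: "subspace (ops M I d)"
    and ops_inputs: "\<not> (finite I \<and> I \<noteq> {}) \<Longrightarrow> ops M I d = {0}"
    and ops_disjoint: "(I, d) \<noteq> (I', d') \<Longrightarrow> ops M I d \<inter> ops M I' d' = {0}"
    \<comment> \<open>relabelling\<close>
    and ren_closed: "inj_on f I \<Longrightarrow> x \<in> ops M I d \<Longrightarrow> ren M f x \<in> ops M (f ` I) d"
    and ren_add: "inj_on f I \<Longrightarrow> x \<in> ops M I d \<Longrightarrow> y \<in> ops M I d \<Longrightarrow>
          ren M f (x + y) = ren M f x + ren M f y"
    and ren_scl: "inj_on f I \<Longrightarrow> x \<in> ops M I d \<Longrightarrow> ren M f (scl M c x) = scl M c (ren M f x)"
    and ren_cong: "x \<in> ops M I d \<Longrightarrow> (\<And>i. i \<in> I \<Longrightarrow> f i = g i) \<Longrightarrow> ren M f x = ren M g x"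
    and ren_id: "x \<in> ops M I d \<Longrightarrow> ren M id x = x"
    and ren_ren: "inj_on f I \<Longrightarrow> inj_on g (f ` I) \<Longrightarrow> x \<in> ops M I d \<Longrightarrow>
          ren M g (ren M f x) = ren M (g \<circ> f) x"
    \<comment> \<open>composition\<close>
    and comp_closed: "i \<in> I \<Longrightarrow> J \<inter> (I - {i}) = {} \<Longrightarrow> x \<in> ops M I d \<Longrightarrow> y \<in> ops M J e \<Longrightarrow>
          pcomp M i x y \<in> ops M ((I - {i}) \<union> J) (d + e)"
    and comp_add_left: "i \<in> I \<Longrightarrow> J \<inter> (I - {i}) = {} \<Longrightarrow>
          x \<in> ops M I d \<Longrightarrow> x' \<in> ops M I d \<Longrightarrow> y \<in> ops M J e \<Longrightarrow>
          pcomp M i (x + x') y = pcomp M i x y + pcomp M i x' y"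
    and comp_add_right: "i \<in> I \<Longrightarrow> J \<inter> (I - {i}) = {} \<Longrightarrow>
          x \<in> ops M I d \<Longrightarrow> y \<in> ops M J e \<Longrightarrow> y' \<in> ops M J e \<Longrightarrow>
          pcomp M i x (y + y') = pcomp M i x y + pcomp M i x y'"
    and comp_scl_left: "i \<in> I \<Longrightarrow> J \<inter> (I - {i}) = {} \<Longrightarrow> x \<in> ops M I d \<Longrightarrow> y \<in> ops M J e \<Longrightarrow>
          pcomp M i (scl M c x) y = scl M c (pcomp M i x y)"
    and comp_scl_right: "i \<in> I \<Longrightarrow> J \<inter> (I - {i}) = {} \<Longrightarrow> x \<in> ops M I d \<Longrightarrow> y \<in> ops M J e \<Longrightarrow>
          pcomp M i x (scl M c y) = scl M c (pcomp M i x y)"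
    and comp_sequential: "i \<in> I \<Longrightarrow> j \<in> J \<Longrightarrow> J \<inter> (I - {i}) = {} \<Longrightarrow>
          K \<inter> ((I - {i}) \<union> (J - {j})) = {} \<Longrightarrow>
          x \<in> ops M I d \<Longrightarrow> y \<in> ops M J e \<Longrightarrow> z \<in> ops M K m \<Longrightarrow>
          pcomp M j (pcomp M i x y) z = pcomp M i x (pcomp M j y z)"
    and comp_parallel: "i \<in> I \<Longrightarrow> i' \<in> I \<Longrightarrow> i \<noteq> i' \<Longrightarrow>
          J \<inter> (I - {i}) = {} \<Longrightarrow> K \<inter> (I - {i'}) = {} \<Longrightarrow> J \<inter> K = {} \<Longrightarrow>
          x \<in> ops M I d \<Longrightarrow> y \<in> ops M J e \<Longrightarrow> z \<in> ops M K m \<Longrightarrow>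
          pcomp M i' (pcomp M i x y) z = scl M ((- 1) ^ (e * m)) (pcomp M i (pcomp M i' x z) y)"
    and comp_ren: "i \<in> I \<Longrightarrow> J \<inter> (I - {i}) = {} \<Longrightarrow> inj_on g I \<Longrightarrow> inj_on h J \<Longrightarrow>
          h ` J \<inter> g ` (I - {i}) = {} \<Longrightarrow> x \<in> ops M I d \<Longrightarrow> y \<in> ops M J e \<Longrightarrow>
          pcomp M (g i) (ren M g x) (ren M h y) = ren M (\<lambda>l. if l \<in> J then h l else g l) (pcomp M i x y)"
    \<comment> \<open>identities\<close>
    and idt_closed: "idt M i \<in> ops M {i} 0"
    and ren_idt: "ren M f (idt M i) = idt M (f i)"
    and comp_idt_left: "y \<in> ops M J e \<Longrightarrow> pcomp M i (idt M i) y = y"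
    and comp_idt_right: "i \<in> I \<Longrightarrow> j \<notin> I - {i} \<Longrightarrow> x \<in> ops M I d \<Longrightarrow>
          pcomp M i x (idt M j) = ren M (id(i := j)) x"
    \<comment> \<open>differential\<close>
    and dif_closed: "x \<in> ops M I (Suc d) \<Longrightarrow> dif M x \<in> ops M I d"
    and dif_degree_0: "x \<in> ops M I 0 \<Longrightarrow> dif M x = 0"
    and dif_add: "x \<in> ops M I d \<Longrightarrow> y \<in> ops M I d \<Longrightarrow> dif M (x + y) = dif M x + dif M y"
    and dif_scl: "x \<in> ops M I d \<Longrightarrow> dif M (scl M c x) = scl M c (dif M x)"
    and dif_dif: "x \<in> ops M I d \<Longrightarrow> dif M (dif M x) = 0"
    and dif_ren: "inj_on f I \<Longrightarrow> x \<in> ops M I d \<Longrightarrow> dif M (ren M f x) = ren M f (dif M x)"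
    and dif_comp: "i \<in> I \<Longrightarrow> J \<inter> (I - {i}) = {} \<Longrightarrow> x \<in> ops M I d \<Longrightarrow> y \<in> ops M J e \<Longrightarrow>
          dif M (pcomp M i x y) = pcomp M i (dif M x) y + scl M ((- 1) ^ d) (pcomp M i x (dif M y))"

definition operad_morphism ::
    "('k, 'v::ab_group_add) operad \<Rightarrow> ('k, 'w::ab_group_add) operad \<Rightarrow> ('v \<Rightarrow> 'w) \<Rightarrow> bool" where
  "operad_morphism M Q f \<longleftrightarrow>
     (\<forall>I d. \<forall>x\<in>ops M I d. f x \<in> ops Q I d) \<and>
     (\<forall>I d. \<forall>x\<in>ops M I d. \<forall>y\<in>ops M I d. f (x + y) = f x + f y) \<and>
     (\<forall>I d c. \<forall>x\<in>ops M I d. f (scl M c x) = scl Q c (f x)) \<and>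
     (\<forall>I d g. \<forall>x\<in>ops M I d. inj_on g I \<longrightarrow> f (ren M g x) = ren Q g (f x)) \<and>
     (\<forall>I d J e i. \<forall>x\<in>ops M I d. \<forall>y\<in>ops M J e. i \<in> I \<and> J \<inter> (I - {i}) = {} \<longrightarrow>
        f (pcomp M i x y) = pcomp Q i (f x) (f y)) \<and>
     (\<forall>i. f (idt M i) = idt Q i) \<and>
     (\<forall>I d. \<forall>x\<in>ops M I d. f (dif M x) = dif Q (f x))"

definition cycles :: "('k, 'v::ab_group_add) operad \<Rightarrow> nat set \<Rightarrow> nat \<Rightarrow> 'v set" where
  "cycles M I d = {x \<in> ops M I d. dif M x = 0}"

definition boundaries :: "('k, 'v::ab_group_add) operad \<Rightarrow> nat set \<Rightarrow> nat \<Rightarrow> 'v set" where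
  "boundaries M I d = dif M ` ops M I (Suc d)"

definition quasi_iso ::
    "('k, 'v::ab_group_add) operad \<Rightarrow> ('k, 'w::ab_group_add) operad \<Rightarrow> ('v \<Rightarrow> 'w) \<Rightarrow> bool" where
  "quasi_iso M Q f \<longleftrightarrow> operad_morphism M Q f \<and>
     (\<forall>I d. (\<forall>x\<in>cycles M I d. f x \<in> boundaries Q I d \<longrightarrow> x \<in> boundaries M I d) \<and>
            (\<forall>y\<in>cycles Q I d. \<exists>x\<in>cycles M I d. y - f x \<in> boundaries Q I d))"


section \<open>Reduced trees and tree compositions\<close>

text \<open>
  A reduced tree with set of leaves \<open>I\<close> is encoded by the set of its vertices, a vertex being
  identified with the set of leaves above it.  The root is \<open>I\<close>, and every vertex has at least two
  inputs.  An input of a vertex is labelled by the smallest leaf above it.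
\<close>

definition trees :: "nat set \<Rightarrow> nat set set set" where
  "trees I = {T. I \<in> T \<and> (\<forall>V\<in>T. V \<subseteq> I \<and> finite V \<and> card V \<ge> 2) \<and>
                 (\<forall>U\<in>T. \<forall>V\<in>T. U \<inter> V = {} \<or> U \<subseteq> V \<or> V \<subseteq> U)}"

definition inputs :: "nat set set \<Rightarrow> nat set \<Rightarrow> nat set" where
  "inputs T V = {v \<in> V. \<forall>U\<in>T. U \<subset> V \<and> v \<in> U \<longrightarrow> v = Min U}"

definition parent :: "nat set set \<Rightarrow> nat set \<Rightarrow> nat set" where
  "parent T V = \<Inter>{U \<in> T. V \<subset> U}"

text \<open>Contraction of the edge that joins the vertex \<open>V\<close> of the decorated tree \<open>(T, p)\<close> to its parent.\<close>

definition contract :: "('k, 'v) operad \<Rightarrow> nat set \<Rightarrow>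
    nat set set \<times> (nat set \<Rightarrow> 'v) \<Rightarrow> nat set set \<times> (nat set \<Rightarrow> 'v)" where
  "contract M V = (\<lambda>(T, p).
     (T - {V}, restrict (p(parent T V := pcomp M (Min V) (p (parent T V)) (p V))) (T - {V})))"

text \<open>
  The composite of a decorated tree; \<^const>\<open>set_encode\<close> fixes the order of the contractions, on
  which the composite depends only up to sign.
\<close>

definition tree_comp ::
    "('k, 'v) operad \<Rightarrow> nat set \<Rightarrow> nat set set \<times> (nat set \<Rightarrow> 'v) \<Rightarrow> 'v" where
  "tree_comp M I = (\<lambda>(T, p).
     snd (fold (contract M) (sorted_key_list_of_set set_encode (T - {I})) (T, p)) I)"


section \<open>Koszulness\<close>

text \<open>
  Let \<open>P\<close> be an operad concentrated in degree 0 with \<open>P(1)\<close> spanned by the identity.  The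
  Ginzburg-Kapranov dual dg operad \<open>D(P)\<close> has as component with input set \<open>I\<close> the complex
  whose term with index \<open>s\<close> is the sum, over the reduced trees \<open>T\<close> with leaves \<open>I\<close> and \<open>s\<close>
  vertices, of the dual of the tensor product of the spaces \<open>P(inputs T V)\<close>, \<open>V \<in> T\<close>,
  twisted by the determinant of the set of inner edges.  An element of the dual of a tensor product
  is a multilinear form; inner edges correspond to the vertices other than the root, and their
  order by \<^const>\<open>set_encode\<close> trivializes the determinant.  The differential is the transpose of
  edge contraction.
\<close>

definition dual_cochains ::
    "('k::field, 'v::ab_group_add) operad \<Rightarrow> nat set \<Rightarrow> nat \<Rightarrow>
     (nat set set \<times> (nat set \<Rightarrow> 'v) \<Rightarrow> 'k) set" where
  "dual_cochains P I s = {\<phi>. \<forall>T\<in>trees I. card T = s \<longrightarrow>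
     (\<forall>p\<in>(\<Pi>\<^sub>E V\<in>T. ops P (inputs T V) 0). \<forall>V\<in>T. \<forall>x\<in>ops P (inputs T V) 0.
        (\<forall>y\<in>ops P (inputs T V) 0. \<phi> (T, p(V := x + y)) = \<phi> (T, p(V := x)) + \<phi> (T, p(V := y))) \<and>
        (\<forall>c. \<phi> (T, p(V := scl P c x)) = c * \<phi> (T, p(V := x))))}"

definition dual_dif ::
    "('k::field, 'v) operad \<Rightarrow> nat set \<Rightarrow> (nat set set \<times> (nat set \<Rightarrow> 'v) \<Rightarrow> 'k) \<Rightarrow>
     nat set set \<times> (nat set \<Rightarrow> 'v) \<Rightarrow> 'k" where
  "dual_dif P I \<phi> = (\<lambda>(T, p). \<Sum>V\<in>T - {I}.
     (- 1) ^ card {U \<in> T - {I}. set_encode U < set_encode V} * \<phi> (contract P V (T, p)))"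

definition dual_eq_on ::
    "('k, 'v) operad \<Rightarrow> nat set \<Rightarrow> nat \<Rightarrow> (nat set set \<times> (nat set \<Rightarrow> 'v) \<Rightarrow> 'k) \<Rightarrow>
     (nat set set \<times> (nat set \<Rightarrow> 'v) \<Rightarrow> 'k) \<Rightarrow> bool" where
  "dual_eq_on P I s \<phi> \<psi> \<longleftrightarrow>
     (\<forall>T\<in>trees I. card T = s \<longrightarrow> (\<forall>p\<in>(\<Pi>\<^sub>E V\<in>T. ops P (inputs T V) 0). \<phi> (T, p) = \<psi> (T, p)))"

text \<open>
  Koszulness of a quadratic operad \<open>P\<close> generated by binary operations, after Ginzburg and
  Kapranov: the canonical map from \<open>D(P)\<close> to the quadratic dual of \<open>P\<close> is a quasi-isomorphism, that
  is, each complex \<open>D(P)(I)\<close> is exact everywhere but at its right end, the term of the binary trees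
  (\<open>s = card I - 1\<close>); the cohomology at the right end is the quadratic dual.  Dually: the
  homology of the bar construction of \<open>P\<close> is concentrated on the diagonal.
  There is no tree with \<open>s = 0\<close>, so that for \<open>s = 1\<close> exactness is injectivity.
\<close>

definition koszul :: "('k::field, 'v::ab_group_add) operad \<Rightarrow> bool" where
  "koszul P \<longleftrightarrow> (\<forall>I s. finite I \<and> s + 1 < card I \<longrightarrow>
     (\<forall>\<phi>\<in>dual_cochains P I s. dual_eq_on P I (s + 1) (dual_dif P I \<phi>) (\<lambda>_. 0) \<longrightarrow>
        (\<exists>\<psi>\<in>dual_cochains P I (s - 1). dual_eq_on P I s \<phi> (dual_dif P I \<psi>))))"


section \<open>Cofibrant resolutions and minimal models\<close>

definition pm_scale :: "'k::field \<Rightarrow> ('u \<Rightarrow>\<^sub>0 'k) \<Rightarrow> ('u \<Rightarrow>\<^sub>0 'k)" where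
  "pm_scale c x = Poly_Mapping.map ((*) c) x"

text \<open>
  Model-categorical notions refer to the dg operads whose ambient space is the vector space with
  basis \<open>'u\<close>, for an infinite type \<open>'u\<close>; up to isomorphism these are all dg operads of dimension at
  most the cardinality of \<open>'u\<close>.  As usual (for complexes in nonnegative degrees), an acyclic
  fibration is a surjective quasi-isomorphism.
\<close>

definition small_dg_operad :: "('k::field, 'u \<Rightarrow>\<^sub>0 'k) operad \<Rightarrow> bool" where
  "small_dg_operad M \<longleftrightarrow> dg_operad M \<and> scl M = pm_scale"

definition acyclic_fibration ::
    "('k, 'v::ab_group_add) operad \<Rightarrow> ('k, 'w::ab_group_add) operad \<Rightarrow> ('v \<Rightarrow> 'w) \<Rightarrow> bool" where
  "acyclic_fibration X Y p \<longleftrightarrow> quasi_iso X Y p \<and> (\<forall>I d. p ` ops X I d = ops Y I d)"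

definition cofibrant :: "('k::field, 'u::infinite \<Rightarrow>\<^sub>0 'k) operad \<Rightarrow> bool" where
  "cofibrant M \<longleftrightarrow> small_dg_operad M \<and>
     (\<forall>(X :: ('k, 'u \<Rightarrow>\<^sub>0 'k) operad) (Y :: ('k, 'u \<Rightarrow>\<^sub>0 'k) operad) p f.
        small_dg_operad X \<and> small_dg_operad Y \<and> acyclic_fibration X Y p \<and> operad_morphism M Y f
        \<longrightarrow> (\<exists>g. operad_morphism M X g \<and> (\<forall>I d. \<forall>x\<in>ops M I d. p (g x) = f x)))"

definition cofibrant_resolution ::
    "('k::field, 'v::ab_group_add) operad \<Rightarrow> ('k, 'u::infinite \<Rightarrow>\<^sub>0 'k) operad \<Rightarrow>
     (('u \<Rightarrow>\<^sub>0 'k) \<Rightarrow> 'v) \<Rightarrow> bool" where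
  "cofibrant_resolution P M \<epsilon> \<longleftrightarrow> cofibrant M \<and> quasi_iso M P \<epsilon>"

text \<open>
  The decorated trees with leaves \<open>I\<close> and total degree \<open>e\<close> whose vertices are decorated by
  elements of \<open>B\<close>.
\<close>

definition decorated_trees ::
    "(nat set \<Rightarrow> nat \<Rightarrow> 'v set) \<Rightarrow> nat set \<Rightarrow> nat \<Rightarrow> (nat set set \<times> (nat set \<Rightarrow> 'v)) set" where
  "decorated_trees B I e = {(T, p). T \<in> trees I \<and>
     (\<exists>g. p \<in> (\<Pi>\<^sub>E V\<in>T. B (inputs T V) (g V)) \<and> (\<Sum>V\<in>T. g V) = e)}"

text \<open>
  The graded operad underlying \<open>M\<close> is free on the graded submodule \<open>E\<close> (stable under relabelling)
  of which \<open>B I d\<close> are bases, with \<open>E(1) = 0\<close>.  The free operad on \<open>E\<close> is, in arity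
  at least 2, the direct sum over the reduced trees \<open>T\<close> of the tensor products of the spaces
  \<open>E(inputs T V)\<close>, \<open>V \<in> T\<close>; so freeness of \<open>M\<close> means that tree composition maps a basis of this
  sum bijectively onto a basis of \<open>M\<close>.
\<close>

definition free_on :: "('k::field, 'v::ab_group_add) operad \<Rightarrow> (nat set \<Rightarrow> nat \<Rightarrow> 'v set) \<Rightarrow> bool" where
  "free_on M B \<longleftrightarrow>
     (\<forall>I d. B I d \<subseteq> ops M I d \<and> \<not> module.dependent (scl M) (B I d)) \<and>
     (\<forall>I d. \<not> (finite I \<and> card I \<ge> 2) \<longrightarrow> B I d = {}) \<and>
     (\<forall>I d f. inj_on f I \<longrightarrow>
        ren M f ` module.span (scl M) (B I d) \<subseteq> module.span (scl M) (B (f ` I) d)) \<and>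
     (\<forall>i. idt M i \<noteq> 0 \<and> ops M {i} 0 = module.span (scl M) {idt M i}) \<and>
     (\<forall>i d. ops M {i} (Suc d) = {0}) \<and>
     (\<forall>I e. finite I \<and> card I \<ge> 2 \<longrightarrow>
        inj_on (tree_comp M I) (decorated_trees B I e) \<and>
        \<not> module.dependent (scl M) (tree_comp M I ` decorated_trees B I e) \<and>
        module.span (scl M) (tree_comp M I ` decorated_trees B I e) = ops M I e)"

definition decomposables ::
    "('k::field, 'v::ab_group_add) operad \<Rightarrow> nat set \<Rightarrow> nat \<Rightarrow> 'v set" where
  "decomposables M I d = module.span (scl M)
     {pcomp M i x y | i x y J e K f. x \<in> ops M J e \<and> y \<in> ops M K f \<and> i \<in> J \<and> K \<inter> (J - {i}) = {} \<and>
        card J \<ge> 2 \<and> card K \<ge> 2 \<and> (J - {i}) \<union> K = I \<and> e + f = d}"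

definition minimal_model ::
    "('k::field, 'v::ab_group_add) operad \<Rightarrow> ('k, 'u::infinite \<Rightarrow>\<^sub>0 'k) operad \<Rightarrow>
     (('u \<Rightarrow>\<^sub>0 'k) \<Rightarrow> 'v) \<Rightarrow> bool" where
  "minimal_model P M \<epsilon> \<longleftrightarrow> cofibrant_resolution P M \<epsilon> \<and>
     (\<exists>B. free_on M B \<and> (\<forall>I d. \<forall>b\<in>B I (Suc d). dif M b \<in> decomposables M I d))"


section \<open>The operad of Jacobi-Jordan algebras\<close>

datatype btree = Leaf nat | Node btree btree

primrec leaves :: "btree \<Rightarrow> nat multiset" where
  "leaves (Leaf i) = {#i#}"
| "leaves (Node s t) = leaves s + leaves t"

primrec relabel :: "(nat \<Rightarrow> nat) \<Rightarrow> btree \<Rightarrow> btree" where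
  "relabel f (Leaf i) = Leaf (f i)"
| "relabel f (Node s t) = Node (relabel f s) (relabel f t)"

definition pm_linear :: "('a \<Rightarrow> ('b \<Rightarrow>\<^sub>0 'k::field)) \<Rightarrow> ('a \<Rightarrow>\<^sub>0 'k) \<Rightarrow> ('b \<Rightarrow>\<^sub>0 'k)" where
  "pm_linear f x = (\<Sum>t\<in>Poly_Mapping.keys x. pm_scale (Poly_Mapping.lookup x t) (f t))"

definition graft :: "(btree \<Rightarrow>\<^sub>0 'k::field) \<Rightarrow> (btree \<Rightarrow>\<^sub>0 'k) \<Rightarrow> (btree \<Rightarrow>\<^sub>0 'k)" where
  "graft x y = pm_linear (\<lambda>s. pm_linear (\<lambda>t. Poly_Mapping.single (Node s t) 1) y) x"

primrec subst_tree :: "nat \<Rightarrow> (btree \<Rightarrow>\<^sub>0 'k::field) \<Rightarrow> btree \<Rightarrow> (btree \<Rightarrow>\<^sub>0 'k)" where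
  "subst_tree i y (Leaf j) = (if j = i then y else Poly_Mapping.single (Leaf j) 1)"
| "subst_tree i y (Node s t) = graft (subst_tree i y s) (subst_tree i y t)"

text \<open>
  The linear combinations of binary trees whose leaves are labelled bijectively by a set \<open>I\<close> are
  the operations with input set \<open>I\<close> of the free operad on one binary operation \<open>Node\<close>; imposing
  commutativity and the Jacobi identity gives the operad of Jacobi-Jordan algebras.  The relations are
  multihomogeneous, so the operadic ideal can be formed in the span of all trees at once.
\<close>

inductive_set jj_ideal :: "(btree \<Rightarrow>\<^sub>0 'k::field) set" where
  zero: "0 \<in> jj_ideal"
| add: "x \<in> jj_ideal \<Longrightarrow> y \<in> jj_ideal \<Longrightarrow> x + y \<in> jj_ideal"
| scale: "x \<in> jj_ideal \<Longrightarrow> pm_scale c x \<in> jj_ideal"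
| comm: "Poly_Mapping.single (Node s t) 1 - Poly_Mapping.single (Node t s) 1 \<in> jj_ideal"
| jacobi: "Poly_Mapping.single (Node r (Node s t)) 1 + Poly_Mapping.single (Node s (Node t r)) 1
    + Poly_Mapping.single (Node t (Node r s)) 1 \<in> jj_ideal"
| left: "x \<in> jj_ideal \<Longrightarrow> graft (Poly_Mapping.single t 1) x \<in> jj_ideal"
| right: "x \<in> jj_ideal \<Longrightarrow> graft x (Poly_Mapping.single t 1) \<in> jj_ideal"

lemma pm_lookup_scale: "Poly_Mapping.lookup (pm_scale c x) t = c * Poly_Mapping.lookup x t"
  by (simp add: pm_scale_def map.rep_eq when_def)

lemma jj_ideal_uminus: "x \<in> jj_ideal \<Longrightarrow> - x \<in> jj_ideal"
proof -
  assume "x \<in> jj_ideal"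
  moreover have "pm_scale (- 1) x = - x"
    by (rule poly_mapping_eqI) (simp add: pm_lookup_scale)
  ultimately show ?thesis
    using jj_ideal.scale[of x "- 1"] by simp
qed

lemma pm_scale_add: "pm_scale c (x + y) = pm_scale c x + pm_scale c y"
  by (rule poly_mapping_eqI) (simp add: pm_lookup_scale lookup_add algebra_simps)

lemma pm_scale_minus: "pm_scale c (x - y) = pm_scale c x - pm_scale c y"
  by (rule poly_mapping_eqI) (simp add: pm_lookup_scale lookup_minus algebra_simps)

lemma pm_scale_simps [simp]: "pm_scale 0 x = 0" "pm_scale c 0 = 0" "pm_scale 1 x = x"
  by (auto intro!: poly_mapping_eqI simp: pm_lookup_scale)

lemma pm_scale_add_left: "pm_scale (c + d) x = pm_scale c x + pm_scale d x"
  by (rule poly_mapping_eqI) (simp add: pm_lookup_scale lookup_add algebra_simps)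

lemma pm_scale_scale: "pm_scale c (pm_scale d x) = pm_scale (c * d) x"
  by (rule poly_mapping_eqI) (simp add: pm_lookup_scale)

lemma pm_scale_sum: "pm_scale c (sum f S) = (\<Sum>t\<in>S. pm_scale c (f t))"
  by (induction S rule: infinite_finite_induct) (auto simp: pm_scale_add)

lemma pm_linear_superset:
  assumes "finite S" "Poly_Mapping.keys x \<subseteq> S"
  shows "pm_linear f x = (\<Sum>t\<in>S. pm_scale (Poly_Mapping.lookup x t) (f t))"
  unfolding pm_linear_def using assms
  by (intro sum.mono_neutral_left) (auto simp: in_keys_iff)

lemma pm_linear_add: "pm_linear f (x + y) = pm_linear f x + pm_linear f y"
proof -
  let ?S = "Poly_Mapping.keys x \<union> Poly_Mapping.keys y"
  have "Poly_Mapping.keys (x + y) \<subseteq> ?S"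
    by (rule Poly_Mapping.keys_add)
  then show ?thesis
    using pm_linear_superset[of ?S x f] pm_linear_superset[of ?S y f]
      pm_linear_superset[of ?S "x + y" f]
    by (simp add: lookup_add pm_scale_add_left sum.distrib)
qed

lemma pm_linear_scale: "pm_linear f (pm_scale c x) = pm_scale c (pm_linear f x)"
proof -
  have "Poly_Mapping.keys (pm_scale c x) \<subseteq> Poly_Mapping.keys x"
    by (auto simp: in_keys_iff pm_lookup_scale)
  then show ?thesis
    using pm_linear_superset[of "Poly_Mapping.keys x" "pm_scale c x" f]
      pm_linear_superset[of "Poly_Mapping.keys x" x f]
    by (simp add: pm_lookup_scale pm_scale_scale[symmetric] pm_scale_sum)
qed

lemma pm_linear_zero [simp]: "pm_linear f 0 = 0"
  by (simp add: pm_linear_def)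

lemma pm_linear_minus: "pm_linear f (x - y) = pm_linear f x - pm_linear f y"
  using pm_linear_add[of f "x - y" y] by simp

lemma pm_linear_sum: "pm_linear f (sum g S) = (\<Sum>t\<in>S. pm_linear f (g t))"
  by (induction S rule: infinite_finite_induct) (auto simp: pm_linear_add)

lemma pm_linear_single [simp]: "pm_linear f (Poly_Mapping.single t 1) = f t"
  by (simp add: pm_linear_def)

lemma pm_linear_fun_add: "pm_linear (\<lambda>t. f t + g t) x = pm_linear f x + pm_linear g x"
  by (simp add: pm_linear_def pm_scale_add sum.distrib)

lemma pm_linear_fun_minus: "pm_linear (\<lambda>t. f t - g t) x = pm_linear f x - pm_linear g x"
  by (simp add: pm_linear_def pm_scale_minus sum_subtractf)

lemma pm_linear_pm_linear: "pm_linear f (pm_linear g x) = pm_linear (\<lambda>t. pm_linear f (g t)) x"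
  by (simp add: pm_linear_def[of g] pm_linear_def[of _ x] pm_linear_sum pm_linear_scale)

lemma pm_linear_swap:
  "pm_linear (\<lambda>s. pm_linear (f s) y) x = pm_linear (\<lambda>t. pm_linear (\<lambda>s. f s t) x) y"
  unfolding pm_linear_def
  by (simp add: pm_scale_sum pm_scale_scale mult.commute) (rule sum.swap)

lemma graft_minus_left: "graft (x - x') y = graft x y - graft x' y"
  by (simp add: graft_def pm_linear_minus)

lemma graft_minus_right: "graft x (y - y') = graft x y - graft x y'"
  by (simp add: graft_def pm_linear_minus pm_linear_fun_minus)

lemma graft_linear_left: "graft (pm_linear f x) y = pm_linear (\<lambda>t. graft (f t) y) x"
  by (simp add: graft_def pm_linear_pm_linear)

lemma graft_linear_right: "graft y (pm_linear f x) = pm_linear (\<lambda>t. graft y (f t)) x"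
  by (simp add: graft_def pm_linear_pm_linear)
     (rule pm_linear_swap)

lemma pm_linear_id: "pm_linear (\<lambda>t. Poly_Mapping.single t 1) x = x"
proof (rule poly_mapping_eqI)
  fix t
  have *: "Poly_Mapping.lookup (sum g S) t = (\<Sum>s\<in>S. Poly_Mapping.lookup (g s) t)"
    for g :: "'a \<Rightarrow> ('a \<Rightarrow>\<^sub>0 'b)" and S
    by (induction S rule: infinite_finite_induct) (auto simp: lookup_add)
  show "Poly_Mapping.lookup (pm_linear (\<lambda>t. Poly_Mapping.single t 1) x) t = Poly_Mapping.lookup x t"
    by (simp add: pm_linear_def * pm_lookup_scale lookup_single when_def in_keys_iff
        if_distrib cong: if_cong)
qed

lemma jj_ideal_minus: "x \<in> jj_ideal \<Longrightarrow> y \<in> jj_ideal \<Longrightarrow> x - y \<in> jj_ideal"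
  using jj_ideal.add[of x "- y"] jj_ideal_uminus[of y] by simp

lemma jj_ideal_sum: "(\<And>t. t \<in> S \<Longrightarrow> f t \<in> jj_ideal) \<Longrightarrow> sum f S \<in> jj_ideal"
  by (induction S rule: infinite_finite_induct) (auto intro: jj_ideal.zero jj_ideal.add)

lemma jj_ideal_linear: "(\<And>t. f t \<in> jj_ideal) \<Longrightarrow> pm_linear f x \<in> jj_ideal"
  unfolding pm_linear_def
  by (rule jj_ideal_sum) (simp add: jj_ideal.scale)

lemma jj_ideal_graft:
  assumes "x \<in> jj_ideal"
  shows "graft y x \<in> jj_ideal" "graft x y \<in> jj_ideal"
proof -
  have "graft (pm_linear (\<lambda>t. Poly_Mapping.single t 1) y) x \<in> jj_ideal"
    unfolding graft_linear_left by (intro jj_ideal_linear jj_ideal.left assms)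
  then show "graft y x \<in> jj_ideal" by (simp add: pm_linear_id)
  have "graft x (pm_linear (\<lambda>t. Poly_Mapping.single t 1) y) \<in> jj_ideal"
    unfolding graft_linear_right by (intro jj_ideal_linear jj_ideal.right assms)
  then show "graft x y \<in> jj_ideal" by (simp add: pm_linear_id)
qed

lemma jj_ideal_comm: "graft x y - graft y x \<in> jj_ideal"
  unfolding graft_def pm_linear_swap[of _ x y] pm_linear_fun_minus[symmetric]
  by (intro jj_ideal_linear jj_ideal.comm)

lemma jj_ideal_jacobi:
  "graft x (graft y z) + graft y (graft z x) + graft z (graft x y) \<in> jj_ideal"
proof -
  let ?f = "\<lambda>r s t. Poly_Mapping.single (Node r (Node s t)) (1::'a)"
  have *: "graft x (graft y z) = pm_linear (\<lambda>r. pm_linear (\<lambda>s. pm_linear (\<lambda>t. ?f r s t) z) y) x"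
    for x y z :: "btree \<Rightarrow>\<^sub>0 'a"
    by (simp add: graft_def pm_linear_pm_linear)
  have 2: "graft y (graft z x) = pm_linear (\<lambda>r. pm_linear (\<lambda>s. pm_linear (\<lambda>t. ?f s t r) z) y) x"
    unfolding * pm_linear_swap[of _ x z] pm_linear_swap[of _ x y] ..
  have 3: "graft z (graft x y) = pm_linear (\<lambda>r. pm_linear (\<lambda>s. pm_linear (\<lambda>t. ?f t r s) z) y) x"
    unfolding * pm_linear_swap[of _ x z] pm_linear_swap[of _ y z] ..
  show ?thesis
    unfolding 2 3 unfolding * pm_linear_fun_add[symmetric]
    by (intro jj_ideal_linear jj_ideal.jacobi)
qed

lemma pm_linear_graft:
  "pm_linear f (graft x y) = pm_linear (\<lambda>s. pm_linear (\<lambda>t. f (Node s t)) y) x"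
  by (simp add: graft_def pm_linear_pm_linear)

lemma pm_linear_subst_graft:
  "pm_linear (subst_tree i y) (graft x x') =
   graft (pm_linear (subst_tree i y) x) (pm_linear (subst_tree i y) x')"
  by (simp add: pm_linear_graft graft_linear_left graft_linear_right)
     (rule pm_linear_swap)

lemma jj_ideal_subst:
  assumes "x \<in> jj_ideal"
  shows "pm_linear (subst_tree i y) x \<in> jj_ideal"
  using assms
  by (induction rule: jj_ideal.induct)
     (auto simp: pm_linear_add pm_linear_minus pm_linear_scale pm_linear_subst_graft
        intro: jj_ideal.zero jj_ideal.add jj_ideal.scale jj_ideal_comm jj_ideal_jacobi jj_ideal_graft)

lemma jj_ideal_subst_tree:
  assumes "y - y' \<in> jj_ideal"
  shows "subst_tree i y t - subst_tree i y' t \<in> jj_ideal"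
proof (induction t)
  case (Leaf j)
  then show ?case by (auto simp: assms jj_ideal.zero)
next
  case (Node s t)
  have "subst_tree i y (Node s t) - subst_tree i y' (Node s t) =
      graft (subst_tree i y s - subst_tree i y' s) (subst_tree i y t)
      + graft (subst_tree i y' s) (subst_tree i y t - subst_tree i y' t)"
    by (simp add: graft_minus_left graft_minus_right)
  then show ?case
    using Node by (simp add: jj_ideal.add jj_ideal_graft)
qed

definition relabel_vec :: "(nat \<Rightarrow> nat) \<Rightarrow> (btree \<Rightarrow>\<^sub>0 'k::field) \<Rightarrow> (btree \<Rightarrow>\<^sub>0 'k)" where
  "relabel_vec f = pm_linear (\<lambda>t. Poly_Mapping.single (relabel f t) 1)"

lemma relabel_vec_graft: "relabel_vec f (graft x y) = graft (relabel_vec f x) (relabel_vec f y)"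
  by (simp add: relabel_vec_def pm_linear_graft graft_def pm_linear_pm_linear)

lemma jj_ideal_relabel: "x \<in> jj_ideal \<Longrightarrow> relabel_vec f x \<in> jj_ideal"
proof (induction rule: jj_ideal.induct)
  case (left x t)
  then show ?case
    by (subst relabel_vec_graft) (simp add: jj_ideal_graft)
next
  case (right x t)
  then show ?case
    by (subst relabel_vec_graft) (simp add: jj_ideal_graft)
qed (auto simp: relabel_vec_def pm_linear_add pm_linear_minus pm_linear_scale
        intro: jj_ideal.intros)

quotient_type (overloaded) 'k jjvec = "btree \<Rightarrow>\<^sub>0 'k::field" / "\<lambda>x y. x - y \<in> jj_ideal"
proof (rule equivpI)
  show "reflp (\<lambda>x y :: btree \<Rightarrow>\<^sub>0 'k. x - y \<in> jj_ideal)"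
    by (simp add: reflp_def jj_ideal.zero)
  show "symp (\<lambda>x y :: btree \<Rightarrow>\<^sub>0 'k. x - y \<in> jj_ideal)"
    using jj_ideal_uminus by (fastforce simp: symp_def)
  show "transp (\<lambda>x y :: btree \<Rightarrow>\<^sub>0 'k. x - y \<in> jj_ideal)"
    using jj_ideal.add by (fastforce simp: transp_def)
qed

instantiation jjvec :: (field) ab_group_add
begin

lift_definition zero_jjvec :: "'a jjvec" is "0" .

lift_definition plus_jjvec :: "'a jjvec \<Rightarrow> 'a jjvec \<Rightarrow> 'a jjvec" is "(+)"
  by (metis add_diff_add jj_ideal.add)

lift_definition uminus_jjvec :: "'a jjvec \<Rightarrow> 'a jjvec" is "uminus"
  by (metis jj_ideal_uminus minus_diff_minus)

lift_definition minus_jjvec :: "'a jjvec \<Rightarrow> 'a jjvec \<Rightarrow> 'a jjvec" is "(-)"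
proof -
  fix a b c d :: "btree \<Rightarrow>\<^sub>0 'a"
  assume "a - b \<in> jj_ideal" "c - d \<in> jj_ideal"
  then have "(a - b) - (c - d) \<in> jj_ideal" by (rule jj_ideal_minus)
  then show "(a - c) - (b - d) \<in> jj_ideal" by (simp add: algebra_simps)
qed

instance
  by standard (transfer, simp add: jj_ideal.zero algebra_simps)+

end

lift_definition jj_scale :: "'k::field \<Rightarrow> 'k jjvec \<Rightarrow> 'k jjvec" is pm_scale
  by (simp add: pm_scale_minus[symmetric] jj_ideal.scale)

lift_definition jj_comp :: "nat \<Rightarrow> 'k::field jjvec \<Rightarrow> 'k jjvec \<Rightarrow> 'k jjvec" is
  "\<lambda>i x y. pm_linear (subst_tree i y) x"
proof -
  fix i and x x' y y' :: "btree \<Rightarrow>\<^sub>0 'k"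
  assume "x - x' \<in> jj_ideal" and y: "y - y' \<in> jj_ideal"
  then have "pm_linear (subst_tree i y) (x - x') +
      pm_linear (\<lambda>t. subst_tree i y t - subst_tree i y' t) x' \<in> jj_ideal"
    by (intro jj_ideal.add jj_ideal_subst jj_ideal_linear jj_ideal_subst_tree)
  then show "pm_linear (subst_tree i y) x - pm_linear (subst_tree i y') x' \<in> jj_ideal"
    by (simp add: pm_linear_minus pm_linear_fun_minus)
qed

lift_definition jj_relabel :: "(nat \<Rightarrow> nat) \<Rightarrow> 'k::field jjvec \<Rightarrow> 'k jjvec" is relabel_vec
  using jj_ideal_relabel by (fastforce simp: relabel_vec_def pm_linear_minus[symmetric])

lift_definition jj_leaf :: "nat \<Rightarrow> 'k::field jjvec" is "\<lambda>i. Poly_Mapping.single (Leaf i) 1" .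

definition jj_multilinear :: "nat set \<Rightarrow> 'k::field jjvec set" where
  "jj_multilinear I = abs_jjvec ` {x. \<forall>t\<in>Poly_Mapping.keys x. finite I \<and> leaves t = mset_set I}"

definition JJss :: "('k::field, 'k jjvec) operad" where
  "JJss = \<lparr>ops = (\<lambda>I d. if d = 0 then jj_multilinear I else {0}), scl = jj_scale, pcomp = jj_comp,
     ren = jj_relabel, idt = jj_leaf, dif = (\<lambda>_. 0)\<rparr>"

definition jacobi_jordan_algebra ::
    "('k::field \<Rightarrow> 'a::ab_group_add \<Rightarrow> 'a) \<Rightarrow> ('a \<Rightarrow> 'a \<Rightarrow> 'a) \<Rightarrow> bool" where
  "jacobi_jordan_algebra s mul \<longleftrightarrow> vector_space s \<and>
     (\<forall>x y z. mul (x + y) z = mul x z + mul y z) \<and> (\<forall>c x y. mul (s c x) y = s c (mul x y)) \<and>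
     (\<forall>x y. mul x y = mul y x) \<and>
     (\<forall>x y z. mul x (mul y z) + mul y (mul z x) + mul z (mul x y) = 0)"


section \<open>The deformation cohomology of a Jacobi-Jordan algebra\<close>

text \<open>
  The endomorphism operad of a vector space: operations with input set \<open>I\<close> are the functions of a
  family of vectors that depend only, and multilinearly, on the members of the family with
  index in \<open>I\<close>.
\<close>

definition multilinear_on ::
    "('k \<Rightarrow> 'a::ab_group_add \<Rightarrow> 'a) \<Rightarrow> nat set \<Rightarrow> ((nat \<Rightarrow> 'a) \<Rightarrow> 'a) \<Rightarrow> bool" where
  "multilinear_on s I F \<longleftrightarrow>
     (\<forall>a b. (\<forall>i\<in>I. a i = b i) \<longrightarrow> F a = F b) \<and>
     (\<forall>a. \<forall>i\<in>I. \<forall>x y. F (a(i := x + y)) = F (a(i := x)) + F (a(i := y))) \<and>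
     (\<forall>a. \<forall>i\<in>I. \<forall>c x. F (a(i := s c x)) = s c (F (a(i := x))))"

definition End_op ::
    "('k \<Rightarrow> 'a::ab_group_add \<Rightarrow> 'a) \<Rightarrow> ('k, (nat \<Rightarrow> 'a) \<Rightarrow> 'a) operad" where
  "End_op s = \<lparr>
     ops = (\<lambda>I d. if d = 0 \<and> finite I \<and> I \<noteq> {} then {F. multilinear_on s I F} else {0}),
     scl = (\<lambda>c F a. s c (F a)),
     pcomp = (\<lambda>i F G a. F (a(i := G a))),
     ren = (\<lambda>f F a. F (a \<circ> f)),
     idt = (\<lambda>i a. a i),
     dif = (\<lambda>_. 0)\<rparr>"

primrec eval_tree :: "('a \<Rightarrow> 'a \<Rightarrow> 'a) \<Rightarrow> (nat \<Rightarrow> 'a) \<Rightarrow> btree \<Rightarrow> 'a" where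
  "eval_tree mul a (Leaf i) = a i"
| "eval_tree mul a (Node t u) = mul (eval_tree mul a t) (eval_tree mul a u)"

text \<open>
  The structure of an algebra over \<^const>\<open>JJss\<close> on a Jacobi-Jordan algebra; the value does not
  depend on the representative.
\<close>

definition jj_action ::
    "('k::field \<Rightarrow> 'a::ab_group_add \<Rightarrow> 'a) \<Rightarrow> ('a \<Rightarrow> 'a \<Rightarrow> 'a) \<Rightarrow> 'k jjvec \<Rightarrow> (nat \<Rightarrow> 'a) \<Rightarrow> 'a" where
  "jj_action s mul x a =
     (\<Sum>t\<in>Poly_Mapping.keys (rep_jjvec x). s (Poly_Mapping.lookup (rep_jjvec x) t) (eval_tree mul a t))"

text \<open>
  Derivations from \<open>M\<close> to \<open>End_op s\<close> along a morphism \<open>\<rho>\<close> that are nonzero in degree \<open>k\<close> only.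
  As \<open>End_op s\<close> lives in degree 0, these are all derivations lowering the degree by \<open>k\<close>,
  and the Leibniz rule carries no sign: the second summand vanishes unless \<open>x\<close> has degree 0.
\<close>

definition derivations ::
    "('k \<Rightarrow> 'a::ab_group_add \<Rightarrow> 'a) \<Rightarrow> ('k, 'v::ab_group_add) operad \<Rightarrow>
     ('v \<Rightarrow> (nat \<Rightarrow> 'a) \<Rightarrow> 'a) \<Rightarrow> nat \<Rightarrow> ('v \<Rightarrow> (nat \<Rightarrow> 'a) \<Rightarrow> 'a) set" where
  "derivations s M \<rho> k = {\<theta>.
     (\<forall>x. x \<notin> (\<Union>I. ops M I k) \<longrightarrow> \<theta> x = 0) \<and>
     (\<forall>I. \<forall>x\<in>ops M I k. \<theta> x \<in> ops (End_op s) I 0) \<and>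
     (\<forall>I. \<forall>x\<in>ops M I k. \<forall>y\<in>ops M I k. \<theta> (x + y) = \<theta> x + \<theta> y) \<and>
     (\<forall>I c. \<forall>x\<in>ops M I k. \<theta> (scl M c x) = scl (End_op s) c (\<theta> x)) \<and>
     (\<forall>I f. \<forall>x\<in>ops M I k. inj_on f I \<longrightarrow> \<theta> (ren M f x) = ren (End_op s) f (\<theta> x)) \<and>
     (\<forall>I d J e i. \<forall>x\<in>ops M I d. \<forall>y\<in>ops M J e. i \<in> I \<and> J \<inter> (I - {i}) = {} \<longrightarrow>
        \<theta> (pcomp M i x y) = pcomp (End_op s) i (\<theta> x) (\<rho> y) + pcomp (End_op s) i (\<rho> x) (\<theta> y))}"

definition inner_derivation ::
    "('k, 'v::ab_group_add) operad \<Rightarrow> ('v \<Rightarrow> (nat \<Rightarrow> 'a::ab_group_add) \<Rightarrow> 'a) \<Rightarrow> ('a \<Rightarrow> 'a) \<Rightarrow>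
     'v \<Rightarrow> (nat \<Rightarrow> 'a) \<Rightarrow> 'a" where
  "inner_derivation M \<rho> f x =
     (if \<exists>I. x \<in> ops M I 0
      then (\<lambda>a. f (\<rho> x a) - (\<Sum>i\<in>(SOME I. x \<in> ops M I 0). \<rho> x (a(i := f (a i)))))
      else 0)"

text \<open>
  The deformation complex of an algebra, given by \<open>\<rho>\<close>, with coefficients in itself, built from
  the resolution \<open>M\<close>: \<open>C\<^sup>1 = Hom(A, A)\<close> and \<open>C\<^bsup>k+2\<^esup>\<close> is the space of derivations of
  degree \<open>k\<close>.  A cochain is represented by a pair whose first component is zero unless the
  cochain has degree 1, and whose second component is zero if it has degree 1.
\<close>

fun def_cochains ::
    "('k \<Rightarrow> 'a::ab_group_add \<Rightarrow> 'a) \<Rightarrow> ('k, 'v::ab_group_add) operad \<Rightarrow>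
     ('v \<Rightarrow> (nat \<Rightarrow> 'a) \<Rightarrow> 'a) \<Rightarrow> nat \<Rightarrow> (('a \<Rightarrow> 'a) \<times> ('v \<Rightarrow> (nat \<Rightarrow> 'a) \<Rightarrow> 'a)) set" where
  "def_cochains s M \<rho> 0 = {0}"
| "def_cochains s M \<rho> (Suc 0) =
     {f. (\<forall>x y. f (x + y) = f x + f y) \<and> (\<forall>c x. f (s c x) = s c (f x))} \<times> {0}"
| "def_cochains s M \<rho> (Suc (Suc k)) = {0} \<times> derivations s M \<rho> k"

fun def_differential ::
    "('k, 'v::ab_group_add) operad \<Rightarrow> ('v \<Rightarrow> (nat \<Rightarrow> 'a::ab_group_add) \<Rightarrow> 'a) \<Rightarrow> nat \<Rightarrow>
     ('a \<Rightarrow> 'a) \<times> ('v \<Rightarrow> (nat \<Rightarrow> 'a) \<Rightarrow> 'a) \<Rightarrow> ('a \<Rightarrow> 'a) \<times> ('v \<Rightarrow> (nat \<Rightarrow> 'a) \<Rightarrow> 'a)" where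
  "def_differential M \<rho> 0 _ = 0"
| "def_differential M \<rho> (Suc 0) (f, \<theta>) = (0, inner_derivation M \<rho> f)"
| "def_differential M \<rho> (Suc (Suc k)) (f, \<theta>) =
     (0, \<lambda>x. if x \<in> (\<Union>I. ops M I (Suc k)) then \<theta> (dif M x) else 0)"

definition def_cocycles ::
    "('k \<Rightarrow> 'a::ab_group_add \<Rightarrow> 'a) \<Rightarrow> ('k, 'v::ab_group_add) operad \<Rightarrow>
     ('v \<Rightarrow> (nat \<Rightarrow> 'a) \<Rightarrow> 'a) \<Rightarrow> nat \<Rightarrow> (('a \<Rightarrow> 'a) \<times> ('v \<Rightarrow> (nat \<Rightarrow> 'a) \<Rightarrow> 'a)) set" where
  "def_cocycles s M \<rho> n = {c \<in> def_cochains s M \<rho> n. def_differential M \<rho> n c = 0}"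

definition def_coboundaries ::
    "('k \<Rightarrow> 'a::ab_group_add \<Rightarrow> 'a) \<Rightarrow> ('k, 'v::ab_group_add) operad \<Rightarrow>
     ('v \<Rightarrow> (nat \<Rightarrow> 'a) \<Rightarrow> 'a) \<Rightarrow> nat \<Rightarrow> (('a \<Rightarrow> 'a) \<times> ('v \<Rightarrow> (nat \<Rightarrow> 'a) \<Rightarrow> 'a)) set" where
  "def_coboundaries s M \<rho> n = def_differential M \<rho> (n - 1) ` def_cochains s M \<rho> (n - 1)"

definition cochain_scale ::
    "('k \<Rightarrow> 'a \<Rightarrow> 'a) \<Rightarrow> 'k \<Rightarrow> ('a \<Rightarrow> 'a) \<times> ('v \<Rightarrow> (nat \<Rightarrow> 'a) \<Rightarrow> 'a) \<Rightarrow>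
     ('a \<Rightarrow> 'a) \<times> ('v \<Rightarrow> (nat \<Rightarrow> 'a) \<Rightarrow> 'a)" where
  "cochain_scale s c = (\<lambda>(f, \<theta>). (\<lambda>a. s c (f a), \<lambda>x a. s c (\<theta> x a)))"

text \<open>
  Two subquotients \<open>Z/B\<close> and \<open>Z'/B'\<close> are isomorphic as vector spaces: a linear map between the
  quotients always lifts to a linear map from \<open>Z\<close> to \<open>Z'\<close>.
\<close>

definition subquotients_isomorphic ::
    "('k \<Rightarrow> 'x::ab_group_add \<Rightarrow> 'x) \<Rightarrow> 'x set \<Rightarrow> 'x set \<Rightarrow>
     ('k \<Rightarrow> 'y::ab_group_add \<Rightarrow> 'y) \<Rightarrow> 'y set \<Rightarrow> 'y set \<Rightarrow> bool" where
  "subquotients_isomorphic s Z B s' Z' B' \<longleftrightarrow> (\<exists>\<Phi>.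
     (\<forall>x\<in>Z. \<Phi> x \<in> Z') \<and>
     (\<forall>x\<in>Z. \<forall>y\<in>Z. \<Phi> (x + y) = \<Phi> x + \<Phi> y) \<and> (\<forall>c. \<forall>x\<in>Z. \<Phi> (s c x) = s' c (\<Phi> x)) \<and>
     (\<forall>x\<in>Z. \<Phi> x \<in> B' \<longleftrightarrow> x \<in> B) \<and> (\<forall>y\<in>Z'. \<exists>x\<in>Z. y - \<Phi> x \<in> B'))"

text \<open>
  The deformation cohomology of a Jacobi-Jordan algebra is the cohomology of the complex built from
  a cofibrant resolution of \<^const>\<open>JJss\<close>.  The following says that two resolutions \<open>(M, \<epsilon>)\<close>
  and \<open>(R, \<eta>)\<close> compute the same cohomology in degree \<open>n\<close>.
\<close>

definition same_deformation_cohomology ::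
    "('k::field \<Rightarrow> 'a::ab_group_add \<Rightarrow> 'a) \<Rightarrow> ('a \<Rightarrow> 'a \<Rightarrow> 'a) \<Rightarrow>
     ('k, 'v::ab_group_add) operad \<Rightarrow> ('v \<Rightarrow> 'k jjvec) \<Rightarrow>
     ('k, 'w::ab_group_add) operad \<Rightarrow> ('w \<Rightarrow> 'k jjvec) \<Rightarrow> nat \<Rightarrow> bool" where
  "same_deformation_cohomology s mul M \<epsilon> R \<eta> n \<longleftrightarrow>
     subquotients_isomorphic
       (cochain_scale s) (def_cocycles s M (jj_action s mul \<circ> \<epsilon>) n)
         (def_coboundaries s M (jj_action s mul \<circ> \<epsilon>) n)
       (cochain_scale s) (def_cocycles s R (jj_action s mul \<circ> \<eta>) n)
         (def_coboundaries s R (jj_action s mul \<circ> \<eta>) n)"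

end

theory Submission
  imports
    Defs
    "HOL-Library.Countable"
    "HOL-Computational_Algebra.Polynomial"
begin

text \<open>
  \<^emph>\<open>Failure of Koszulness.\<close> In a Jacobi-Jordan algebra the Jacobi identity gives \<open>x(xx) = 0\<close>, and then
  \<open>(xx)(xx) = - 2 x(x(xx)) = 0\<close>, so the free algebra on one generator is spanned by \<open>x\<close> and
  \<open>xx\<close>: the symmetric group has no coinvariants on \<open>JJss(n)\<close> for \<open>n \<ge> 3\<close>.  Consider the
  invariants of the symmetric group on the complex \<open>D(JJss)\<close> in arity 5.  An inner edge counts with the sign of its
  place in an order of the edges, and with this sign only five shapes of trees carry
  invariant cochains: two with four vertices, three with three vertices and none with fewer.
  Hence in the invariant part the term with three vertices has a cocycle, which cannot be a
  coboundary.  The formula for it, \<open>jj_cocycle\<close>, reads the decorations in a five-dimensional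
  algebra, the free one on \<open>x\<close> and \<open>y\<close> truncated to the words \<open>x, y, xx, xy, x(xy)\<close>: a binary vertex
  contributes its coefficient (\<open>coefU\<close>), the ternary vertex the coefficient of \<open>x(xy)\<close> when \<open>y\<close> is
  placed at one input that carries a subtree (\<open>coefW\<close>).  It is closed by a check of the three shapes of binary trees
  with five leaves (\<open>jj_cocycle_closed\<close>).  It is not exact because it takes the value 3 on the composites of
  \<open>a\<cdot>\<close>, \<open>b(c\<cdot>)\<close> and \<open>de\<close>, whereas the sum of any coboundary over all labellings \<open>a, b, c, d, e\<close> vanishes
  (\<open>jj_cocycle_not_coboundary\<close>): contracting one edge gives \<open>b(c(de))\<close>, whose cyclic sum over \<open>c, d, e\<close>
  is zero by the Jacobi identity, and contracting the other gives \<open>a(b(ck))\<close>, whose sum over the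
  permutations of \<open>a, b, c\<close> is zero in every Jacobi-Jordan algebra
  (\<open>sum_permutations_left_mult_zero\<close>).

  \<^emph>\<open>Independence of the resolution.\<close> A minimal model is in particular a cofibrant resolution, and any two
  cofibrant resolutions \<open>M\<close> and \<open>R\<close> give isomorphic cohomology.  As \<open>JJss\<close> lives in degree 0, a
  resolution is an acyclic fibration onto it, so lifting yields morphisms \<open>g : M \<rightarrow> R\<close> and
  \<open>h : R \<rightarrow> M\<close> over \<open>JJss\<close>; precomposition with them are maps between the deformation
  complexes.  They are mutually inverse on cohomology because an endomorphism \<open>w\<close> of a resolution \<open>C\<close>
  over \<open>JJss\<close> acts trivially: \<open>w\<close> is homotopic to the identity.  The homotopy is a lift of the
  identity along the acyclic fibration \<open>path_operad \<rightarrow> C\<close>, where a path from \<open>x\<close> to \<open>w x\<close> is an element of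
  \<open>C \<otimes> k[t, dt]\<close>, and integrating the \<open>dt\<close>-part of the path over \<open>[0, 1]\<close>
  turns a cocycle derivation \<open>\<theta>\<close> into a derivation \<open>\<tau>\<close> with \<open>\<theta> \<circ> w - \<theta> = \<tau> \<circ> d\<close>
  (\<open>homotopic_derivations\<close>).  Characteristic 0 enters through the integration.  The lifting property of a cofibrant
  operad speaks only of operads inside one fixed ambient space, so \<open>JJss\<close> and the path operad are
  transported into it along linear embeddings (\<open>cofibrant_lift\<close>).
\<close>

section \<open>Evaluation in a Jacobi-Jordan algebra\<close>

text \<open>
  The axioms of a Jacobi-Jordan algebra as a locale, so that its elementary consequences can also be used for
  the five-dimensional algebra below and for the space of all operations.
\<close>

locale jj_algebra = vector_space s
  for s :: "'k::field \<Rightarrow> 'a::ab_group_add \<Rightarrow> 'a" +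
  fixes mul :: "'a \<Rightarrow> 'a \<Rightarrow> 'a"
  assumes mul_add_left: "mul (x + y) z = mul x z + mul y z"
    and mul_scale_left: "mul (s c x) y = s c (mul x y)"
    and mul_commute: "mul x y = mul y x"
    and mul_jacobi: "mul x (mul y z) + mul y (mul z x) + mul z (mul x y) = 0"
begin

lemma mul_add_right: "mul z (x + y) = mul z x + mul z y"
  by (metis mul_add_left mul_commute)

lemma mul_scale_right: "mul y (s c x) = s c (mul y x)"
  by (metis mul_scale_left mul_commute)

lemma mul_zero_left [simp]: "mul 0 x = 0"
  using mul_add_left[of 0 0 x] by simp

lemma mul_zero_right [simp]: "mul x 0 = 0"
  by (metis mul_zero_left mul_commute)

lemma mul_sum_left: "mul (sum f S) y = (\<Sum>t\<in>S. mul (f t) y)"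
  by (induction S rule: infinite_finite_induct) (auto simp: mul_add_left)

lemma mul_sum_right: "mul y (sum f S) = (\<Sum>t\<in>S. mul y (f t))"
  by (induction S rule: infinite_finite_induct) (auto simp: mul_add_right)

definition eval_comb :: "(btree \<Rightarrow>\<^sub>0 'k) \<Rightarrow> (nat \<Rightarrow> 'a) \<Rightarrow> 'a" where
  "eval_comb x a = (\<Sum>t\<in>Poly_Mapping.keys x. s (Poly_Mapping.lookup x t) (eval_tree mul a t))"

lemma eval_comb_superset:
  assumes "finite S" "Poly_Mapping.keys x \<subseteq> S"
  shows "eval_comb x a = (\<Sum>t\<in>S. s (Poly_Mapping.lookup x t) (eval_tree mul a t))"
  unfolding eval_comb_def using assms
  by (intro sum.mono_neutral_left) (auto simp: in_keys_iff)

lemma eval_comb_zero [simp]: "eval_comb 0 a = 0"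
  by (simp add: eval_comb_def)

lemma eval_comb_add: "eval_comb (x + y) a = eval_comb x a + eval_comb y a"
proof -
  let ?S = "Poly_Mapping.keys x \<union> Poly_Mapping.keys y"
  have "Poly_Mapping.keys (x + y) \<subseteq> ?S"
    by (rule Poly_Mapping.keys_add)
  then show ?thesis
    using eval_comb_superset[of ?S x a] eval_comb_superset[of ?S y a]
      eval_comb_superset[of ?S "x + y" a]
    by (simp add: lookup_add scale_left_distrib sum.distrib)
qed

lemma eval_comb_scale: "eval_comb (pm_scale c x) a = s c (eval_comb x a)"
proof -
  have "Poly_Mapping.keys (pm_scale c x) \<subseteq> Poly_Mapping.keys x"
    by (auto simp: in_keys_iff pm_lookup_scale)
  then show ?thesis
    using eval_comb_superset[of "Poly_Mapping.keys x" "pm_scale c x" a]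
      eval_comb_superset[of "Poly_Mapping.keys x" x a]
    by (simp add: pm_lookup_scale scale_sum_right)
qed

lemma eval_comb_minus: "eval_comb (x - y) a = eval_comb x a - eval_comb y a"
  using eval_comb_add[of "x - y" y a] by (simp add: algebra_simps)

lemma eval_comb_sum: "eval_comb (sum f S) a = (\<Sum>t\<in>S. eval_comb (f t) a)"
  by (induction S rule: infinite_finite_induct) (auto simp: eval_comb_add)

lemma eval_comb_single [simp]: "eval_comb (Poly_Mapping.single t 1) a = eval_tree mul a t"
  by (simp add: eval_comb_def)

lemma eval_comb_linear:
  "eval_comb (pm_linear f x) a
    = (\<Sum>t\<in>Poly_Mapping.keys x. s (Poly_Mapping.lookup x t) (eval_comb (f t) a))"
  by (simp add: pm_linear_def eval_comb_sum eval_comb_scale)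

lemma eval_comb_graft: "eval_comb (graft x y) a = mul (eval_comb x a) (eval_comb y a)"
  unfolding graft_def eval_comb_linear eval_comb_single eval_comb_def[of x] mul_sum_left mul_scale_left
  by (simp add: eval_comb_def[of y] mul_sum_right mul_scale_right)

text \<open>
  Every Jacobi-Jordan algebra satisfies the relations, so evaluation descends to the operations of the operad;
  in the sequel values are computed on arbitrary representatives.
\<close>

lemma eval_comb_ideal: "x \<in> jj_ideal \<Longrightarrow> eval_comb x a = 0"
proof (induction rule: jj_ideal.induct)
  case (comm t u)
  then show ?case by (simp add: eval_comb_minus mul_commute)
next
  case (jacobi t u v)
  then show ?case by (simp add: eval_comb_add mul_jacobi)
qed (auto simp: eval_comb_add eval_comb_scale eval_comb_graft)

lemma jj_action_abs: "jj_action s mul (abs_jjvec x) a = eval_comb x a"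
proof -
  have "rep_jjvec (abs_jjvec x) - x \<in> jj_ideal"
    using Quotient3_abs_rep[OF Quotient3_jjvec, of "abs_jjvec x"] by (simp add: jjvec.abs_eq_iff)
  then have "eval_comb (rep_jjvec (abs_jjvec x)) a = eval_comb x a"
    using eval_comb_ideal[of "rep_jjvec (abs_jjvec x) - x" a] by (simp add: eval_comb_minus)
  then show ?thesis
    by (simp add: jj_action_def eval_comb_def)
qed

lemma eval_subst_tree:
  "eval_comb (subst_tree i y t) a = eval_tree mul (a(i := eval_comb y a)) t"
  by (induction t) (auto simp: eval_comb_graft)

lemma jj_action_add: "jj_action s mul (x + y) a = jj_action s mul x a + jj_action s mul y a"
proof (induction x; induction y)
  fix x y :: "btree \<Rightarrow>\<^sub>0 'k"
  show "jj_action s mul (abs_jjvec x + abs_jjvec y) a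
      = jj_action s mul (abs_jjvec x) a + jj_action s mul (abs_jjvec y) a"
    by (simp add: jj_action_abs plus_jjvec.abs_eq eval_comb_add)
qed

lemma jj_action_scale: "jj_action s mul (jj_scale c x) a = s c (jj_action s mul x a)"
proof (induction x)
  fix x :: "btree \<Rightarrow>\<^sub>0 'k"
  show "jj_action s mul (jj_scale c (abs_jjvec x)) a = s c (jj_action s mul (abs_jjvec x) a)"
    by (simp add: jj_action_abs jj_scale.abs_eq eval_comb_scale)
qed

lemma jj_action_zero [simp]: "jj_action s mul 0 a = 0"
  using jj_action_add[of 0 0 a] by simp

lemma jj_action_comp:
  "jj_action s mul (jj_comp i x y) a = jj_action s mul x (a(i := jj_action s mul y a))"
proof (induction x; induction y)
  fix x y :: "btree \<Rightarrow>\<^sub>0 'k"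
  show "jj_action s mul (jj_comp i (abs_jjvec x) (abs_jjvec y)) a
      = jj_action s mul (abs_jjvec x) (a(i := jj_action s mul (abs_jjvec y) a))"
    by (simp add: jj_action_abs jj_comp.abs_eq eval_comb_linear eval_subst_tree)
       (simp add: eval_comb_def)
qed

lemma eval_tree_upd_other: "i \<notin># leaves t \<Longrightarrow> eval_tree mul (a(i := x)) t = eval_tree mul a t"
  by (induction t) auto

lemma eval_tree_cong: "(\<And>i. i \<in># leaves t \<Longrightarrow> a i = b i) \<Longrightarrow> eval_tree mul a t = eval_tree mul b t"
  by (induction t) auto

text \<open>
  The leaf \<open>i\<close> occurs once, so exactly one factor of each product on the way to it depends on the
  input \<open>i\<close>.
\<close>

lemma eval_tree_linear:
  assumes "count (leaves t) i = 1"
  shows "eval_tree mul (a(i := x + y)) t = eval_tree mul (a(i := x)) t + eval_tree mul (a(i := y)) t"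
    and "eval_tree mul (a(i := s c x)) t = s c (eval_tree mul (a(i := x)) t)"
proof -
  have "eval_tree mul (a(i := x + y)) t = eval_tree mul (a(i := x)) t + eval_tree mul (a(i := y)) t
      \<and> eval_tree mul (a(i := s c x)) t = s c (eval_tree mul (a(i := x)) t)"
    using assms
  proof (induction t)
    case (Leaf j)
    then show ?case by (auto split: if_splits)
  next
    case (Node t u)
    then consider "count (leaves t) i = 1" "i \<notin># leaves u" | "count (leaves u) i = 1" "i \<notin># leaves t"
      by (auto simp: not_in_iff add_is_1)
    then show ?case
    proof cases
      case 1
      then show ?thesis
        using Node.IH(1) unfolding eval_tree.simps eval_tree_upd_other[OF 1(2)]
        by (simp only: mul_add_left mul_scale_left)
    next
      case 2
      then show ?thesis
        using Node.IH(2) unfolding eval_tree.simps eval_tree_upd_other[OF 2(2)]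
        by (simp only: mul_add_right mul_scale_right)
    qed
  qed
  then show "eval_tree mul (a(i := x + y)) t = eval_tree mul (a(i := x)) t + eval_tree mul (a(i := y)) t"
    and "eval_tree mul (a(i := s c x)) t = s c (eval_tree mul (a(i := x)) t)"
    by auto
qed

lemma jj_action_multilinear:
  assumes "x \<in> jj_multilinear I"
  shows "multilinear_on s I (jj_action s mul x)"
proof -
  obtain y where x: "x = abs_jjvec y"
    and y: "\<And>t. t \<in> Poly_Mapping.keys y \<Longrightarrow> finite I \<and> leaves t = mset_set I"
    using assms by (auto simp: jj_multilinear_def)
  have *: "count (leaves t) i = 1" if "t \<in> Poly_Mapping.keys y" "i \<in> I" for t i
    using y[OF that(1)] that(2) by simp
  have cong: "eval_tree mul a t = eval_tree mul b t"
    if "\<And>i. i \<in> I \<Longrightarrow> a i = b i" "t \<in> Poly_Mapping.keys y" for a b t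
    by (rule eval_tree_cong) (use y[OF that(2)] that(1) in auto)
  note eqs = eval_tree_linear[OF *]
  show ?thesis
    unfolding multilinear_on_def x jj_action_abs eval_comb_def
  proof (intro conjI allI impI ballI)
    fix a b :: "nat \<Rightarrow> 'a" assume "\<forall>i\<in>I. a i = b i"
    then show "(\<Sum>t\<in>Poly_Mapping.keys y. s (Poly_Mapping.lookup y t) (eval_tree mul a t))
        = (\<Sum>t\<in>Poly_Mapping.keys y. s (Poly_Mapping.lookup y t) (eval_tree mul b t))"
      using cong by (intro sum.cong refl) (metis (no_types, lifting))
  next
    fix a :: "nat \<Rightarrow> 'a" and i z z' assume "i \<in> I"
    then show "(\<Sum>t\<in>Poly_Mapping.keys y. s (Poly_Mapping.lookup y t) (eval_tree mul (a(i := z + z')) t))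
        = (\<Sum>t\<in>Poly_Mapping.keys y. s (Poly_Mapping.lookup y t) (eval_tree mul (a(i := z)) t))
          + (\<Sum>t\<in>Poly_Mapping.keys y. s (Poly_Mapping.lookup y t) (eval_tree mul (a(i := z')) t))"
      unfolding sum.distrib[symmetric] by (intro sum.cong refl) (simp only: eqs scale_right_distrib)
  next
    fix a :: "nat \<Rightarrow> 'a" and i c z assume "i \<in> I"
    then show "(\<Sum>t\<in>Poly_Mapping.keys y. s (Poly_Mapping.lookup y t) (eval_tree mul (a(i := s c z)) t))
        = s c (\<Sum>t\<in>Poly_Mapping.keys y. s (Poly_Mapping.lookup y t) (eval_tree mul (a(i := z)) t))"
      unfolding scale_sum_right by (intro sum.cong refl) (simp only: eqs scale_scale mult.commute)
  qed
qed

text \<open>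
  Trees have at least one leaf, so that the operations with an empty or infinite set of inputs are zero on
  both sides.
\<close>

lemma jj_action_multilinear_End:
  assumes "x \<in> jj_multilinear I"
  shows "jj_action s mul x \<in> ops (End_op s) I 0"
proof (cases "finite I \<and> I \<noteq> {}")
  case True
  then show ?thesis
    using jj_action_multilinear[OF assms] by (simp add: End_op_def)
next
  case False
  obtain y where x: "x = abs_jjvec y"
    and y: "\<And>t. t \<in> Poly_Mapping.keys y \<Longrightarrow> finite I \<and> leaves t = mset_set I"
    using assms by (auto simp: jj_multilinear_def)
  have "leaves t \<noteq> {#}" for t by (induction t) auto
  then have "t \<notin> Poly_Mapping.keys y" for t
    using y False by (metis mset_set.empty)
  then have "y = 0" by (metis equals0I keys_eq_empty)
  then have "x = 0" using x by (simp add: zero_jjvec_def)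
  then show ?thesis using False by (auto simp: End_op_def fun_eq_iff)
qed

end

lemma jj_algebra_iff: "jacobi_jordan_algebra s mul \<longleftrightarrow> jj_algebra s mul"
  unfolding jacobi_jordan_algebra_def jj_algebra_def jj_algebra_axioms_def by auto

abbreviation jj_tree :: "btree \<Rightarrow> 'k::field jjvec" where
  "jj_tree t \<equiv> abs_jjvec (Poly_Mapping.single t 1)"

lemma abs_jjvec_sum: "abs_jjvec (sum g S) = (\<Sum>t\<in>S. abs_jjvec (g t))"
  by (induction S rule: infinite_finite_induct) (auto simp: zero_jjvec_def plus_jjvec.abs_eq[symmetric])

lemma abs_jjvec_expand:
  "abs_jjvec y = (\<Sum>t\<in>Poly_Mapping.keys y. jj_scale (Poly_Mapping.lookup y t) (jj_tree t))"
proof -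
  have "abs_jjvec y = abs_jjvec (pm_linear (\<lambda>t. Poly_Mapping.single t 1) y)"
    by (simp add: pm_linear_id)
  then show ?thesis
    by (simp add: pm_linear_def abs_jjvec_sum jj_scale.abs_eq)
qed

lemma zero_jj_multilinear: "0 \<in> jj_multilinear I"
  by (auto simp: jj_multilinear_def zero_jjvec_def intro!: image_eqI[of _ _ 0])

lemma vector_space_jj_scale: "vector_space (jj_scale :: 'k::field \<Rightarrow> _)"
proof
  fix c d :: 'k and x y :: "'k jjvec"
  show "jj_scale c (x + y) = jj_scale c x + jj_scale c y"
    by transfer (simp add: pm_scale_add jj_ideal.zero)
  show "jj_scale (c + d) x = jj_scale c x + jj_scale d x"
    by transfer (simp add: pm_scale_add_left jj_ideal.zero)
  show "jj_scale c (jj_scale d x) = jj_scale (c * d) x"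
    by transfer (simp add: pm_scale_scale jj_ideal.zero)
  show "jj_scale 1 x = x"
    by transfer (simp add: jj_ideal.zero)
qed

lemma vector_space_pm_scale: "vector_space (pm_scale :: 'k::field \<Rightarrow> ('u \<Rightarrow>\<^sub>0 'k) \<Rightarrow> _)"
  by standard (simp_all add: pm_scale_add pm_scale_add_left pm_scale_scale)

text \<open>
  The relations are multihomogeneous: the part of an element of the ideal that is spanned by the
  trees with a given multiset of leaves is again in the ideal.
\<close>

definition restrict_leaves :: "nat multiset \<Rightarrow> (btree \<Rightarrow>\<^sub>0 'k::field) \<Rightarrow> (btree \<Rightarrow>\<^sub>0 'k)" where
  "restrict_leaves m = pm_linear (\<lambda>t. if leaves t = m then Poly_Mapping.single t 1 else 0)"

lemma restrict_leaves_graft: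
  "restrict_leaves m (graft (Poly_Mapping.single t 1) x)
    = (if leaves t \<subseteq># m then graft (Poly_Mapping.single t 1) (restrict_leaves (m - leaves t) x) else 0)"
  "restrict_leaves m (graft x (Poly_Mapping.single t 1))
    = (if leaves t \<subseteq># m then graft (restrict_leaves (m - leaves t) x) (Poly_Mapping.single t 1) else 0)"
proof -
  have *: "leaves t + leaves u = m \<longleftrightarrow> leaves t \<subseteq># m \<and> leaves u = m - leaves t" for u
    by (auto simp: subset_mset.le_iff_add)
  have [simp]: "pm_linear (\<lambda>_. 0) y = 0" for y :: "btree \<Rightarrow>\<^sub>0 'k::field"
    by (simp add: pm_linear_def)
  have [simp]: "pm_linear f (if b then y else 0) = (if b then pm_linear f y else 0)"
    for f :: "btree \<Rightarrow> btree \<Rightarrow>\<^sub>0 'k::field" and b y by simp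
  show "restrict_leaves m (graft (Poly_Mapping.single t 1) x)
    = (if leaves t \<subseteq># m then graft (Poly_Mapping.single t 1) (restrict_leaves (m - leaves t) x) else 0)"
    by (simp add: restrict_leaves_def graft_def pm_linear_pm_linear * cong: if_cong)
  show "restrict_leaves m (graft x (Poly_Mapping.single t 1))
    = (if leaves t \<subseteq># m then graft (restrict_leaves (m - leaves t) x) (Poly_Mapping.single t 1) else 0)"
    by (simp add: restrict_leaves_def graft_def pm_linear_pm_linear * add.commute[of _ "leaves t"] cong: if_cong)
qed

text \<open>
  Each generator of the ideal is a combination of trees with the same leaves, and grafting a tree adds its
  leaves.
\<close>

lemma restrict_leaves_ideal: "x \<in> jj_ideal \<Longrightarrow> restrict_leaves m x \<in> jj_ideal"
proof (induction arbitrary: m rule: jj_ideal.induct)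
  case (comm t u)
  then show ?case
    by (simp add: restrict_leaves_def pm_linear_minus add.commute jj_ideal.zero jj_ideal.comm)
next
  case (jacobi r t u)
  then show ?case
    by (simp add: restrict_leaves_def pm_linear_add add_ac jj_ideal.zero jj_ideal.jacobi[simplified add_ac])
next
  case (left x t)
  then show ?case
    by (simp add: restrict_leaves_graft jj_ideal.zero jj_ideal.left)
next
  case (right x t)
  then show ?case
    by (simp add: restrict_leaves_graft jj_ideal.zero jj_ideal.right)
qed (simp_all add: restrict_leaves_def pm_linear_add pm_linear_scale jj_ideal.intros)

text \<open>
  Projecting a difference of two representatives onto the trees with leaves \<open>I\<close> returns the first
  one, modulo the ideal.
\<close>

lemma jj_multilinear_disjoint:
  assumes "I \<noteq> I'" "x \<in> jj_multilinear I" "x \<in> jj_multilinear I'"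
  shows "x = 0"
proof -
  obtain y where x: "x = abs_jjvec y"
    and y: "\<And>t. t \<in> Poly_Mapping.keys y \<Longrightarrow> finite I \<and> leaves t = mset_set I"
    using assms(2) by (auto simp: jj_multilinear_def)
  obtain y' where x': "x = abs_jjvec y'"
    and y': "\<And>t. t \<in> Poly_Mapping.keys y' \<Longrightarrow> finite I' \<and> leaves t = mset_set I'"
    using assms(3) by (auto simp: jj_multilinear_def)
  have "y - y' \<in> jj_ideal"
    using x x' jjvec.abs_eq_iff[of y y'] by simp
  then have *: "restrict_leaves (mset_set I) y - restrict_leaves (mset_set I) y' \<in> jj_ideal"
    using restrict_leaves_ideal[of "y - y'" "mset_set I"] by (simp add: restrict_leaves_def pm_linear_minus)
  have "restrict_leaves (mset_set I) y = pm_linear (\<lambda>t. Poly_Mapping.single t 1) y"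
    unfolding restrict_leaves_def pm_linear_def using y by (auto intro!: sum.cong)
  then have 1: "restrict_leaves (mset_set I) y = y"
    by (simp add: pm_linear_id)
  have 2: "restrict_leaves (mset_set I) y' = 0 \<or> y = 0"
  proof (cases "finite I")
    case True
    have "leaves t \<noteq> mset_set I" if "t \<in> Poly_Mapping.keys y'" for t
      using y'[OF that] assms(1) True by (metis finite_set_mset_mset_set)
    then show ?thesis
      unfolding restrict_leaves_def pm_linear_def by (auto intro!: sum.neutral)
  next
    case False
    then have "t \<notin> Poly_Mapping.keys y" for t
      using y by blast
    then show ?thesis by (metis equals0I keys_eq_empty)
  qed
  have "y \<in> jj_ideal"
    using * 1 2 by (auto simp: jj_ideal.zero)
  then show ?thesis
    using x by (simp add: zero_jjvec_def jjvec.abs_eq_iff)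
qed

section \<open>Images of dg operads and liftings\<close>

lemma operad_morphismD:
  assumes "operad_morphism M Q f"
  shows morphism_ops: "x \<in> ops M I d \<Longrightarrow> f x \<in> ops Q I d"
    and morphism_add: "x \<in> ops M I d \<Longrightarrow> y \<in> ops M I d \<Longrightarrow> f (x + y) = f x + f y"
    and morphism_scl: "x \<in> ops M I d \<Longrightarrow> f (scl M c x) = scl Q c (f x)"
    and morphism_ren: "x \<in> ops M I d \<Longrightarrow> inj_on g I \<Longrightarrow> f (ren M g x) = ren Q g (f x)"
    and morphism_comp: "x \<in> ops M I d \<Longrightarrow> y \<in> ops M J e \<Longrightarrow> i \<in> I \<Longrightarrow> J \<inter> (I - {i}) = {} \<Longrightarrow>
      f (pcomp M i x y) = pcomp Q i (f x) (f y)"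
    and morphism_idt: "f (idt M i) = idt Q i"
    and morphism_dif: "x \<in> ops M I d \<Longrightarrow> f (dif M x) = dif Q (f x)"
proof -
  note m = assms[unfolded operad_morphism_def]
  show "x \<in> ops M I d \<Longrightarrow> f x \<in> ops Q I d"
    by (rule m[THEN conjunct1, rule_format])
  show "x \<in> ops M I d \<Longrightarrow> y \<in> ops M I d \<Longrightarrow> f (x + y) = f x + f y"
    by (rule m[THEN conjunct2, THEN conjunct1, rule_format])
  show "x \<in> ops M I d \<Longrightarrow> f (scl M c x) = scl Q c (f x)"
    by (rule m[THEN conjunct2, THEN conjunct2, THEN conjunct1, rule_format])
  show "x \<in> ops M I d \<Longrightarrow> inj_on g I \<Longrightarrow> f (ren M g x) = ren Q g (f x)"
    by (rule m[THEN conjunct2, THEN conjunct2, THEN conjunct2, THEN conjunct1, rule_format])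
  show "x \<in> ops M I d \<Longrightarrow> y \<in> ops M J e \<Longrightarrow> i \<in> I \<Longrightarrow> J \<inter> (I - {i}) = {} \<Longrightarrow>
      f (pcomp M i x y) = pcomp Q i (f x) (f y)"
    using m[THEN conjunct2, THEN conjunct2, THEN conjunct2, THEN conjunct2, THEN conjunct1, rule_format, of x I d y J e i]
    by simp
  show "f (idt M i) = idt Q i"
    by (rule m[THEN conjunct2, THEN conjunct2, THEN conjunct2, THEN conjunct2, THEN conjunct2,
          THEN conjunct1, rule_format])
  show "x \<in> ops M I d \<Longrightarrow> f (dif M x) = dif Q (f x)"
    by (rule m[THEN conjunct2, THEN conjunct2, THEN conjunct2, THEN conjunct2, THEN conjunct2,
          THEN conjunct2, rule_format])
qed

lemma operad_morphismI:
  assumes "\<And>I d x. x \<in> ops M I d \<Longrightarrow> f x \<in> ops Q I d"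
    and "\<And>I d x y. x \<in> ops M I d \<Longrightarrow> y \<in> ops M I d \<Longrightarrow> f (x + y) = f x + f y"
    and "\<And>I d c x. x \<in> ops M I d \<Longrightarrow> f (scl M c x) = scl Q c (f x)"
    and "\<And>I d g x. x \<in> ops M I d \<Longrightarrow> inj_on g I \<Longrightarrow> f (ren M g x) = ren Q g (f x)"
    and "\<And>I d J e i x y. x \<in> ops M I d \<Longrightarrow> y \<in> ops M J e \<Longrightarrow> i \<in> I \<Longrightarrow> J \<inter> (I - {i}) = {} \<Longrightarrow>
      f (pcomp M i x y) = pcomp Q i (f x) (f y)"
    and "\<And>i. f (idt M i) = idt Q i"
    and "\<And>I d x. x \<in> ops M I d \<Longrightarrow> f (dif M x) = dif Q (f x)"
  shows "operad_morphism M Q f"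
  unfolding operad_morphism_def
  by (intro conjI allI ballI impI; (elim conjE)?) (rule assms; assumption)+

lemma operad_morphism_comp:
  assumes "operad_morphism M Q f" "operad_morphism Q S g"
  shows "operad_morphism M S (g \<circ> f)"
proof -
  note f = operad_morphismD[OF assms(1)] and g = operad_morphismD[OF assms(2)]
  show ?thesis
    by (rule operad_morphismI; unfold comp_apply)
       (simp_all add: f(1,6) f(2)[of _ _ _] f(3) f(4) f(5) f(7) g(1,6)
          g(2)[OF f(1) f(1)] g(3)[OF f(1)] g(4)[OF f(1)] g(5)[OF f(1) f(1)] g(7)[OF f(1)])
qed

lemma operad_morphism_id: "operad_morphism M M id"
  by (simp add: operad_morphism_def)

context dg_operad
begin

lemma ops_zero [simp]: "0 \<in> ops M I d"
  using ops_subspace subspace_0 by blast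

lemma ops_add: "x \<in> ops M I d \<Longrightarrow> y \<in> ops M I d \<Longrightarrow> x + y \<in> ops M I d"
  using ops_subspace subspace_add by blast

lemma ops_diff: "x \<in> ops M I d \<Longrightarrow> y \<in> ops M I d \<Longrightarrow> x - y \<in> ops M I d"
  using ops_subspace subspace_diff by blast

lemma ops_uminus: "x \<in> ops M I d \<Longrightarrow> - x \<in> ops M I d"
  using ops_subspace subspace_neg by blast

lemma ops_scl: "x \<in> ops M I d \<Longrightarrow> scl M c x \<in> ops M I d"
  using ops_subspace subspace_scale by blast

lemma ops_unique: "x \<in> ops M I d \<Longrightarrow> x \<in> ops M I' d' \<Longrightarrow> x \<noteq> 0 \<Longrightarrow> I = I' \<and> d = d'"
  using ops_disjoint[of I d I' d'] by blast

lemma dif_zero [simp]: "dif M 0 = 0"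
  by (rule dif_degree_0[where I = "{}"]) simp

lemma dif_closed': "x \<in> ops M I d \<Longrightarrow> dif M x \<in> ops M I (d - 1)"
  using dif_closed[of x I "d - 1"] dif_degree_0[of x I] by (cases d) auto

lemma dif_diff: "x \<in> ops M I d \<Longrightarrow> y \<in> ops M I d \<Longrightarrow> dif M (x - y) = dif M x - dif M y"
  using dif_add[of "x - y" I d y] ops_diff[of x I d y] by (simp add: algebra_simps)

lemma ren_zero [simp]: "inj_on f I \<Longrightarrow> ren M f 0 = 0"
  using ren_scl[of f I 0 0 0] by simp

lemma comp_zero_left: "i \<in> I \<Longrightarrow> J \<inter> (I - {i}) = {} \<Longrightarrow> y \<in> ops M J e \<Longrightarrow> pcomp M i 0 y = 0"
  using comp_scl_left[of i I J 0 0 y e 0] by simp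

lemma comp_zero_right: "i \<in> I \<Longrightarrow> J \<inter> (I - {i}) = {} \<Longrightarrow> x \<in> ops M I d \<Longrightarrow> pcomp M i x 0 = 0"
  using comp_scl_right[of i I J x d 0 0 0] by simp

lemma morphism_zero: "operad_morphism M Q f \<Longrightarrow> f 0 = 0"
  using morphism_add[of M Q f 0 "{}" 0 0] by simp

end

text \<open>
  The relabelling of a composite in the compatibility of composition with relabelling.
\<close>

lemma inj_on_if:
  assumes "inj_on g I" "inj_on h J" "h ` J \<inter> g ` (I - {i}) = {}"
  shows "inj_on (\<lambda>l. if l \<in> J then h l else g l) ((I - {i}) \<union> J)"
proof (rule inj_onI)
  let ?l = "\<lambda>l. if l \<in> J then h l else g l"
  fix u v assume uv: "u \<in> (I - {i}) \<union> J" "v \<in> (I - {i}) \<union> J" "?l u = ?l v"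
  have "h u \<noteq> g v" if "u \<in> J" "v \<in> I - {i}" for u v
    using assms(3) that by blast
  then show "u = v"
    using uv inj_onD[OF assms(1), of u v] inj_onD[OF assms(2), of u v]
    by (cases "u \<in> J"; cases "v \<in> J") (simp_all, metis)
qed

text \<open>
  All equational axioms pass to a surjective image.  What does not is assumed: that components meet in 0 only,
  and that relabelling depends only on the values of the map on the inputs, which a morphism guarantees for
  injections only.
\<close>

lemma dg_operad_image:
  assumes R: "dg_operad R" and f: "operad_morphism R Q f"
    and surj: "\<And>I d. f ` ops R I d = ops Q I d"
    and vs: "vector_space (scl Q)"
    and disj: "\<And>I d I' d'. (I, d) \<noteq> (I', d') \<Longrightarrow> ops Q I d \<inter> ops Q I' d' = {0}"
    and cong: "\<And>x I d g h. x \<in> ops Q I d \<Longrightarrow> (\<And>i. i \<in> I \<Longrightarrow> g i = h i) \<Longrightarrow> ren Q g x = ren Q h x"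
  shows "dg_operad Q"
proof -
  interpret R: dg_operad R by (rule R)
  interpret Q: vector_space "scl Q" by (rule vs)
  note m = operad_morphismD[OF f]
  have ex: "\<exists>x'\<in>ops R I d. x = f x'" if "x \<in> ops Q I d" for x I d
    using surj[of I d] that by auto
  have f0: "f 0 = 0"
    using f by (rule R.morphism_zero)
  note cl = R.ops_add R.ops_scl R.ren_closed R.comp_closed R.dif_closed R.dif_closed'
  have add: "f x + f y = f (x + y)" if "x \<in> ops R I d" "y \<in> ops R I d" for x y I d
    using m(2) that by metis
  have scl: "scl Q c (f x) = f (scl R c x)" if "x \<in> ops R I d" for x I d c
    using m(3) that by metis
  have ren: "ren Q g (f x) = f (ren R g x)" if "inj_on g I" "x \<in> ops R I d" for x I d g
    using m(4) that by metis
  have comp: "pcomp Q i (f x) (f y) = f (pcomp R i x y)"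
    if "i \<in> I" "J \<inter> (I - {i}) = {}" "x \<in> ops R I d" "y \<in> ops R J e" for i x y I d J e
    using m(5)[OF that(3,4,1,2)] by simp
  have dif: "dif Q (f x) = f (dif R x)" if "x \<in> ops R I d" for x I d
    using m(7) that by metis
  note idt = m(6)[symmetric]
  show ?thesis
  proof (unfold_locales, goal_cases)
    case (1 I d)
    show ?case
      unfolding Q.subspace_def
    proof (intro conjI ballI allI)
      show "0 \<in> ops Q I d" using surj[of I d] R.ops_zero[of I d] f0 by (metis imageI)
      show "x + y \<in> ops Q I d" if "x \<in> ops Q I d" "y \<in> ops Q I d" for x y
        using ex[OF that(1)] ex[OF that(2)] surj[of I d] by (auto simp: add cl(1))
      show "scl Q c x \<in> ops Q I d" if "x \<in> ops Q I d" for x c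
        using ex[OF that] surj[of I d] by (auto simp: scl cl(2))
    qed
  next
    case (2 I d)
    then show ?case
      unfolding surj[symmetric] by (simp add: R.ops_inputs f0)
  next
    case 3
    then show ?case by (rule disj)
  next
    case (4 g I x d)
    obtain x' where x: "x' \<in> ops R I d" "x = f x'" using ex[OF 4(2)] by auto
    show ?case
      unfolding x(2) ren[OF 4(1) x(1)] by (rule m(1)[OF cl(3)[OF 4(1) x(1)]])
  next
    case (5 g I x d y)
    obtain x' where x: "x' \<in> ops R I d" "x = f x'" using ex[OF 5(2)] by auto
    obtain y' where y: "y' \<in> ops R I d" "y = f y'" using ex[OF 5(3)] by auto
    show ?case
      unfolding x(2) y(2) add[OF x(1) y(1)] ren[OF 5(1) x(1)] ren[OF 5(1) y(1)]
        ren[OF 5(1) cl(1)[OF x(1) y(1)]] add[OF cl(3)[OF 5(1) x(1)] cl(3)[OF 5(1) y(1)]]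
        R.ren_add[OF 5(1) x(1) y(1)] ..
  next
    case (6 g I x d c)
    obtain x' where x: "x' \<in> ops R I d" "x = f x'" using ex[OF 6(2)] by auto
    show ?case
      unfolding x(2) scl[OF x(1)] ren[OF 6(1) x(1)] ren[OF 6(1) cl(2)[OF x(1)]]
        scl[OF cl(3)[OF 6(1) x(1)]] R.ren_scl[OF 6(1) x(1)] ..
  next
    case 7
    then show ?case by (rule cong)
  next
    case (8 x I d)
    obtain x' where x: "x' \<in> ops R I d" "x = f x'" using ex[OF 8] by auto
    show ?case
      unfolding x(2) ren[OF inj_on_id x(1)] R.ren_id[OF x(1)] ..
  next
    case (9 g I h x d)
    obtain x' where x: "x' \<in> ops R I d" "x = f x'" using ex[OF 9(3)] by auto
    show ?case
      unfolding x(2) ren[OF 9(1) x(1)] ren[OF comp_inj_on[OF 9(1,2)] x(1)]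
        ren[OF 9(2) cl(3)[OF 9(1) x(1)]] R.ren_ren[OF 9(1,2) x(1)] ..
  next
    case (10 i I J x d y e)
    obtain x' where x: "x' \<in> ops R I d" "x = f x'" using ex[OF 10(3)] by auto
    obtain y' where y: "y' \<in> ops R J e" "y = f y'" using ex[OF 10(4)] by auto
    show ?case
      unfolding x(2) y(2) comp[OF 10(1,2) x(1) y(1)]
      by (rule m(1)[OF cl(4)[OF 10(1,2) x(1) y(1)]])
  next
    case (11 i I J x d x2 y e)
    obtain x' where x: "x' \<in> ops R I d" "x = f x'" using ex[OF 11(3)] by auto
    obtain x2' where x2: "x2' \<in> ops R I d" "x2 = f x2'" using ex[OF 11(4)] by auto
    obtain y' where y: "y' \<in> ops R J e" "y = f y'" using ex[OF 11(5)] by auto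
    show ?case
      unfolding x(2) y(2) x2(2) add[OF x(1) x2(1)] comp[OF 11(1,2) x(1) y(1)]
        comp[OF 11(1,2) x2(1) y(1)] comp[OF 11(1,2) cl(1)[OF x(1) x2(1)] y(1)]
        add[OF cl(4)[OF 11(1,2) x(1) y(1)] cl(4)[OF 11(1,2) x2(1) y(1)]]
        R.comp_add_left[OF 11(1,2) x(1) x2(1) y(1)] ..
  next
    case (12 i I J x d y e y2)
    obtain x' where x: "x' \<in> ops R I d" "x = f x'" using ex[OF 12(3)] by auto
    obtain y' where y: "y' \<in> ops R J e" "y = f y'" using ex[OF 12(4)] by auto
    obtain y2' where y2: "y2' \<in> ops R J e" "y2 = f y2'" using ex[OF 12(5)] by auto
    show ?case
      unfolding x(2) y(2) y2(2) add[OF y(1) y2(1)] comp[OF 12(1,2) x(1) y(1)]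
        comp[OF 12(1,2) x(1) y2(1)] comp[OF 12(1,2) x(1) cl(1)[OF y(1) y2(1)]]
        add[OF cl(4)[OF 12(1,2) x(1) y(1)] cl(4)[OF 12(1,2) x(1) y2(1)]]
        R.comp_add_right[OF 12(1,2) x(1) y(1) y2(1)] ..
  next
    case (13 i I J x d y e c)
    obtain x' where x: "x' \<in> ops R I d" "x = f x'" using ex[OF 13(3)] by auto
    obtain y' where y: "y' \<in> ops R J e" "y = f y'" using ex[OF 13(4)] by auto
    show ?case
      unfolding x(2) y(2) scl[OF x(1)] comp[OF 13(1,2) x(1) y(1)] comp[OF 13(1,2) cl(2)[OF x(1)] y(1)]
        scl[OF cl(4)[OF 13(1,2) x(1) y(1)]] R.comp_scl_left[OF 13(1,2) x(1) y(1)] ..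
  next
    case (14 i I J x d y e c)
    obtain x' where x: "x' \<in> ops R I d" "x = f x'" using ex[OF 14(3)] by auto
    obtain y' where y: "y' \<in> ops R J e" "y = f y'" using ex[OF 14(4)] by auto
    show ?case
      unfolding x(2) y(2) scl[OF y(1)] comp[OF 14(1,2) x(1) y(1)] comp[OF 14(1,2) x(1) cl(2)[OF y(1)]]
        scl[OF cl(4)[OF 14(1,2) x(1) y(1)]] R.comp_scl_right[OF 14(1,2) x(1) y(1)] ..
  next
    case (15 i I j J K x d y e z r)
    obtain x' where x: "x' \<in> ops R I d" "x = f x'" using ex[OF 15(5)] by auto
    obtain y' where y: "y' \<in> ops R J e" "y = f y'" using ex[OF 15(6)] by auto
    obtain z' where z: "z' \<in> ops R K r" "z = f z'" using ex[OF 15(7)] by auto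
    have *: "j \<in> (I - {i}) \<union> J" "K \<inter> ((I - {i}) \<union> J - {j}) = {}" "K \<inter> (J - {j}) = {}"
      "((J - {j}) \<union> K) \<inter> (I - {i}) = {}"
      using 15(2-4) by blast+
    show ?case
      unfolding x(2) y(2) z(2) comp[OF 15(1,3) x(1) y(1)] comp[OF 15(2) *(3) y(1) z(1)]
        comp[OF *(1,2) cl(4)[OF 15(1,3) x(1) y(1)] z(1)]
        comp[OF 15(1) *(4) x(1) cl(4)[OF 15(2) *(3) y(1) z(1)]]
        R.comp_sequential[OF 15(1-4) x(1) y(1) z(1)] ..
  next
    case (16 i I i' J K x d y e z r)
    obtain x' where x: "x' \<in> ops R I d" "x = f x'" using ex[OF 16(7)] by auto
    obtain y' where y: "y' \<in> ops R J e" "y = f y'" using ex[OF 16(8)] by auto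
    obtain z' where z: "z' \<in> ops R K r" "z = f z'" using ex[OF 16(9)] by auto
    have *: "i' \<in> (I - {i}) \<union> J" "K \<inter> ((I - {i}) \<union> J - {i'}) = {}"
      "i \<in> (I - {i'}) \<union> K" "J \<inter> ((I - {i'}) \<union> K - {i}) = {}"
      using 16(1-6) by blast+
    show ?case
      unfolding x(2) y(2) z(2) comp[OF 16(1,4) x(1) y(1)] comp[OF 16(2,5) x(1) z(1)]
        comp[OF *(1,2) cl(4)[OF 16(1,4) x(1) y(1)] z(1)]
        comp[OF *(3,4) cl(4)[OF 16(2,5) x(1) z(1)] y(1)]
        scl[OF cl(4)[OF *(3,4) cl(4)[OF 16(2,5) x(1) z(1)] y(1)]]
        R.comp_parallel[OF 16(1-6) x(1) y(1) z(1)] ..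
  next
    case (17 i I J g h x d y e)
    obtain x' where x: "x' \<in> ops R I d" "x = f x'" using ex[OF 17(6)] by auto
    obtain y' where y: "y' \<in> ops R J e" "y = f y'" using ex[OF 17(7)] by auto
    let ?l = "\<lambda>l. if l \<in> J then h l else g l"
    have *: "g i \<in> g ` I" "h ` J \<inter> (g ` I - {g i}) = {}"
      using 17(1,5) by auto
    from inj_on_if[OF 17(3-5)] show ?case
      unfolding x(2) y(2) ren[OF 17(3) x(1)] ren[OF 17(4) y(1)]
        comp[OF * cl(3)[OF 17(3) x(1)] cl(3)[OF 17(4) y(1)]] comp[OF 17(1,2) x(1) y(1)]
      using ren[of ?l, OF _ cl(4)[OF 17(1,2) x(1) y(1)]] R.comp_ren[OF 17(1-5) x(1) y(1)] by simp
  next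
    case (18 i)
    show ?case unfolding idt by (rule m(1)[OF R.idt_closed])
  next
    case (19 g i)
    show ?case
      unfolding idt ren[OF _ R.idt_closed, of g i, simplified] R.ren_idt ..
  next
    case (20 y J e i)
    obtain y' where y: "y' \<in> ops R J e" "y = f y'" using ex[OF 20] by auto
    have *: "i \<in> {i}" "J \<inter> ({i} - {i}) = {}" by auto
    show ?case
      unfolding y(2) idt comp[OF * R.idt_closed y(1)] R.comp_idt_left[OF y(1)] ..
  next
    case (21 i I j x d)
    obtain x' where x: "x' \<in> ops R I d" "x = f x'" using ex[OF 21(3)] by auto
    have *: "inj_on (id(i := j)) I" "{j} \<inter> (I - {i}) = {}"
      using 21(2) by (auto simp: inj_on_def)
    show ?case
      unfolding x(2) idt comp[OF 21(1) *(2) x(1) R.idt_closed] ren[OF *(1) x(1)]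
        R.comp_idt_right[OF 21(1,2) x(1)] ..
  next
    case (22 x I d)
    obtain x' where x: "x' \<in> ops R I (Suc d)" "x = f x'" using ex[OF 22] by auto
    show ?case
      unfolding x(2) dif[OF x(1)] by (rule m(1)[OF cl(5)[OF x(1)]])
  next
    case (23 x I)
    obtain x' where x: "x' \<in> ops R I 0" "x = f x'" using ex[OF 23] by auto
    show ?case
      unfolding x(2) dif[OF x(1)] R.dif_degree_0[OF x(1)] by (rule f0)
  next
    case (24 x I d y)
    obtain x' where x: "x' \<in> ops R I d" "x = f x'" using ex[OF 24(1)] by auto
    obtain y' where y: "y' \<in> ops R I d" "y = f y'" using ex[OF 24(2)] by auto
    show ?case
      unfolding x(2) y(2) add[OF x(1) y(1)] dif[OF x(1)] dif[OF y(1)] dif[OF cl(1)[OF x(1) y(1)]]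
        add[OF cl(6)[OF x(1)] cl(6)[OF y(1)]] R.dif_add[OF x(1) y(1)] ..
  next
    case (25 x I d c)
    obtain x' where x: "x' \<in> ops R I d" "x = f x'" using ex[OF 25] by auto
    show ?case
      unfolding x(2) scl[OF x(1)] dif[OF x(1)] dif[OF cl(2)[OF x(1)]]
        scl[OF cl(6)[OF x(1)]] R.dif_scl[OF x(1)] ..
  next
    case (26 x I d)
    obtain x' where x: "x' \<in> ops R I d" "x = f x'" using ex[OF 26] by auto
    show ?case
      unfolding x(2) dif[OF x(1)] dif[OF cl(6)[OF x(1)]] R.dif_dif[OF x(1)] by (rule f0)
  next
    case (27 g I x d)
    obtain x' where x: "x' \<in> ops R I d" "x = f x'" using ex[OF 27(2)] by auto
    show ?case
      unfolding x(2) dif[OF x(1)] ren[OF 27(1) x(1)] dif[OF cl(3)[OF 27(1) x(1)]]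
        ren[OF 27(1) cl(6)[OF x(1)]] R.dif_ren[OF 27(1) x(1)] ..
  next
    case (28 i I J x d y e)
    obtain x' where x: "x' \<in> ops R I d" "x = f x'" using ex[OF 28(3)] by auto
    obtain y' where y: "y' \<in> ops R J e" "y = f y'" using ex[OF 28(4)] by auto
    note xy = cl(4)[OF 28(1,2) x(1) y(1)]
    have 1: "pcomp R i (dif R x') y' \<in> ops R ((I - {i}) \<union> J) (d + e - 1)"
    proof (cases d)
      case 0
      then show ?thesis
        using x(1) R.comp_zero_left[OF 28(1,2) y(1)] by (simp add: R.dif_degree_0)
    next
      case (Suc d')
      then show ?thesis
        using cl(4)[OF 28(1,2) cl(5)[of x' I d'] y(1)] x(1) by simp
    qed
    have 2: "pcomp R i x' (dif R y') \<in> ops R ((I - {i}) \<union> J) (d + e - 1)"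
    proof (cases e)
      case 0
      then show ?thesis
        using y(1) R.comp_zero_right[OF 28(1,2) x(1)] by (simp add: R.dif_degree_0)
    next
      case (Suc e')
      then show ?thesis
        using cl(4)[OF 28(1,2) x(1) cl(5)[of y' J e']] y(1) by simp
    qed
    show ?case
      unfolding x(2) y(2) dif[OF x(1)] dif[OF y(1)] comp[OF 28(1,2) x(1) y(1)]
        comp[OF 28(1,2) cl(6)[OF x(1)] y(1)] comp[OF 28(1,2) x(1) cl(6)[OF y(1)]] dif[OF xy]
        scl[OF 2] add[OF 1 cl(2)[OF 2]] R.dif_comp[OF 28(1,2) x(1) y(1)] ..
  qed
qed

text \<open>
  An operad whose ambient space is embedded linearly into a space with a basis; linearity is required only on
  a subspace \<open>W\<close> that contains all operations.
\<close>

locale embedded_operad = dg_operad M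
  for M :: "('k::field, 'w::ab_group_add) operad" +
  fixes \<iota> :: "'w \<Rightarrow> 'u \<Rightarrow>\<^sub>0 'k" and W :: "'w set"
  assumes W_subspace: "subspace W"
    and ops_W: "ops M I d \<subseteq> W"
    and \<iota>_inj: "inj_on \<iota> W"
    and \<iota>_add: "x \<in> W \<Longrightarrow> y \<in> W \<Longrightarrow> \<iota> (x + y) = \<iota> x + \<iota> y"
    and \<iota>_scl: "x \<in> W \<Longrightarrow> \<iota> (scl M c x) = pm_scale c (\<iota> x)"
begin

definition \<kappa> :: "('u \<Rightarrow>\<^sub>0 'k) \<Rightarrow> 'w" where
  "\<kappa> = inv_into W \<iota>"

definition transported :: "('k, 'u \<Rightarrow>\<^sub>0 'k) operad" where
  "transported = \<lparr>ops = (\<lambda>I d. \<iota> ` ops M I d), scl = pm_scale,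
     pcomp = (\<lambda>i x y. \<iota> (pcomp M i (\<kappa> x) (\<kappa> y))), ren = (\<lambda>f x. \<iota> (ren M f (\<kappa> x))),
     idt = (\<lambda>i. \<iota> (idt M i)), dif = (\<lambda>x. \<iota> (dif M (\<kappa> x)))\<rparr>"

lemma \<kappa>_\<iota>: "x \<in> W \<Longrightarrow> \<kappa> (\<iota> x) = x"
  by (simp add: \<kappa>_def \<iota>_inj)

lemma \<kappa>_\<iota>_ops: "x \<in> ops M I d \<Longrightarrow> \<kappa> (\<iota> x) = x"
  using \<kappa>_\<iota> ops_W by blast

lemma \<iota>_zero [simp]: "\<iota> 0 = 0"
  using \<iota>_add[of 0 0] subspace_0[OF W_subspace] by simp

lemma \<iota>_morphism: "operad_morphism M transported \<iota>"
  by (rule operad_morphismI)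
     (auto simp: transported_def \<kappa>_\<iota>_ops intro: \<iota>_add \<iota>_scl subsetD[OF ops_W])

lemma transported_small: "small_dg_operad transported"
  unfolding small_dg_operad_def
proof
  show "dg_operad transported"
  proof (rule dg_operad_image[OF dg_operad_axioms \<iota>_morphism])
    show "vector_space (scl transported)"
      by (simp add: transported_def vector_space_pm_scale)
    show "ops transported I d \<inter> ops transported I' d' = {0}" if "(I, d) \<noteq> (I', d')" for I d I' d'
    proof -
      have "\<iota> x = 0" if "x \<in> ops M I d" "y \<in> ops M I' d'" "\<iota> x = \<iota> y" for x y
      proof -
        have "x = y" using that by (metis \<kappa>_\<iota>_ops)
        then have "x = 0" using ops_disjoint[OF \<open>(I, d) \<noteq> (I', d')\<close>] that by blast
        then show ?thesis by simp
      qed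
      moreover have "0 \<in> \<iota> ` ops M I d" "0 \<in> \<iota> ` ops M I' d'"
        using \<iota>_zero ops_zero by (metis image_eqI)+
      ultimately have "\<iota> ` ops M I d \<inter> \<iota> ` ops M I' d' = {0}" by blast
      then show ?thesis by (simp add: transported_def)
    qed
    show "ren transported g x = ren transported h x"
      if "x \<in> ops transported I d" "\<And>i. i \<in> I \<Longrightarrow> g i = h i" for x I d g h
      using that ren_cong[of _ I d g h] by (auto simp: transported_def \<kappa>_\<iota>_ops)
  qed (simp add: transported_def)
qed (simp add: transported_def)

lemma \<kappa>_morphism: "operad_morphism transported M \<kappa>"
proof (rule operad_morphismI)
  show "\<kappa> (x + y) = \<kappa> x + \<kappa> y" if asm: "x \<in> ops transported I d" "y \<in> ops transported I d" for I d x y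
  proof -
    obtain x' y' where xy: "x' \<in> ops M I d" "x = \<iota> x'" "y' \<in> ops M I d" "y = \<iota> y'"
      using asm by (auto simp: transported_def)
    then have "\<iota> x' + \<iota> y' = \<iota> (x' + y')"
      using \<iota>_add[of x' y'] ops_W[of I d] by (simp add: subset_iff)
    then show ?thesis
      using \<kappa>_\<iota>_ops[OF ops_add[OF xy(1,3)]] xy by (simp add: \<kappa>_\<iota>_ops)
  qed
  show "\<kappa> (scl transported c x) = scl M c (\<kappa> x)" if asm: "x \<in> ops transported I d" for I d x c
  proof -
    obtain x' where x: "x' \<in> ops M I d" "x = \<iota> x'"
      using asm by (auto simp: transported_def)
    then have "pm_scale c (\<iota> x') = \<iota> (scl M c x')"
      using \<iota>_scl[of x' c] ops_W[of I d] by (simp add: subset_iff)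
    then show ?thesis
      using \<kappa>_\<iota>_ops[OF ops_scl[OF x(1), of c]] x by (simp add: \<kappa>_\<iota>_ops transported_def)
  qed
qed (auto simp: transported_def \<kappa>_\<iota>_ops[OF ren_closed] \<kappa>_\<iota>_ops[OF comp_closed] \<kappa>_\<iota>_ops[OF dif_closed']
    \<kappa>_\<iota>_ops[OF idt_closed] \<kappa>_\<iota>_ops)

lemma cycles_transported: "cycles transported I d = \<iota> ` cycles M I d"
proof -
  have "\<iota> (dif M x) = 0 \<longleftrightarrow> dif M x = 0" if "x \<in> ops M I d" for x
    using \<kappa>_\<iota>_ops[OF dif_closed'[OF that]] \<kappa>_\<iota>_ops[OF ops_zero] by (metis \<iota>_zero)
  then show ?thesis
    unfolding cycles_def by (auto simp: transported_def \<kappa>_\<iota>_ops image_iff)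
qed

lemma boundaries_transported: "boundaries transported I d = \<iota> ` boundaries M I d"
  unfolding boundaries_def by (auto simp: transported_def \<kappa>_\<iota>_ops image_iff)

end

lemma boundaries_ops: "dg_operad M \<Longrightarrow> x \<in> boundaries M I d \<Longrightarrow> x \<in> ops M I d"
  unfolding boundaries_def using dg_operad.dif_closed by fastforce

text \<open>
  The embedding is an isomorphism onto the transported operad, so cycles and boundaries correspond.
\<close>

lemma acyclic_fibration_transported:
  assumes "embedded_operad X \<iota> V" "embedded_operad Y \<iota>' V'" "acyclic_fibration X Y p"
  shows "acyclic_fibration (embedded_operad.transported X \<iota> V) (embedded_operad.transported Y \<iota>' V')
    (\<iota>' \<circ> p \<circ> embedded_operad.\<kappa> \<iota> V)"
proof -
  interpret X: embedded_operad X \<iota> V by fact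
  interpret Y: embedded_operad Y \<iota>' V' by fact
  let ?q = "\<iota>' \<circ> p \<circ> X.\<kappa>"
  have p: "operad_morphism X Y p" and onto: "\<And>I d. p ` ops X I d = ops Y I d"
    and inj: "\<And>I d x. x \<in> cycles X I d \<Longrightarrow> p x \<in> boundaries Y I d \<Longrightarrow> x \<in> boundaries X I d"
    and sur: "\<And>I d y. y \<in> cycles Y I d \<Longrightarrow> \<exists>x\<in>cycles X I d. y - p x \<in> boundaries Y I d"
    using assms(3) by (auto simp: acyclic_fibration_def quasi_iso_def)
  have q: "operad_morphism X.transported Y.transported ?q"
    using operad_morphism_comp[OF operad_morphism_comp[OF X.\<kappa>_morphism p] Y.\<iota>_morphism] by (simp add: comp_assoc)
  have qx: "?q (\<iota> x) = \<iota>' (p x)" if "x \<in> ops X I d" for x I d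
    using X.\<kappa>_\<iota>_ops[OF that] by simp
  have "?q ` ops X.transported I d = ops Y.transported I d" for I d
  proof -
    have "?q ` ops X.transported I d = \<iota>' ` p ` ops X I d"
      by (force simp: X.transported_def X.\<kappa>_\<iota>_ops image_iff)
    then show ?thesis by (simp add: onto Y.transported_def)
  qed
  moreover have "z \<in> boundaries X.transported I d"
    if asm: "z \<in> cycles X.transported I d" "?q z \<in> boundaries Y.transported I d" for z I d
  proof -
    obtain x where x: "x \<in> cycles X I d" "z = \<iota> x" using asm(1) X.cycles_transported by auto
    then have xo: "x \<in> ops X I d" by (simp add: cycles_def)
    obtain b where b: "b \<in> boundaries Y I d" "\<iota>' (p x) = \<iota>' b"
      using asm(2) qx[OF xo] x(2) Y.boundaries_transported by auto
    then have "p x = b"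
      using Y.\<kappa>_\<iota>_ops[OF morphism_ops[OF p xo]] Y.\<kappa>_\<iota>_ops[OF boundaries_ops[OF Y.dg_operad_axioms b(1)]]
      by metis
    then show ?thesis
      using inj[OF x(1)] b x(2) X.boundaries_transported by blast
  qed
  moreover have "\<exists>x\<in>cycles X.transported I d. z - ?q x \<in> boundaries Y.transported I d"
    if asm: "z \<in> cycles Y.transported I d" for z I d
  proof -
    obtain y where y: "y \<in> cycles Y I d" "z = \<iota>' y" using asm Y.cycles_transported by auto
    obtain x where x: "x \<in> cycles X I d" "y - p x \<in> boundaries Y I d" using sur[OF y(1)] by auto
    then have xo: "x \<in> ops X I d" and yo: "y \<in> ops Y I d" using y by (auto simp: cycles_def)
    have "\<iota>' y = \<iota>' (y - p x) + \<iota>' (p x)"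
      using Y.\<iota>_add[of "y - p x" "p x"] Y.ops_W[of I d] morphism_ops[OF p xo] Y.ops_diff[OF yo morphism_ops[OF p xo]]
      by (simp add: subset_iff)
    then have "\<iota>' y - ?q (\<iota> x) \<in> boundaries Y.transported I d"
      using qx[OF xo] x(2) by (simp add: Y.boundaries_transported)
    then show ?thesis
      using x(1) y(2) X.cycles_transported by blast
  qed
  ultimately show ?thesis
    unfolding acyclic_fibration_def quasi_iso_def using q by blast
qed

text \<open>
  The lifting property of a cofibrant operad, freed from the restriction that the two operads live in its own
  ambient space.
\<close>

lemma cofibrant_lift:
  fixes M :: "('k::field, 'u::infinite \<Rightarrow>\<^sub>0 'k) operad"
    and \<iota> :: "'x::ab_group_add \<Rightarrow> 'u \<Rightarrow>\<^sub>0 'k" and \<iota>' :: "'y::ab_group_add \<Rightarrow> 'u \<Rightarrow>\<^sub>0 'k"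
  assumes M: "cofibrant M" and X: "embedded_operad X \<iota> V" and Y: "embedded_operad Y \<iota>' V'"
    and p: "acyclic_fibration X Y p" and f: "operad_morphism M Y f"
  obtains g where "operad_morphism M X g" "\<And>I d x. x \<in> ops M I d \<Longrightarrow> p (g x) = f x"
proof -
  interpret X: embedded_operad X \<iota> V by fact
  interpret Y: embedded_operad Y \<iota>' V' by fact
  let ?q = "\<iota>' \<circ> p \<circ> X.\<kappa>"
  have "operad_morphism M Y.transported (\<iota>' \<circ> f)"
    by (rule operad_morphism_comp[OF f Y.\<iota>_morphism])
  then obtain g where g: "operad_morphism M X.transported g"
    and qg: "\<And>I d x. x \<in> ops M I d \<Longrightarrow> ?q (g x) = (\<iota>' \<circ> f) x"
    using M[unfolded cofibrant_def, THEN conjunct2, rule_format, of X.transported Y.transported ?q "\<iota>' \<circ> f"]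
      X.transported_small Y.transported_small acyclic_fibration_transported[OF X Y p] by blast
  show thesis
  proof (rule that)
    show "operad_morphism M X (X.\<kappa> \<circ> g)"
      by (rule operad_morphism_comp[OF g X.\<kappa>_morphism])
    show "p ((X.\<kappa> \<circ> g) x) = f x" if x: "x \<in> ops M I d" for x I d
    proof -
      have "X.\<kappa> (g x) \<in> ops X I d"
        using morphism_ops[OF X.\<kappa>_morphism morphism_ops[OF g x]] .
      then have 1: "p (X.\<kappa> (g x)) \<in> ops Y I d"
        using p morphism_ops by (fastforce simp: acyclic_fibration_def quasi_iso_def)
      have "\<iota>' (p (X.\<kappa> (g x))) = \<iota>' (f x)" using qg[OF x] by simp
      then have "Y.\<kappa> (\<iota>' (p (X.\<kappa> (g x)))) = Y.\<kappa> (\<iota>' (f x))" by (rule arg_cong)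
      then show ?thesis
        unfolding Y.\<kappa>_\<iota>_ops[OF 1] Y.\<kappa>_\<iota>_ops[OF morphism_ops[OF f x]] comp_apply .
    qed
  qed
qed

section \<open>Linear embeddings into spaces with a basis\<close>

lemma single_one_eq_iff: "Poly_Mapping.single u (1::'k::field) = Poly_Mapping.single v 1 \<longleftrightarrow> u = v"
  by (metis lookup_single_eq lookup_single_not_eq zero_neq_one)

lemma independent_single:
  "\<not> module.dependent (pm_scale :: 'k::field \<Rightarrow> ('u \<Rightarrow>\<^sub>0 'k) \<Rightarrow> _) ((\<lambda>u. Poly_Mapping.single u 1) ` U)"
proof -
  interpret vector_space "pm_scale :: 'k \<Rightarrow> ('u \<Rightarrow>\<^sub>0 'k) \<Rightarrow> _" by (rule vector_space_pm_scale)
  show ?thesis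
    unfolding dependent_explicit
  proof (intro notI, elim exE conjE bexE)
    fix t :: "('u \<Rightarrow>\<^sub>0 'k) set" and c v
    assume t: "finite t" "t \<subseteq> (\<lambda>u. Poly_Mapping.single u 1) ` U"
      and sum: "(\<Sum>v\<in>t. pm_scale (c v) v) = 0" and v: "v \<in> t" "c v \<noteq> 0"
    have inj: "inj (\<lambda>u. Poly_Mapping.single u (1::'k))"
      by (rule injI) (simp add: single_one_eq_iff)
    obtain T where T: "finite T" "t = (\<lambda>u. Poly_Mapping.single u 1) ` T"
      using t by (metis finite_subset_image)
    obtain u where u: "u \<in> T" "v = Poly_Mapping.single u 1"
      using v T by auto
    have "0 = (\<Sum>u'\<in>T. pm_scale (c (Poly_Mapping.single u' 1)) (Poly_Mapping.single u' 1))"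
      using sum unfolding T(2) by (subst (asm) sum.reindex) (auto intro: inj_on_subset[OF inj])
    then have "0 = (\<Sum>u'\<in>T. Poly_Mapping.lookup (pm_scale (c (Poly_Mapping.single u' 1)) (Poly_Mapping.single u' 1)) u)"
      by (metis lookup_sum lookup_zero)
    also have "\<dots> = c v"
      using T(1) u by (simp add: pm_lookup_scale lookup_single when_def if_distrib cong: if_cong)
    finally show False using v(2) by simp
  qed
qed

text \<open>
  A spanning family contains a basis; distinct basis vectors are sent to distinct basis vectors, chosen by
  means of \<open>j\<close>.
\<close>

lemma exists_linear_embedding:
  fixes s :: "'k::field \<Rightarrow> 'w::ab_group_add \<Rightarrow> 'w" and f :: "'x \<Rightarrow> 'w" and j :: "'x \<Rightarrow> 'u"
  assumes s: "vector_space s" and j: "inj j"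
  obtains \<iota> :: "'w \<Rightarrow> 'u \<Rightarrow>\<^sub>0 'k"
  where "\<And>x y. \<iota> (x + y) = \<iota> x + \<iota> y" "\<And>c x. \<iota> (s c x) = pm_scale c (\<iota> x)"
    "inj_on \<iota> (module.span s (range f))"
proof -
  interpret vs1: vector_space s by (rule s)
  interpret vs2: vector_space "pm_scale :: 'k \<Rightarrow> ('u \<Rightarrow>\<^sub>0 'k) \<Rightarrow> _" by (rule vector_space_pm_scale)
  interpret vector_space_pair s "pm_scale :: 'k \<Rightarrow> ('u \<Rightarrow>\<^sub>0 'k) \<Rightarrow> _" ..
  obtain B where B: "B \<subseteq> range f" "vs1.independent B" "range f \<subseteq> vs1.span B"
    using vs1.maximal_independent_subset by blast
  define h where "h b = (Poly_Mapping.single (j (inv f b)) 1 :: 'u \<Rightarrow>\<^sub>0 'k)" for b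
  define \<iota> where "\<iota> = construct B h"
  have lin: "Vector_Spaces.linear s pm_scale \<iota>"
    unfolding \<iota>_def by (rule linear_construct[OF B(2)])
  have eq: "\<iota> b = h b" if "b \<in> B" for b
    unfolding \<iota>_def by (rule construct_basis[OF B(2) that])
  have "inj_on \<iota> B"
  proof (rule inj_onI)
    fix b b' assume b: "b \<in> B" "b' \<in> B" "\<iota> b = \<iota> b'"
    then have "inv f b = inv f b'"
      using inj_eq[OF j] by (auto simp: eq h_def single_one_eq_iff)
    then show "b = b'"
      using b(1,2) B(1) by (metis f_inv_into_f subset_iff)
  qed
  moreover have "vs2.independent (\<iota> ` B)"
  proof (rule vs2.independent_mono[OF independent_single[of UNIV]])
    show "\<iota> ` B \<subseteq> range (\<lambda>u. Poly_Mapping.single u 1)"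
      by (auto simp: eq h_def)
  qed
  ultimately have "inj_on \<iota> (vs1.span B)"
    using lin linear_inj_on_span_independent_image by blast
  then have "inj_on \<iota> (vs1.span (range f))"
    using vs1.span_minimal[OF B(3) vs1.subspace_span] inj_on_subset by blast
  then show thesis
    using that linear_add[OF lin] linear_scale[OF lin] by blast
qed

instance btree :: countable
  by countable_datatype

text \<open>
  The classes of the countably many trees span the ambient space of the operad.
\<close>

lemma JJss_embedded:
  assumes "dg_operad (JJss :: ('k::field, 'k jjvec) operad)"
  obtains \<iota> :: "'k::field jjvec \<Rightarrow> ('u::infinite \<Rightarrow>\<^sub>0 'k)" where "embedded_operad JJss \<iota> UNIV"
proof -
  interpret dg_operad "JJss :: ('k, 'k jjvec) operad" by fact
  let ?f = "jj_tree :: btree \<Rightarrow> 'k jjvec"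
  obtain i :: "nat \<Rightarrow> 'u" where "inj i"
    using infinite_countable_subset[OF infinite_UNIV] by auto
  then have j: "inj (i \<circ> to_nat :: btree \<Rightarrow> 'u)"
    by (simp add: inj_compose)
  have scl: "scl JJss = (jj_scale :: 'k \<Rightarrow> _)" by (simp add: JJss_def)
  obtain \<iota> :: "'k jjvec \<Rightarrow> 'u \<Rightarrow>\<^sub>0 'k" where \<iota>: "\<And>x y. \<iota> (x + y) = \<iota> x + \<iota> y"
      "\<And>c x. \<iota> (jj_scale c x) = pm_scale c (\<iota> x)" "inj_on \<iota> (span (range ?f))"
    using exists_linear_embedding[OF vector_space_jj_scale j, of ?f] unfolding scl by metis
  have "x \<in> span (range ?f)" for x
  proof (induction x)
    fix y :: "btree \<Rightarrow>\<^sub>0 'k"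
    have "abs_jjvec y = (\<Sum>t\<in>Poly_Mapping.keys y. scl JJss (Poly_Mapping.lookup y t) (?f t))"
      unfolding scl by (rule abs_jjvec_expand)
    also have "\<dots> \<in> span (range ?f)"
      by (intro span_sum span_scale span_base) auto
    finally show "abs_jjvec y \<in> span (range ?f)" .
  qed
  then have "inj \<iota>" using \<iota>(3) by (auto simp: inj_on_def)
  then have "embedded_operad JJss \<iota> UNIV"
    using subspace_UNIV by unfold_locales (auto simp: scl \<iota>)
  then show thesis by (rule that)
qed

section \<open>Polynomial paths\<close>

text \<open>
  \<open>path_deriv S a a'\<close>: the function \<open>a\<close> is a polynomial with coefficients in
  \<open>S\<close> and \<open>a'\<close> is its formal derivative.  Treating polynomials as functions makes
  the operations on paths pointwise; the derivative is well defined because the field is infinite.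
\<close>

inductive path_deriv :: "('u \<Rightarrow>\<^sub>0 'k::field) set \<Rightarrow> ('k \<Rightarrow> 'u \<Rightarrow>\<^sub>0 'k) \<Rightarrow> ('k \<Rightarrow> 'u \<Rightarrow>\<^sub>0 'k) \<Rightarrow> bool"
  for S where
  zero: "path_deriv S (\<lambda>t. 0) (\<lambda>t. 0)"
| add_monom: "x \<in> S \<Longrightarrow> path_deriv S a a' \<Longrightarrow>
    path_deriv S (\<lambda>t. a t + pm_scale (t ^ n) x) (\<lambda>t. a' t + pm_scale (of_nat n * t ^ (n - 1)) x)"

lemma path_deriv_monom: "x \<in> S \<Longrightarrow> path_deriv S (\<lambda>t. pm_scale (t ^ n) x) (\<lambda>t. pm_scale (of_nat n * t ^ (n - 1)) x)"
  using path_deriv.add_monom[OF _ path_deriv.zero] by simp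

lemma path_deriv_const: "x \<in> S \<Longrightarrow> path_deriv S (\<lambda>t. x) (\<lambda>t. 0)"
  using path_deriv_monom[of x S 0] by simp

lemma path_deriv_mono: "path_deriv S a a' \<Longrightarrow> S \<subseteq> T \<Longrightarrow> path_deriv T a a'"
proof (induction rule: path_deriv.induct)
  case zero
  show ?case by (rule path_deriv.zero)
next
  case (add_monom x a a' n)
  then show ?case using path_deriv.add_monom[of x T a a' n] by blast
qed

lemma path_deriv_add:
  assumes "path_deriv S a a'" "path_deriv S b b'"
  shows "path_deriv S (\<lambda>t. a t + b t) (\<lambda>t. a' t + b' t)"
  using assms(2)
proof (induction rule: path_deriv.induct)
  case zero
  then show ?case using assms(1) by simp
next
  case (add_monom x b b' n)
  then show ?case
    using path_deriv.add_monom[of x S "\<lambda>t. a t + b t" "\<lambda>t. a' t + b' t" n] by (simp add: add.assoc)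
qed

lemma path_deriv_linear:
  fixes a :: "'k::field \<Rightarrow> 'u \<Rightarrow>\<^sub>0 'k" and L :: "('u \<Rightarrow>\<^sub>0 'k) \<Rightarrow> ('u \<Rightarrow>\<^sub>0 'k)"
  assumes "path_deriv S a a'"
    and "module.subspace pm_scale S"
    and "\<And>x. x \<in> S \<Longrightarrow> L x \<in> T"
    and "\<And>x y. x \<in> S \<Longrightarrow> y \<in> S \<Longrightarrow> L (x + y) = L x + L y"
    and "\<And>c x. x \<in> S \<Longrightarrow> L (pm_scale c x) = pm_scale c (L x)"
  shows "path_deriv T (\<lambda>t. L (a t)) (\<lambda>t. L (a' t)) \<and> (\<forall>t. a t \<in> S \<and> a' t \<in> S)"
  using assms(1)
proof (induction rule: path_deriv.induct)
  case zero
  interpret vector_space "pm_scale :: 'k \<Rightarrow> ('u \<Rightarrow>\<^sub>0 'k) \<Rightarrow> _" by (rule vector_space_pm_scale)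
  have "0 \<in> S" using assms(2) by (rule subspace_0)
  then show ?case using assms(5)[of 0 0] by (simp add: path_deriv.zero)
next
  case (add_monom x a a' n)
  interpret vector_space "pm_scale :: 'k \<Rightarrow> ('u \<Rightarrow>\<^sub>0 'k) \<Rightarrow> _" by (rule vector_space_pm_scale)
  have *: "pm_scale c x \<in> S" for c
    using assms(2) add_monom(1) by (rule subspace_scale)
  then show ?case
    using add_monom path_deriv.add_monom[OF assms(3)[OF add_monom(1)], of "\<lambda>t. L (a t)" "\<lambda>t. L (a' t)" n]
    by (simp add: assms(4,5) subspace_add[OF assms(2)])
qed

lemma path_deriv_values:
  assumes "path_deriv S a a'" "module.subspace pm_scale S"
  shows "a t \<in> S" "a' t \<in> S"
  using path_deriv_linear[OF assms, of "\<lambda>x. x" S] by auto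

text \<open>
  The Leibniz rule; by bilinearity it is enough to treat monomials.  Mapping into a subspace \<open>U\<close>
  records where the coefficients of the product lie.
\<close>

lemma path_deriv_bilinear:
  fixes a b :: "'k::field \<Rightarrow> 'u \<Rightarrow>\<^sub>0 'k" and B :: "('u \<Rightarrow>\<^sub>0 'k) \<Rightarrow> ('u \<Rightarrow>\<^sub>0 'k) \<Rightarrow> ('u \<Rightarrow>\<^sub>0 'k)"
  assumes a: "path_deriv S a a'" and b: "path_deriv T b b'"
    and S: "module.subspace pm_scale S" and T: "module.subspace pm_scale T"
    and maps: "\<And>x y. x \<in> S \<Longrightarrow> y \<in> T \<Longrightarrow> B x y \<in> U"
    and add1: "\<And>x x' y. x \<in> S \<Longrightarrow> x' \<in> S \<Longrightarrow> y \<in> T \<Longrightarrow> B (x + x') y = B x y + B x' y"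
    and add2: "\<And>x y y'. x \<in> S \<Longrightarrow> y \<in> T \<Longrightarrow> y' \<in> T \<Longrightarrow> B x (y + y') = B x y + B x y'"
    and scl1: "\<And>c x y. x \<in> S \<Longrightarrow> y \<in> T \<Longrightarrow> B (pm_scale c x) y = pm_scale c (B x y)"
    and scl2: "\<And>c x y. x \<in> S \<Longrightarrow> y \<in> T \<Longrightarrow> B x (pm_scale c y) = pm_scale c (B x y)"
  shows "path_deriv U (\<lambda>t. B (a t) (b t)) (\<lambda>t. B (a' t) (b t) + B (a t) (b' t))"
proof -
  interpret vector_space "pm_scale :: 'k \<Rightarrow> ('u \<Rightarrow>\<^sub>0 'k) \<Rightarrow> _" by (rule vector_space_pm_scale)
  have monom: "path_deriv U (\<lambda>t. B (pm_scale (t ^ n) x) (b t))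
      (\<lambda>t. B (pm_scale (of_nat n * t ^ (n - 1)) x) (b t) + B (pm_scale (t ^ n) x) (b' t))"
    if x: "x \<in> S" for x n
    using b
  proof (induction rule: path_deriv.induct)
    case zero
    have "B z 0 = 0" if "z \<in> S" for z
      using scl2[OF that subspace_0[OF T], of 0] by simp
    then show ?case by (simp add: subspace_scale[OF S x] path_deriv.zero)
  next
    case (add_monom y b b' m)
    note bt = path_deriv_values[OF add_monom(2) T] subspace_scale[OF T add_monom(1)] subspace_scale[OF S x]
    have m: "of_nat (n + m) * t ^ (n + m - 1) = of_nat n * t ^ (n - 1) * t ^ m + t ^ n * (of_nat m * t ^ (m - 1))"
      for t :: 'k
      by (cases n; cases m) (auto simp: algebra_simps power_add)
    have 1: "B (pm_scale (t ^ n) x) (b t + pm_scale (t ^ m) y)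
        = B (pm_scale (t ^ n) x) (b t) + pm_scale (t ^ (n + m)) (B x y)" for t
      by (simp add: add2 bt scl1 scl2 x add_monom(1) pm_scale_scale power_add mult.commute)
    have 2: "B (pm_scale (of_nat n * t ^ (n - 1)) x) (b t + pm_scale (t ^ m) y)
          + B (pm_scale (t ^ n) x) (b' t + pm_scale (of_nat m * t ^ (m - 1)) y)
        = (B (pm_scale (of_nat n * t ^ (n - 1)) x) (b t) + B (pm_scale (t ^ n) x) (b' t))
          + pm_scale (of_nat (n + m) * t ^ (n + m - 1)) (B x y)" for t
      unfolding m[of t] by (simp add: add2 bt scl1 scl2 x add_monom(1) pm_scale_scale pm_scale_add_left ac_simps)
    show ?case
      unfolding 1 2 by (rule path_deriv.add_monom[OF maps[OF x add_monom(1)] add_monom(3)])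
  qed
  show ?thesis
    using a
  proof (induction rule: path_deriv.induct)
    case zero
    have "B 0 z = 0" if "z \<in> T" for z
      using scl1[OF subspace_0[OF S] that, of 0] by simp
    then show ?case by (simp add: path_deriv_values[OF b T] path_deriv.zero)
  next
    case (add_monom x a a' n)
    note bt = path_deriv_values[OF b T] path_deriv_values[OF add_monom(2) S] subspace_scale[OF S add_monom(1)]
    show ?case
      using path_deriv_add[OF add_monom(3) monom[OF add_monom(1), of n]]
      by (simp add: add1 bt algebra_simps)
  qed
qed

lemma path_deriv_deriv:
  fixes a :: "'k::field \<Rightarrow> 'u \<Rightarrow>\<^sub>0 'k"
  shows "path_deriv S a a' \<Longrightarrow> module.subspace pm_scale S \<Longrightarrow> \<exists>a''. path_deriv S a' a''"
proof (induction rule: path_deriv.induct)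
  case zero
  then show ?case using path_deriv.zero by blast
next
  case (add_monom x a a' n)
  interpret vector_space "pm_scale :: 'k \<Rightarrow> ('u \<Rightarrow>\<^sub>0 'k) \<Rightarrow> _" by (rule vector_space_pm_scale)
  obtain a'' where "path_deriv S a' a''" using add_monom by auto
  then show ?case
    using path_deriv.add_monom[OF subspace_scale[OF add_monom(4,1), of "of_nat n"], of a' a'' "n - 1"]
    by (auto simp: pm_scale_scale mult.commute)
qed

lemma path_deriv_antideriv:
  fixes a :: "'k::field_char_0 \<Rightarrow> 'u \<Rightarrow>\<^sub>0 'k"
  shows "path_deriv S a a' \<Longrightarrow> module.subspace pm_scale S \<Longrightarrow> \<exists>A. path_deriv S A a \<and> A 0 = 0"
proof (induction rule: path_deriv.induct)
  case zero
  then show ?case using path_deriv.zero by blast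
next
  case (add_monom x a a' n)
  interpret vector_space "pm_scale :: 'k \<Rightarrow> ('u \<Rightarrow>\<^sub>0 'k) \<Rightarrow> _" by (rule vector_space_pm_scale)
  obtain A where A: "path_deriv S A a" "A 0 = 0" using add_monom by auto
  have "(1 + of_nat n :: 'k) \<noteq> 0"
    by (metis of_nat_Suc of_nat_neq_0)
  then have "path_deriv S (\<lambda>t. A t + pm_scale (t * t ^ n / (1 + of_nat n)) x) (\<lambda>t. a t + pm_scale (t ^ n) x)"
    using path_deriv.add_monom[OF subspace_scale[OF add_monom(4,1), of "1 / of_nat (Suc n)"] A(1), of "Suc n"]
    by (auto simp: pm_scale_scale mult.commute)
  then show ?case
    using A(2) by (intro exI[of _ "\<lambda>t. A t + pm_scale (t * t ^ n / (1 + of_nat n)) x"]) simp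
qed

text \<open>
  Each coordinate is an ordinary polynomial over the infinite field, hence determined by its values.
\<close>

lemma path_deriv_coordinate:
  assumes "path_deriv S a a'"
  shows "\<exists>p. \<forall>t. Poly_Mapping.lookup (a t) u = poly p t \<and> Poly_Mapping.lookup (a' t) u = poly (pderiv p) t"
  using assms
proof (induction rule: path_deriv.induct)
  case zero
  then show ?case by (intro exI[of _ 0]) simp
next
  case (add_monom x a a' n)
  then obtain p where "\<forall>t. Poly_Mapping.lookup (a t) u = poly p t \<and> Poly_Mapping.lookup (a' t) u = poly (pderiv p) t"
    by blast
  then show ?case
    by (intro exI[of _ "p + monom (Poly_Mapping.lookup x u) n"])
       (auto simp: lookup_add pm_lookup_scale pderiv_add pderiv_monom poly_monom)
qed

lemma path_deriv_unique:
  fixes a :: "'k::field_char_0 \<Rightarrow> 'u \<Rightarrow>\<^sub>0 'k"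
  assumes "path_deriv S a a'" "path_deriv T a a''"
  shows "a' = a''"
proof (intro ext poly_mapping_eqI)
  fix t u
  obtain p where p: "\<And>t. Poly_Mapping.lookup (a t) u = poly p t" "\<And>t. Poly_Mapping.lookup (a' t) u = poly (pderiv p) t"
    using path_deriv_coordinate[OF assms(1)] by blast
  obtain q where q: "\<And>t. Poly_Mapping.lookup (a t) u = poly q t" "\<And>t. Poly_Mapping.lookup (a'' t) u = poly (pderiv q) t"
    using path_deriv_coordinate[OF assms(2)] by blast
  have "p = q" using p(1) q(1) by (metis ext poly_eq_poly_eq_iff)
  then show "Poly_Mapping.lookup (a' t) u = Poly_Mapping.lookup (a'' t) u"
    using p(2) q(2) by simp
qed

lemma path_deriv_zero_imp_const:
  fixes a :: "'k::field_char_0 \<Rightarrow> 'u \<Rightarrow>\<^sub>0 'k"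
  assumes "path_deriv S a (\<lambda>t. 0)"
  shows "a t = a t'"
proof (rule poly_mapping_eqI)
  fix u
  obtain p where p: "\<And>t. Poly_Mapping.lookup (a t) u = poly p t" "\<And>t. (0::'k) = poly (pderiv p) t"
    using path_deriv_coordinate[OF assms, of u] by auto
  have "pderiv p = 0" using p(2) by (metis poly_all_0_iff_0)
  then have "degree p = 0" by (simp add: pderiv_eq_0_iff)
  then obtain c where "p = [:c:]" by (rule degree_eq_zeroE)
  then show "Poly_Mapping.lookup (a t) u = Poly_Mapping.lookup (a t') u"
    unfolding p(1) by simp
qed

lemma sum_singles: "(\<Sum>u\<in>Poly_Mapping.keys x. pm_scale (Poly_Mapping.lookup x u) (Poly_Mapping.single u 1)) = x"
  using pm_linear_id[of x] by (simp add: pm_linear_def)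

definition pair_scale :: "'k::field \<Rightarrow> ('k \<Rightarrow> 'u \<Rightarrow>\<^sub>0 'k) \<times> ('k \<Rightarrow> 'u \<Rightarrow>\<^sub>0 'k) \<Rightarrow> ('k \<Rightarrow> 'u \<Rightarrow>\<^sub>0 'k) \<times> ('k \<Rightarrow> 'u \<Rightarrow>\<^sub>0 'k)"
  where "pair_scale c = (\<lambda>(a, b). (\<lambda>t. pm_scale c (a t), \<lambda>t. pm_scale c (b t)))"

lemma vector_space_pair_scale: "vector_space pair_scale"
  by standard (auto simp: pair_scale_def fun_eq_iff pm_scale_add pm_scale_add_left pm_scale_scale)

definition basic_path :: "bool \<times> nat \<times> 'u \<Rightarrow> ('k::field \<Rightarrow> 'u \<Rightarrow>\<^sub>0 'k) \<times> ('k \<Rightarrow> 'u \<Rightarrow>\<^sub>0 'k)" where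
  "basic_path = (\<lambda>(first, n, u).
     if first then (\<lambda>t. pm_scale (t ^ n) (Poly_Mapping.single u 1), 0)
     else (0, \<lambda>t. pm_scale (t ^ n) (Poly_Mapping.single u 1)))"

text \<open>
  Pairs of polynomial paths are spanned by the monomial paths through basis vectors, a family with as many
  members as there are basis vectors.
\<close>

lemma path_pair_in_span:
  fixes a b :: "'k::field \<Rightarrow> 'u \<Rightarrow>\<^sub>0 'k"
  assumes "path_deriv UNIV a a'" "path_deriv UNIV b b'"
  shows "(a, b) \<in> module.span pair_scale (range basic_path)"
proof -
  interpret vector_space "pair_scale :: 'k \<Rightarrow> ('k \<Rightarrow> 'u \<Rightarrow>\<^sub>0 'k) \<times> ('k \<Rightarrow> 'u \<Rightarrow>\<^sub>0 'k) \<Rightarrow> _"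
    by (rule vector_space_pair_scale)
  have sum_fun: "(\<Sum>u\<in>U. (g u, 0)) = ((\<lambda>t. \<Sum>u\<in>U. g u t), 0)" "(\<Sum>u\<in>U. (0, g u)) = (0, (\<lambda>t. \<Sum>u\<in>U. g u t))"
    for g :: "'u \<Rightarrow> 'k \<Rightarrow> 'u \<Rightarrow>\<^sub>0 'k" and U
    by (induction U rule: infinite_finite_induct) (auto simp: zero_prod_def fun_eq_iff)
  have basic: "pair_scale c (basic_path (True, n, u)) = (\<lambda>t. pm_scale (t ^ n * c) (Poly_Mapping.single u 1), 0)"
    "pair_scale c (basic_path (False, n, u)) = (0, \<lambda>t. pm_scale (t ^ n * c) (Poly_Mapping.single u 1))"
    for c :: 'k and n and u :: 'u
    by (simp_all add: basic_path_def pair_scale_def pm_scale_scale mult.commute zero_fun_def)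
  have singles: "(\<Sum>u\<in>Poly_Mapping.keys x. pm_scale (c * Poly_Mapping.lookup x u) (Poly_Mapping.single u 1)) = pm_scale c x"
    for c and x :: "'u \<Rightarrow>\<^sub>0 'k"
    by (simp add: pm_scale_scale[symmetric] pm_scale_sum[symmetric] sum_singles)
  have 1: "(a, 0) \<in> span (range basic_path)"
    using assms(1)
  proof (induction rule: path_deriv.induct)
    case zero
    show ?case
      using span_zero[of "range basic_path"] by (simp only: zero_prod_def zero_fun_def)
  next
    case (add_monom x a a' n)
    have "((\<lambda>t. pm_scale (t ^ n) x), 0)
        = (\<Sum>u\<in>Poly_Mapping.keys x. pair_scale (Poly_Mapping.lookup x u) (basic_path (True, n, u)))"
      by (simp only: basic sum_fun singles)
    also have "\<dots> \<in> span (range basic_path)"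
      by (intro span_sum span_scale span_base) auto
    finally have "(a, 0) + ((\<lambda>t. pm_scale (t ^ n) x), 0) \<in> span (range basic_path)"
      by (intro span_add add_monom(3))
    then show ?case by (simp add: plus_fun_def)
  qed
  have 2: "(0, b) \<in> span (range basic_path)"
    using assms(2)
  proof (induction rule: path_deriv.induct)
    case zero
    show ?case
      using span_zero[of "range basic_path"] by (simp only: zero_prod_def zero_fun_def)
  next
    case (add_monom x a a' n)
    have "(0, (\<lambda>t. pm_scale (t ^ n) x))
        = (\<Sum>u\<in>Poly_Mapping.keys x. pair_scale (Poly_Mapping.lookup x u) (basic_path (False, n, u)))"
      by (simp only: basic sum_fun singles)
    also have "\<dots> \<in> span (range basic_path)"
      by (intro span_sum span_scale span_base) auto
    finally have "(0, a) + (0, (\<lambda>t. pm_scale (t ^ n) x)) \<in> span (range basic_path)"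
      by (intro span_add add_monom(3))
    then show ?case by (simp add: plus_fun_def)
  qed
  show ?thesis using span_add[OF 1 2] by simp
qed

lemma inj_bool_nat_times:
  obtains j :: "bool \<times> nat \<times> 'u::infinite \<Rightarrow> 'u" where "inj j"
proof -
  obtain i :: "nat \<Rightarrow> 'u" where i: "inj i"
    using infinite_countable_subset[OF infinite_UNIV] by auto
  have "inj_on (i \<circ> to_nat) (UNIV :: (bool \<times> nat) set)"
    using i by (simp add: inj_compose)
  then have "(card_of (UNIV :: (bool \<times> nat) set), card_of (UNIV :: 'u set)) \<in> ordLeq"
    using card_of_ordLeq by blast
  then have "(card_of ((UNIV :: 'u set) \<times> (UNIV :: (bool \<times> nat) set)), card_of (UNIV :: 'u set)) \<in> ordIso"
    by (intro conjunct1[OF card_of_Times_infinite]) (auto simp: infinite_UNIV)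
  then obtain h :: "'u \<times> bool \<times> nat \<Rightarrow> 'u" where "bij_betw h (UNIV \<times> UNIV) UNIV"
    using card_of_ordIso by blast
  then have h: "inj h" by (simp add: bij_betw_def)
  have "inj (\<lambda>(first, n, u). h (u, first, n))"
    using h by (auto simp: inj_def)
  then show thesis by (rule that)
qed

section \<open>The path operad of an endomorphism\<close>

text \<open>
  The situation of an endomorphism \<open>w\<close> over the operad of which \<open>C\<close> is a resolution:
  \<open>C\<close> has no homology in positive degrees, and \<open>w\<close> induces the identity in homology
  of degree 0.
\<close>

locale endomorphism_over = dg_operad C
  for C :: "('k::field_char_0, 'u::infinite \<Rightarrow>\<^sub>0 'k) operad" +
  fixes w :: "('u \<Rightarrow>\<^sub>0 'k) \<Rightarrow> ('u \<Rightarrow>\<^sub>0 'k)"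
  assumes scl_C: "scl C = pm_scale"
    and w_morphism: "operad_morphism C C w"
    and acyclic: "x \<in> cycles C I (Suc d) \<Longrightarrow> x \<in> boundaries C I (Suc d)"
    and w_homotopic: "x \<in> ops C I 0 \<Longrightarrow> w x - x \<in> boundaries C I 0"
begin

abbreviation poly_paths :: "nat set \<Rightarrow> nat \<Rightarrow> ('k \<Rightarrow> 'u \<Rightarrow>\<^sub>0 'k) set" where
  "poly_paths I d \<equiv> {a. \<exists>a'. path_deriv (ops C I d) a a'}"

definition deriv :: "('k \<Rightarrow> 'u \<Rightarrow>\<^sub>0 'k) \<Rightarrow> ('k \<Rightarrow> 'u \<Rightarrow>\<^sub>0 'k)" where
  "deriv a = (THE a'. path_deriv UNIV a a')"

text \<open>
  The sign \<open>(- 1) ^ d\<close> on the operations of degree \<open>d\<close>, as a map of the ambient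
  space: composition has no access to the degrees.
\<close>

definition parity :: "('u \<Rightarrow>\<^sub>0 'k) \<Rightarrow> ('u \<Rightarrow>\<^sub>0 'k)" where
  "parity x = (if \<exists>I d. odd d \<and> x \<in> ops C I d then - x else x)"

text \<open>
  A pair \<open>(a, b)\<close> of degree \<open>d\<close> stands for \<open>a + dt b\<close> in \<open>C
  \<otimes> k[t, dt]\<close>, where \<open>dt\<close> has degree \<open>- 1\<close>.  The complex is truncated
  to nonnegative degrees, hence the condition in degree 0, which says that the element is a cycle.  The path
  runs from \<open>a 0\<close> to \<open>w (a 0)\<close>.
\<close>

definition paths :: "nat set \<Rightarrow> nat \<Rightarrow> (('k \<Rightarrow> 'u \<Rightarrow>\<^sub>0 'k) \<times> ('k \<Rightarrow> 'u \<Rightarrow>\<^sub>0 'k)) set" where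
  "paths I d = {(a, b). a \<in> poly_paths I d \<and> b \<in> poly_paths I (Suc d) \<and> a 1 = w (a 0) \<and>
     (d = 0 \<longrightarrow> deriv a = (\<lambda>t. dif C (b t)))}"

text \<open>
  With \<open>dt\<close> written on the left, \<open>(a + dt b)(a' + dt b') = aa' + dt (ba' + (- 1) ^ d
  ab')\<close> and the differential of \<open>a + dt b\<close> is \<open>da + dt (\<partial>a / \<partial>t -
  db)\<close>, so that only the product involves a sign that depends on a degree \<open>d\<close>.
\<close>

definition path_operad :: "('k, ('k \<Rightarrow> 'u \<Rightarrow>\<^sub>0 'k) \<times> ('k \<Rightarrow> 'u \<Rightarrow>\<^sub>0 'k)) operad" where
  "path_operad = \<lparr>ops = paths, scl = pair_scale,
     pcomp = (\<lambda>i (a, b) (a', b'). (\<lambda>t. pcomp C i (a t) (a' t),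
       \<lambda>t. pcomp C i (b t) (a' t) + pcomp C i (parity (a t)) (b' t))),
     ren = (\<lambda>f (a, b). (\<lambda>t. ren C f (a t), \<lambda>t. ren C f (b t))),
     idt = (\<lambda>i. (\<lambda>t. idt C i, \<lambda>t. 0)),
     dif = (\<lambda>(a, b). (\<lambda>t. dif C (a t), \<lambda>t. deriv a t - dif C (b t)))\<rparr>"

lemmas sub = ops_subspace[unfolded scl_C]

lemma w_ops: "x \<in> ops C I d \<Longrightarrow> w x \<in> ops C I d"
  by (rule morphism_ops[OF w_morphism])

lemma w_zero [simp]: "w 0 = 0"
  by (rule morphism_zero[OF w_morphism])

lemma deriv_eq: "path_deriv S a a' \<Longrightarrow> deriv a = a'"
  unfolding deriv_def using path_deriv_mono[of S a a' UNIV] path_deriv_unique by blast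

lemma parity_eq: "x \<in> ops C I d \<Longrightarrow> parity x = pm_scale ((- 1) ^ d) x"
proof (cases "x = 0")
  case True
  then show ?thesis by (simp add: parity_def)
next
  case False
  assume x: "x \<in> ops C I d"
  have "- x = pm_scale (- 1) x"
    by (rule poly_mapping_eqI) (simp add: pm_lookup_scale)
  moreover have "(\<exists>I' d'. odd d' \<and> x \<in> ops C I' d') \<longleftrightarrow> odd d"
    using ops_unique[OF x _ False] x by blast
  ultimately show ?thesis by (auto simp: parity_def)
qed

lemma parity_zero [simp]: "parity 0 = 0"
  by (simp add: parity_def)

lemma parity_ops: "x \<in> ops C I d \<Longrightarrow> parity x \<in> ops C I d"
  using ops_scl[of x I d "(- 1) ^ d"] by (simp add: parity_eq scl_C)

lemma pathsD:
  assumes "(a, b) \<in> paths I d"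
  shows "path_deriv (ops C I d) a (deriv a)" "path_deriv (ops C I (Suc d)) b (deriv b)"
    "a 1 = w (a 0)" "d = 0 \<Longrightarrow> deriv a t = dif C (b t)"
    "a t \<in> ops C I d" "b t \<in> ops C I (Suc d)" "deriv a t \<in> ops C I d" "deriv b t \<in> ops C I (Suc d)"
proof -
  obtain a' b' where "path_deriv (ops C I d) a a'" "path_deriv (ops C I (Suc d)) b b'"
    using assms by (auto simp: paths_def)
  then show 1: "path_deriv (ops C I d) a (deriv a)" "path_deriv (ops C I (Suc d)) b (deriv b)"
    using deriv_eq by auto
  show "a 1 = w (a 0)" "d = 0 \<Longrightarrow> deriv a t = dif C (b t)"
    using assms by (auto simp: paths_def)
  show "a t \<in> ops C I d" "b t \<in> ops C I (Suc d)" "deriv a t \<in> ops C I d" "deriv b t \<in> ops C I (Suc d)"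
    using path_deriv_values[OF 1(1) sub] path_deriv_values[OF 1(2) sub] by auto
qed

lemma pathsI:
  assumes "path_deriv (ops C I d) a a'" "path_deriv (ops C I (Suc d)) b b'"
    "a 1 = w (a 0)" "d = 0 \<Longrightarrow> a' = (\<lambda>t. dif C (b t))"
  shows "(a, b) \<in> paths I d"
  using assms deriv_eq[OF assms(1)] by (auto simp: paths_def)

lemma path_deriv_scale: "path_deriv (ops C I d) a a' \<Longrightarrow> path_deriv (ops C I d) (\<lambda>t. pm_scale c (a t)) (\<lambda>t. pm_scale c (a' t))"
  by (rule path_deriv_linear[THEN conjunct1, OF _ sub])
     (auto simp: pm_scale_add pm_scale_scale mult.commute ops_scl[unfolded scl_C])

lemma path_deriv_uminus: "path_deriv (ops C I d) a a' \<Longrightarrow> path_deriv (ops C I d) (\<lambda>t. - a t) (\<lambda>t. - a' t)"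
  by (rule path_deriv_linear[THEN conjunct1, OF _ sub])
     (auto simp: ops_uminus intro!: poly_mapping_eqI simp: pm_lookup_scale)

lemma path_deriv_diff: "path_deriv (ops C I d) a a' \<Longrightarrow> path_deriv (ops C I d) b b' \<Longrightarrow>
    path_deriv (ops C I d) (\<lambda>t. a t - b t) (\<lambda>t. a' t - b' t)"
  using path_deriv_add[OF _ path_deriv_uminus, of I d a a' b b'] by simp

lemma path_deriv_parity: "path_deriv (ops C I d) a a' \<Longrightarrow> path_deriv (ops C I d) (\<lambda>t. parity (a t)) (\<lambda>t. parity (a' t))"
proof -
  assume a: "path_deriv (ops C I d) a a'"
  note v = path_deriv_values[OF a sub]
  show ?thesis
    unfolding parity_eq[OF v(1)] parity_eq[OF v(2)] by (rule path_deriv_scale[OF a])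
qed

lemma path_deriv_ren: "path_deriv (ops C I d) a a' \<Longrightarrow> inj_on f I \<Longrightarrow>
    path_deriv (ops C (f ` I) d) (\<lambda>t. ren C f (a t)) (\<lambda>t. ren C f (a' t))"
  by (rule path_deriv_linear[THEN conjunct1, OF _ sub]) (auto simp: ren_closed ren_add ren_scl[unfolded scl_C])

lemma path_deriv_dif: "path_deriv (ops C I (Suc d)) a a' \<Longrightarrow>
    path_deriv (ops C I d) (\<lambda>t. dif C (a t)) (\<lambda>t. dif C (a' t))"
  by (rule path_deriv_linear[THEN conjunct1, OF _ sub]) (auto simp: dif_closed dif_add dif_scl[unfolded scl_C])

lemma path_deriv_comp:
  assumes "path_deriv (ops C I d) a a'" "path_deriv (ops C J e) b b'" "i \<in> I" "J \<inter> (I - {i}) = {}"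
  shows "path_deriv (ops C ((I - {i}) \<union> J) (d + e)) (\<lambda>t. pcomp C i (a t) (b t))
    (\<lambda>t. pcomp C i (a' t) (b t) + pcomp C i (a t) (b' t))"
  by (rule path_deriv_bilinear[OF assms(1,2) sub sub])
     (rule comp_closed[OF assms(3,4)] comp_add_left[OF assms(3,4)] comp_add_right[OF assms(3,4)]
        comp_scl_left[OF assms(3,4), unfolded scl_C] comp_scl_right[OF assms(3,4), unfolded scl_C]; assumption)+

lemma paths_subspace: "module.subspace pair_scale (paths I d)"
proof -
  interpret P: vector_space "pair_scale :: 'k \<Rightarrow> ('k \<Rightarrow> 'u \<Rightarrow>\<^sub>0 'k) \<times> ('k \<Rightarrow> 'u \<Rightarrow>\<^sub>0 'k) \<Rightarrow> _"
    by (rule vector_space_pair_scale)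
  show ?thesis
    unfolding P.subspace_def
  proof (intro conjI ballI allI)
    have "(\<lambda>t. 0, \<lambda>t. 0) \<in> paths I d"
      by (rule pathsI[OF path_deriv.zero path_deriv.zero]) auto
    then show "0 \<in> paths I d" by (simp add: zero_prod_def zero_fun_def)
  next
    fix x y assume xy: "x \<in> paths I d" "y \<in> paths I d"
    obtain a b a2 b2 where e: "x = (a, b)" "y = (a2, b2)" by (cases x; cases y)
    note x = pathsD[OF xy(1)[unfolded e]] and y = pathsD[OF xy(2)[unfolded e]]
    have "(\<lambda>t. a t + a2 t, \<lambda>t. b t + b2 t) \<in> paths I d"
      by (rule pathsI[OF path_deriv_add[OF x(1) y(1)] path_deriv_add[OF x(2) y(2)]])
         (auto simp: x(3) y(3) x(4) y(4) morphism_add[OF w_morphism x(5) y(5)] dif_add[OF x(6) y(6)])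
    then show "x + y \<in> paths I d" by (simp add: e plus_fun_def)
  next
    fix c x assume "x \<in> paths I d"
    then obtain a b where e: "x = (a, b)" and ab: "(a, b) \<in> paths I d" by (cases x) auto
    note x = pathsD[OF ab]
    have "(\<lambda>t. pm_scale c (a t), \<lambda>t. pm_scale c (b t)) \<in> paths I d"
      by (rule pathsI[OF path_deriv_scale[OF x(1)] path_deriv_scale[OF x(2)]])
         (auto simp: x(3) x(4) morphism_scl[OF w_morphism x(5), unfolded scl_C] dif_scl[OF x(6), unfolded scl_C])
    then show "pair_scale c x \<in> paths I d" by (simp add: e pair_scale_def)
  qed
qed

lemma paths_ren:
  assumes "(a, b) \<in> paths I d" "inj_on f I"
  shows "(\<lambda>t. ren C f (a t), \<lambda>t. ren C f (b t)) \<in> paths (f ` I) d"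
proof -
  note x = pathsD[OF assms(1)]
  show ?thesis
    by (rule pathsI[OF path_deriv_ren[OF x(1) assms(2)] path_deriv_ren[OF x(2) assms(2)]])
       (auto simp: x(3) x(4) morphism_ren[OF w_morphism x(5) assms(2)] dif_ren[OF assms(2) x(6)])
qed

lemma paths_comp:
  assumes "(a, b) \<in> paths I d" "(a2, b2) \<in> paths J e" "i \<in> I" "J \<inter> (I - {i}) = {}"
  shows "(\<lambda>t. pcomp C i (a t) (a2 t), \<lambda>t. pcomp C i (b t) (a2 t) + pcomp C i (parity (a t)) (b2 t))
    \<in> paths ((I - {i}) \<union> J) (d + e)"
proof -
  note x = pathsD[OF assms(1)] and y = pathsD[OF assms(2)] and i = assms(3,4)
  have "path_deriv (ops C ((I - {i}) \<union> J) (Suc (d + e))) (\<lambda>t. pcomp C i (b t) (a2 t))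
      (\<lambda>t. pcomp C i (deriv b t) (a2 t) + pcomp C i (b t) (deriv a2 t))"
    using path_deriv_comp[OF x(2) y(1) i] by simp
  moreover have "path_deriv (ops C ((I - {i}) \<union> J) (Suc (d + e))) (\<lambda>t. pcomp C i (parity (a t)) (b2 t))
      (\<lambda>t. pcomp C i (parity (deriv a t)) (b2 t) + pcomp C i (parity (a t)) (deriv b2 t))"
    using path_deriv_comp[OF path_deriv_parity[OF x(1)] y(2) i] by simp
  ultimately show ?thesis
  proof (rule pathsI[OF path_deriv_comp[OF x(1) y(1) i] path_deriv_add])
    show "pcomp C i (a 1) (a2 1) = w (pcomp C i (a 0) (a2 0))"
      by (simp add: x(3) y(3) morphism_comp[OF w_morphism x(5) y(5) i])
  next
    assume "d + e = 0"
    then have de: "d = 0" "e = 0" by auto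
    have "pcomp C i (deriv a t) (a2 t) + pcomp C i (a t) (deriv a2 t) =
        dif C (pcomp C i (b t) (a2 t) + pcomp C i (parity (a t)) (b2 t))" for t
    proof -
      note at = x(5)[of t, unfolded de] and bt = x(6)[of t, unfolded de]
      note a2t = y(5)[of t, unfolded de] and b2t = y(6)[of t, unfolded de]
      have p: "parity (a t) = a t" using parity_eq[OF at] by simp
      have 1: "dif C (pcomp C i (b t) (a2 t)) = pcomp C i (dif C (b t)) (a2 t)"
        using dif_comp[OF i bt a2t] comp_zero_right[OF i bt] by (simp add: dif_degree_0[OF a2t])
      have 2: "dif C (pcomp C i (a t) (b2 t)) = pcomp C i (a t) (dif C (b2 t))"
        using dif_comp[OF i at b2t] comp_zero_left[OF i b2t] by (simp add: dif_degree_0[OF at])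
      have "pcomp C i (b t) (a2 t) \<in> ops C ((I - {i}) \<union> J) 1" "pcomp C i (a t) (b2 t) \<in> ops C ((I - {i}) \<union> J) 1"
        using comp_closed[OF i bt a2t] comp_closed[OF i at b2t] by auto
      then show ?thesis
        by (simp add: p dif_add 1 2 x(4)[OF de(1)] y(4)[OF de(2)])
    qed
    then show "(\<lambda>t. pcomp C i (deriv a t) (a2 t) + pcomp C i (a t) (deriv a2 t)) =
        (\<lambda>t. dif C (pcomp C i (b t) (a2 t) + pcomp C i (parity (a t)) (b2 t)))" by simp
  qed
qed

lemma paths_dif:
  assumes "(a, b) \<in> paths I (Suc d)"
  shows "(\<lambda>t. dif C (a t), \<lambda>t. deriv a t - dif C (b t)) \<in> paths I d"
proof -
  note x = pathsD[OF assms]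
  obtain a'' where a'': "path_deriv (ops C I (Suc d)) (deriv a) a''"
    using path_deriv_deriv[OF x(1) sub] by blast
  show ?thesis
  proof (rule pathsI[OF path_deriv_dif[OF x(1)] path_deriv_diff[OF a'' path_deriv_dif[OF x(2)]]])
    show "dif C (a 1) = w (dif C (a 0))"
      by (simp add: x(3) morphism_dif[OF w_morphism x(5)])
    show "(\<lambda>t. dif C (deriv a t)) = (\<lambda>t. dif C (deriv a t - dif C (b t)))"
      using x(6,7) by (simp add: dif_diff[OF x(7) dif_closed[OF x(6)]] dif_dif[OF x(6)])
  qed
qed

lemma path_operad_simps [simp]:
  "ops path_operad = paths" "scl path_operad = pair_scale"
  "pcomp path_operad i (a, b) (a', b') = (\<lambda>t. pcomp C i (a t) (a' t),
       \<lambda>t. pcomp C i (b t) (a' t) + pcomp C i (parity (a t)) (b' t))"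
  "ren path_operad f (a, b) = (\<lambda>t. ren C f (a t), \<lambda>t. ren C f (b t))"
  "idt path_operad i = (\<lambda>t. idt C i, \<lambda>t. 0)"
  "dif path_operad (a, b) = (\<lambda>t. dif C (a t), \<lambda>t. deriv a t - dif C (b t))"
  by (simp_all add: path_operad_def)

lemma paths_dif_0:
  assumes "(a, b) \<in> paths I 0"
  shows "dif path_operad (a, b) = 0"
  using pathsD(4)[OF assms] by (simp add: dif_degree_0[OF pathsD(5)[OF assms]] zero_prod_def zero_fun_def)

lemma paths_zero: "0 \<in> paths I d"
proof -
  have "(\<lambda>t. 0, \<lambda>t. 0) \<in> paths I d"
    by (rule pathsI[OF path_deriv.zero path_deriv.zero]) auto
  then show ?thesis by (simp add: zero_prod_def zero_fun_def)
qed

lemma signs: "pm_scale ((- 1) ^ n) (pm_scale ((- 1) ^ m) x) = pm_scale ((- 1) ^ (n + m)) x"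
  by (simp add: pm_scale_scale power_add)

lemma parity_comp:
  assumes "x \<in> ops C I d" "y \<in> ops C J e" "i \<in> I" "J \<inter> (I - {i}) = {}"
  shows "parity (pcomp C i x y) = pcomp C i (parity x) (parity y)"
  using comp_closed[OF assms(3,4,1,2)]
  by (simp add: parity_eq[OF assms(1)] parity_eq[OF assms(2)] parity_eq
      comp_scl_left[OF assms(3,4), unfolded scl_C, OF assms(1) ops_scl[OF assms(2), unfolded scl_C]]
      comp_scl_right[OF assms(3,4), unfolded scl_C, OF assms(1,2)] signs)

lemma parity_ren: "x \<in> ops C I d \<Longrightarrow> inj_on f I \<Longrightarrow> parity (ren C f x) = ren C f (parity x)"
  using ren_closed[of f I x d] by (simp add: parity_eq ren_scl[unfolded scl_C])

lemma path_deriv_idt: "path_deriv (ops C {i} 0) (\<lambda>t. idt C i) (\<lambda>t. 0)"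
  by (rule path_deriv_const[OF idt_closed])

text \<open>
  The second component of each axiom is the axiom of \<open>C\<close> in the two places where the factor
  \<open>dt\<close> can stand; moving \<open>dt\<close> past an operation produces the parity.
\<close>

lemma dg_operad_path_operad: "dg_operad path_operad"
proof (rule dg_operad.intro)
  show "vector_space (scl path_operad)"
    by (simp add: vector_space_pair_scale)
  show "dg_operad_axioms path_operad"
  proof (rule dg_operad_axioms.intro, goal_cases)
    case 1
    then show ?case by (simp add: paths_subspace)
  next
    case (2 I d)
    have "x = 0" if "x \<in> paths I d" for x
    proof -
      obtain a b where e: "x = (a, b)" by (cases x)
      note x = pathsD(5,6)[OF that[unfolded e]]
      have "a t = 0" "b t = 0" for t
        using x[of t] ops_inputs[OF 2, of d] ops_inputs[OF 2, of "Suc d"] by auto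
      then show ?thesis by (simp add: e zero_prod_def fun_eq_iff)
    qed
    then show ?case using paths_zero by auto
  next
    case (3 I d I' d')
    have "x = 0" if "x \<in> paths I d" "x \<in> paths I' d'" for x
    proof -
      obtain a b where e: "x = (a, b)" by (cases x)
      note x = pathsD(5,6)[OF that(1)[unfolded e]] and y = pathsD(5,6)[OF that(2)[unfolded e]]
      have "a t = 0" "b t = 0" for t
        using ops_unique[OF x(1) y(1), of t] ops_unique[OF x(2) y(2), of t] 3 by auto
      then show ?thesis by (simp add: e zero_prod_def fun_eq_iff)
    qed
    then show ?case using paths_zero by auto
  next
    case (4 f I x d)
    obtain a b where e: "x = (a, b)" by (cases x)
    then show ?case using 4 paths_ren by simp
  next
    case (5 f I x d y)
    obtain a b a2 b2 where e: "x = (a, b)" "y = (a2, b2)" by (cases x; cases y)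
    note x = pathsD(5,6)[OF 5(2)[unfolded e path_operad_simps]] and y = pathsD(5,6)[OF 5(3)[unfolded e path_operad_simps]]
    show ?case
      by (simp add: e plus_fun_def ren_add[OF 5(1) x(1) y(1)] ren_add[OF 5(1) x(2) y(2)])
  next
    case (6 f I x d c)
    obtain a b where e: "x = (a, b)" by (cases x)
    note x = pathsD(5,6)[OF 6(2)[unfolded e path_operad_simps]]
    show ?case
      by (simp add: e pair_scale_def ren_scl[OF 6(1) x(1), unfolded scl_C] ren_scl[OF 6(1) x(2), unfolded scl_C])
  next
    case (7 x I d f g)
    obtain a b where e: "x = (a, b)" by (cases x)
    note x = pathsD(5,6)[OF 7(1)[unfolded e path_operad_simps]]
    show ?case
      using ren_cong[OF x(1) 7(2)] ren_cong[OF x(2) 7(2)] by (simp add: e)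
  next
    case (8 x I d)
    obtain a b where e: "x = (a, b)" by (cases x)
    note x = pathsD(5,6)[OF 8[unfolded e path_operad_simps]]
    show ?case by (simp add: e ren_id[OF x(1)] ren_id[OF x(2)])
  next
    case (9 f I g x d)
    obtain a b where e: "x = (a, b)" by (cases x)
    note x = pathsD(5,6)[OF 9(3)[unfolded e path_operad_simps]]
    show ?case by (simp add: e ren_ren[OF 9(1,2) x(1)] ren_ren[OF 9(1,2) x(2)])
  next
    case (10 i I J x d y e)
    obtain a b a2 b2 where e: "x = (a, b)" "y = (a2, b2)" by (cases x; cases y)
    show ?case
      using paths_comp[OF 10(3,4)[unfolded e path_operad_simps] 10(1,2)] by (simp add: e)
  next
    case (11 i I J x d x2 y e)
    obtain a b a2 b2 a3 b3 where e: "x = (a, b)" "x2 = (a2, b2)" "y = (a3, b3)" by (cases x; cases y; cases x2)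
    note x = pathsD(5,6)[OF 11(3)[unfolded e path_operad_simps]] and x2 = pathsD(5,6)[OF 11(4)[unfolded e path_operad_simps]]
      and y = pathsD(5,6)[OF 11(5)[unfolded e path_operad_simps]]
    have p: "parity (a t + a2 t) = parity (a t) + parity (a2 t)" for t
      by (simp only: parity_eq[OF x(1)] parity_eq[OF x2(1)] parity_eq[OF ops_add[OF x(1) x2(1)]] pm_scale_add)
    note add = comp_add_left[OF 11(1,2)]
    show ?case
      by (simp add: e plus_fun_def p add[OF x(1) x2(1) y(1)] add[OF x(2) x2(2) y(1)]
          add[OF parity_ops[OF x(1)] parity_ops[OF x2(1)] y(2)]) (simp only: add_ac)
  next
    case (12 i I J x d y e y2)
    obtain a b a2 b2 a3 b3 where e: "x = (a, b)" "y = (a2, b2)" "y2 = (a3, b3)" by (cases x; cases y; cases y2)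
    note x = pathsD(5,6)[OF 12(3)[unfolded e path_operad_simps]] and y = pathsD(5,6)[OF 12(4)[unfolded e path_operad_simps]]
      and y2 = pathsD(5,6)[OF 12(5)[unfolded e path_operad_simps]]
    note add = comp_add_right[OF 12(1,2)]
    show ?case
      by (simp add: e plus_fun_def add[OF x(1) y(1) y2(1)] add[OF x(2) y(1) y2(1)]
          add[OF parity_ops[OF x(1)] y(2) y2(2)]) (simp only: add_ac)
  next
    case (13 i I J x d y e c)
    obtain a b a2 b2 where e: "x = (a, b)" "y = (a2, b2)" by (cases x; cases y)
    note x = pathsD(5,6)[OF 13(3)[unfolded e path_operad_simps]] and y = pathsD(5,6)[OF 13(4)[unfolded e path_operad_simps]]
    have p: "parity (pm_scale c (a t)) = pm_scale c (parity (a t))" for t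
      by (simp only: parity_eq[OF x(1)] parity_eq[OF ops_scl[OF x(1), unfolded scl_C]] pm_scale_scale mult.commute)
    note scl = comp_scl_left[OF 13(1,2), unfolded scl_C]
    show ?case
      by (simp add: e pair_scale_def p scl[OF x(1) y(1)] scl[OF x(2) y(1)] scl[OF parity_ops[OF x(1)] y(2)] pm_scale_add)
  next
    case (14 i I J x d y e c)
    obtain a b a2 b2 where e: "x = (a, b)" "y = (a2, b2)" by (cases x; cases y)
    note x = pathsD(5,6)[OF 14(3)[unfolded e path_operad_simps]] and y = pathsD(5,6)[OF 14(4)[unfolded e path_operad_simps]]
    note scl = comp_scl_right[OF 14(1,2), unfolded scl_C]
    show ?case
      by (simp add: e pair_scale_def scl[OF x(1) y(1)] scl[OF x(2) y(1)] scl[OF parity_ops[OF x(1)] y(2)] pm_scale_add)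
  next
    case (15 i I j J K x d y e z m)
    obtain a b a2 b2 a3 b3 where e: "x = (a, b)" "y = (a2, b2)" "z = (a3, b3)" by (cases x; cases y; cases z)
    note x = pathsD(5,6)[OF 15(5)[unfolded e path_operad_simps]] and y = pathsD(5,6)[OF 15(6)[unfolded e path_operad_simps]]
      and z = pathsD(5,6)[OF 15(7)[unfolded e path_operad_simps]]
    have *: "j \<in> (I - {i}) \<union> J" "K \<inter> ((I - {i}) \<union> J - {j}) = {}" "K \<inter> (J - {j}) = {}"
      "((J - {j}) \<union> K) \<inter> (I - {i}) = {}"
      using 15(2-4) by blast+
    note seq = comp_sequential[OF 15(1-4)]
    have 1: "pcomp C j (pcomp C i (b t) (a2 t) + pcomp C i (parity (a t)) (b2 t)) (a3 t)
        = pcomp C i (b t) (pcomp C j (a2 t) (a3 t)) + pcomp C i (parity (a t)) (pcomp C j (b2 t) (a3 t))" for t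
    proof -
      have "pcomp C i (b t) (a2 t) \<in> ops C ((I - {i}) \<union> J) (Suc (d + e))"
        "pcomp C i (parity (a t)) (b2 t) \<in> ops C ((I - {i}) \<union> J) (Suc (d + e))"
        using comp_closed[OF 15(1,3) x(2) y(1)] comp_closed[OF 15(1,3) parity_ops[OF x(1)] y(2)] by auto
      from comp_add_left[OF *(1,2) this z(1)] show ?thesis
        by (simp add: seq[OF x(2) y(1) z(1)] seq[OF parity_ops[OF x(1)] y(2) z(1)])
    qed
    have 2: "pcomp C i (parity (a t)) (pcomp C j (b2 t) (a3 t) + pcomp C j (parity (a2 t)) (b3 t))
        = pcomp C i (parity (a t)) (pcomp C j (b2 t) (a3 t)) + pcomp C i (parity (a t)) (pcomp C j (parity (a2 t)) (b3 t))" for t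
    proof -
      have "pcomp C j (b2 t) (a3 t) \<in> ops C ((J - {j}) \<union> K) (Suc (e + m))"
        "pcomp C j (parity (a2 t)) (b3 t) \<in> ops C ((J - {j}) \<union> K) (Suc (e + m))"
        using comp_closed[OF 15(2) *(3) y(2) z(1)] comp_closed[OF 15(2) *(3) parity_ops[OF y(1)] z(2)] by auto
      from comp_add_right[OF 15(1) *(4) parity_ops[OF x(1)] this] show ?thesis .
    qed
    show ?case
      by (simp add: e 1 2 seq[OF x(1) y(1) z(1)] parity_comp[OF x(1) y(1) 15(1,3)]
          seq[OF parity_ops[OF x(1)] parity_ops[OF y(1)] z(2)]) (simp only: add_ac)
  next
    case (16 i I i' J K x d y e z m)
    obtain a b a2 b2 a3 b3 where e: "x = (a, b)" "y = (a2, b2)" "z = (a3, b3)" by (cases x; cases y; cases z)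
    note x = pathsD(5,6)[OF 16(7)[unfolded e path_operad_simps]] and y = pathsD(5,6)[OF 16(8)[unfolded e path_operad_simps]]
      and z = pathsD(5,6)[OF 16(9)[unfolded e path_operad_simps]]
    have *: "i' \<in> (I - {i}) \<union> J" "K \<inter> ((I - {i}) \<union> J - {i'}) = {}"
      "i \<in> (I - {i'}) \<union> K" "J \<inter> ((I - {i'}) \<union> K - {i}) = {}"
      using 16(1-6) by blast+
    note par = comp_parallel[OF 16(1-6), unfolded scl_C]
    have 1: "pcomp C i' (pcomp C i (b t) (a2 t) + pcomp C i (parity (a t)) (b2 t)) (a3 t)
        = pcomp C i' (pcomp C i (b t) (a2 t)) (a3 t) + pcomp C i' (pcomp C i (parity (a t)) (b2 t)) (a3 t)" for t
    proof -
      have "pcomp C i (b t) (a2 t) \<in> ops C ((I - {i}) \<union> J) (Suc (d + e))"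
        "pcomp C i (parity (a t)) (b2 t) \<in> ops C ((I - {i}) \<union> J) (Suc (d + e))"
        using comp_closed[OF 16(1,4) x(2) y(1)] comp_closed[OF 16(1,4) parity_ops[OF x(1)] y(2)] by auto
      from comp_add_left[OF *(1,2) this z(1)] show ?thesis .
    qed
    have 2: "pcomp C i (pcomp C i' (b t) (a3 t) + pcomp C i' (parity (a t)) (b3 t)) (a2 t)
        = pcomp C i (pcomp C i' (b t) (a3 t)) (a2 t) + pcomp C i (pcomp C i' (parity (a t)) (b3 t)) (a2 t)" for t
    proof -
      have "pcomp C i' (b t) (a3 t) \<in> ops C ((I - {i'}) \<union> K) (Suc (d + m))"
        "pcomp C i' (parity (a t)) (b3 t) \<in> ops C ((I - {i'}) \<union> K) (Suc (d + m))"
        using comp_closed[OF 16(2,5) x(2) z(1)] comp_closed[OF 16(2,5) parity_ops[OF x(1)] z(2)] by auto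
      from comp_add_left[OF *(3,4) this y(1)] show ?thesis .
    qed
    have 3: "pcomp C i' (pcomp C i (parity (a t)) (parity (a2 t))) (b3 t)
        = pm_scale ((- 1) ^ (e * m)) (pcomp C i (pcomp C i' (parity (a t)) (b3 t)) (a2 t))" for t
    proof -
      have p: "pcomp C i (pcomp C i' (parity (a t)) (b3 t)) (parity (a2 t))
          = pm_scale ((- 1) ^ e) (pcomp C i (pcomp C i' (parity (a t)) (b3 t)) (a2 t))"
        unfolding parity_eq[OF y(1)]
        by (rule comp_scl_right[OF *(3,4) comp_closed[OF 16(2,5) parity_ops[OF x(1)] z(2)] y(1), unfolded scl_C])
      have "(- 1) ^ (e * Suc m + e) = ((- 1) ^ (e * m) :: 'k)"
        by (simp add: power_add power_mult_distrib[symmetric])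
      then show ?thesis
        by (simp only: par[OF parity_ops[OF x(1)] parity_ops[OF y(1)] z(2)] p signs)
    qed
    have 4: "pcomp C i' (pcomp C i (parity (a t)) (b2 t)) (a3 t)
        = pm_scale ((- 1) ^ (e * m)) (pcomp C i (pcomp C i' (parity (a t)) (parity (a3 t))) (b2 t))" for t
    proof -
      have p1: "pcomp C i' (parity (a t)) (parity (a3 t)) = pm_scale ((- 1) ^ m) (pcomp C i' (parity (a t)) (a3 t))"
        unfolding parity_eq[OF z(1)]
        by (rule comp_scl_right[OF 16(2,5) parity_ops[OF x(1)] z(1), unfolded scl_C])
      have p: "pcomp C i (pcomp C i' (parity (a t)) (parity (a3 t))) (b2 t)
          = pm_scale ((- 1) ^ m) (pcomp C i (pcomp C i' (parity (a t)) (a3 t)) (b2 t))"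
        unfolding p1
        by (rule comp_scl_left[OF *(3,4) comp_closed[OF 16(2,5) parity_ops[OF x(1)] z(1)] y(2), unfolded scl_C])
      have "(- 1) ^ (Suc e * m) = ((- 1) ^ (e * m + m) :: 'k)"
        by (simp add: add.commute)
      then show ?thesis
        by (simp only: par[OF parity_ops[OF x(1)] y(2) z(1)] p signs)
    qed
    show ?case
      by (simp add: e pair_scale_def 1 2 3 4 par[OF x(1) y(1) z(1)] par[OF x(2) y(1) z(1)]
          parity_comp[OF x(1) y(1) 16(1,4)] parity_comp[OF x(1) z(1) 16(2,5)] pm_scale_add) (simp only: add_ac)
  next
    case (17 i I J g h x d y e)
    obtain a b a2 b2 where e: "x = (a, b)" "y = (a2, b2)" by (cases x; cases y)
    note x = pathsD(5,6)[OF 17(6)[unfolded e path_operad_simps]] and y = pathsD(5,6)[OF 17(7)[unfolded e path_operad_simps]]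
    note r = comp_ren[OF 17(1-5)]
    let ?l = "\<lambda>l. if l \<in> J then h l else g l"
    note l = inj_on_if[OF 17(3-5)]
    have "ren C ?l (pcomp C i (b t) (a2 t) + pcomp C i (parity (a t)) (b2 t))
        = ren C ?l (pcomp C i (b t) (a2 t)) + ren C ?l (pcomp C i (parity (a t)) (b2 t))" for t
    proof -
      have "pcomp C i (b t) (a2 t) \<in> ops C ((I - {i}) \<union> J) (Suc (d + e))"
        "pcomp C i (parity (a t)) (b2 t) \<in> ops C ((I - {i}) \<union> J) (Suc (d + e))"
        using comp_closed[OF 17(1,2) x(2) y(1)] comp_closed[OF 17(1,2) parity_ops[OF x(1)] y(2)] by auto
      from ren_add[OF l this] show ?thesis .
    qed
    then show ?case
      by (simp add: e parity_ren[OF x(1) 17(3)] r[OF x(1) y(1)] r[OF x(2) y(1)] r[OF parity_ops[OF x(1)] y(2)])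
  next
    case (18 i)
    show ?case
      unfolding path_operad_simps
      by (rule pathsI[OF path_deriv_idt path_deriv.zero]) (auto simp: morphism_idt[OF w_morphism])
  next
    case (19 f i)
    have "ren C f 0 = 0" by (rule ren_zero[of f "{}"]) simp
    then show ?case by (simp add: ren_idt)
  next
    case (20 y J e i)
    obtain a b where e: "y = (a, b)" by (cases y)
    note y = pathsD(5,6)[OF 20[unfolded e path_operad_simps]]
    have *: "i \<in> {i}" "J \<inter> ({i} - {i}) = {}" by auto
    have "parity (idt C i) = idt C i"
      using parity_eq[OF idt_closed] by simp
    then show ?case
      by (simp add: e comp_idt_left[OF y(1)] comp_idt_left[OF y(2)] comp_zero_left[OF * y(1)])
  next
    case (21 i I j x d)
    obtain a b where e: "x = (a, b)" by (cases x)
    note x = pathsD(5,6)[OF 21(3)[unfolded e path_operad_simps]]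
    have *: "{j} \<inter> (I - {i}) = {}" using 21(2) by auto
    show ?case
      by (simp add: e comp_idt_right[OF 21(1,2) x(1)] comp_idt_right[OF 21(1,2) x(2)]
          comp_zero_right[OF 21(1) * parity_ops[OF x(1)]])
  next
    case (22 x I d)
    obtain a b where e: "x = (a, b)" by (cases x)
    then show ?case using 22 paths_dif by simp
  next
    case (23 x I)
    obtain a b where e: "x = (a, b)" by (cases x)
    then show ?case using 23 paths_dif_0[of a b I] by simp
  next
    case (24 x I d y)
    obtain a b a2 b2 where e: "x = (a, b)" "y = (a2, b2)" by (cases x; cases y)
    note x = pathsD[OF 24(1)[unfolded e path_operad_simps]] and y = pathsD[OF 24(2)[unfolded e path_operad_simps]]
    show ?case
      using deriv_eq[OF path_deriv_add[OF x(1) y(1)]]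
      by (simp add: e plus_fun_def dif_add[OF x(5) y(5)] dif_add[OF x(6) y(6)] add_diff_add)
  next
    case (25 x I d c)
    obtain a b where e: "x = (a, b)" by (cases x)
    note x = pathsD[OF 25[unfolded e path_operad_simps]]
    show ?case
      using deriv_eq[OF path_deriv_scale[OF x(1), of c]]
      by (simp add: e pair_scale_def dif_scl[OF x(5), unfolded scl_C] dif_scl[OF x(6), unfolded scl_C] pm_scale_minus)
  next
    case (26 x I d)
    obtain a b where e: "x = (a, b)" by (cases x)
    note ab = 26[unfolded e path_operad_simps] and x = pathsD[OF 26[unfolded e path_operad_simps]]
    show ?case
    proof (cases d)
      case 0
      then have "dif path_operad x = 0" using paths_dif_0 ab e by simp
      moreover have "dif path_operad 0 = 0"
        using deriv_eq[OF path_deriv.zero[of UNIV]] by (simp add: zero_prod_def zero_fun_def)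
      ultimately show ?thesis by simp
    next
      case (Suc d')
      show ?thesis
        using deriv_eq[OF path_deriv_dif[OF x(1)[unfolded Suc]]]
        by (simp add: e dif_dif[OF x(5)] dif_diff[OF x(7) dif_closed[OF x(6)]] dif_dif[OF x(6)]
            zero_prod_def zero_fun_def)
    qed
  next
    case (27 f I x d)
    obtain a b where e: "x = (a, b)" by (cases x)
    note x = pathsD[OF 27(2)[unfolded e path_operad_simps]]
    have "ren C f (deriv a t - dif C (b t)) = ren C f (deriv a t) - ren C f (dif C (b t))" for t
      using ren_add[OF 27(1) ops_diff[OF x(7)[of t] dif_closed[OF x(6)[of t]]] dif_closed[OF x(6)[of t]]]
      by (simp add: algebra_simps)
    then show ?case
      using deriv_eq[OF path_deriv_ren[OF x(1) 27(1)]]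
      by (simp add: e dif_ren[OF 27(1) x(5)] dif_ren[OF 27(1) x(6)])
  next
    case (28 i I J x d y e)
    obtain a b a2 b2 where e: "x = (a, b)" "y = (a2, b2)" by (cases x; cases y)
    note x = pathsD[OF 28(3)[unfolded e path_operad_simps]] and y = pathsD[OF 28(4)[unfolded e path_operad_simps]]
    note i = 28(1,2)
    let ?\<sigma> = "(- 1) ^ d :: 'k"
    have neg: "pm_scale (- c) z = - pm_scale c z" for c :: 'k and z :: "'u \<Rightarrow>\<^sub>0 'k"
      by (rule poly_mapping_eqI) (simp add: pm_lookup_scale)
    have snd: "pcomp C i (deriv a t) (a2 t) + pcomp C i (a t) (deriv a2 t)
          - dif C (pcomp C i (b t) (a2 t) + pcomp C i (parity (a t)) (b2 t))
        = pcomp C i (deriv a t - dif C (b t)) (a2 t) + pcomp C i (parity (dif C (a t))) (b2 t)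
          + pm_scale ?\<sigma> (pcomp C i (b t) (dif C (a2 t)) + pcomp C i (parity (a t)) (deriv a2 t - dif C (b2 t)))" for t
    proof -
      note x5 = x(5)[of t] and x6 = x(6)[of t] and x7 = x(7)[of t]
      note y5 = y(5)[of t] and y6 = y(6)[of t] and y7 = y(7)[of t]
      note pa = parity_ops[OF x5]
      have 1: "dif C (pcomp C i (b t) (a2 t) + pcomp C i (parity (a t)) (b2 t))
          = dif C (pcomp C i (b t) (a2 t)) + dif C (pcomp C i (parity (a t)) (b2 t))"
      proof -
        have "pcomp C i (b t) (a2 t) \<in> ops C ((I - {i}) \<union> J) (Suc (d + e))"
          "pcomp C i (parity (a t)) (b2 t) \<in> ops C ((I - {i}) \<union> J) (Suc (d + e))"
          using comp_closed[OF i x6 y5] comp_closed[OF i pa y6] by auto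
        from dif_add[OF this] show ?thesis .
      qed
      have 2: "dif C (pcomp C i (b t) (a2 t))
          = pcomp C i (dif C (b t)) (a2 t) - pm_scale ?\<sigma> (pcomp C i (b t) (dif C (a2 t)))"
        using dif_comp[OF i x6 y5, unfolded scl_C] by (simp add: neg)
      have 3: "dif C (pcomp C i (parity (a t)) (b2 t))
          = pcomp C i (dif C (parity (a t))) (b2 t) + pm_scale ?\<sigma> (pcomp C i (parity (a t)) (dif C (b2 t)))"
        by (rule dif_comp[OF i pa y6, unfolded scl_C])
      have 4: "pcomp C i (deriv a t - dif C (b t)) (a2 t)
          = pcomp C i (deriv a t) (a2 t) - pcomp C i (dif C (b t)) (a2 t)"
        using comp_add_left[OF i ops_diff[OF x7 dif_closed[OF x6]] dif_closed[OF x6] y5]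
        by (simp add: algebra_simps)
      have 5: "pcomp C i (parity (a t)) (deriv a2 t - dif C (b2 t))
          = pcomp C i (parity (a t)) (deriv a2 t) - pcomp C i (parity (a t)) (dif C (b2 t))"
        using comp_add_right[OF i pa ops_diff[OF y7 dif_closed[OF y6]] dif_closed[OF y6]]
        by (simp add: algebra_simps)
      have 6: "pm_scale ?\<sigma> (pcomp C i (parity (a t)) (deriv a2 t)) = pcomp C i (a t) (deriv a2 t)"
        unfolding parity_eq[OF x5] comp_scl_left[OF i x5 y7, unfolded scl_C] signs by simp
      have 7: "pcomp C i (parity (dif C (a t))) (b2 t) = - pcomp C i (dif C (parity (a t))) (b2 t)"
      proof (cases d)
        case 0
        then show ?thesis
          using x5 parity_ops[OF x5] comp_zero_left[OF i y6]
          by (simp add: dif_degree_0 parity_zero)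
      next
        case (Suc d')
        note da = dif_closed[OF x5[unfolded Suc]]
        show ?thesis
          unfolding parity_eq[OF da] parity_eq[OF x5] dif_scl[OF x5, unfolded scl_C]
            comp_scl_left[OF i da y6, unfolded scl_C]
          by (simp add: Suc neg)
      qed
      show ?thesis
        unfolding 1 2 3 4 5 7 pm_scale_add pm_scale_minus 6 by (simp add: algebra_simps)
    qed
    have "deriv (\<lambda>t. pcomp C i (a t) (a2 t)) = (\<lambda>t. pcomp C i (deriv a t) (a2 t) + pcomp C i (a t) (deriv a2 t))"
      by (rule deriv_eq[OF path_deriv_comp[OF x(1) y(1) i]])
    then show ?case
      by (simp add: e pair_scale_def plus_fun_def snd dif_comp[OF i x(5) y(5), unfolded scl_C])
  qed
qed

lemma path_operad_embedded:
  obtains \<iota> :: "('k \<Rightarrow> 'u \<Rightarrow>\<^sub>0 'k) \<times> ('k \<Rightarrow> 'u \<Rightarrow>\<^sub>0 'k) \<Rightarrow> ('u \<Rightarrow>\<^sub>0 'k)" and W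
  where "embedded_operad path_operad \<iota> W"
proof -
  interpret P: dg_operad path_operad by (rule dg_operad_path_operad)
  obtain j :: "bool \<times> nat \<times> 'u \<Rightarrow> 'u" where "inj j"
    by (rule inj_bool_nat_times)
  then obtain \<iota> :: "('k \<Rightarrow> 'u \<Rightarrow>\<^sub>0 'k) \<times> ('k \<Rightarrow> 'u \<Rightarrow>\<^sub>0 'k) \<Rightarrow> ('u \<Rightarrow>\<^sub>0 'k)"
    where \<iota>: "\<And>x y. \<iota> (x + y) = \<iota> x + \<iota> y" "\<And>c x. \<iota> (pair_scale c x) = pm_scale c (\<iota> x)"
      "inj_on \<iota> (module.span pair_scale (range basic_path))"
    using exists_linear_embedding[OF vector_space_pair_scale, of j basic_path] by metis
  have "x \<in> module.span pair_scale (range basic_path)" if "x \<in> paths I d" for x I d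
  proof -
    obtain a b where e: "x = (a, b)" by (cases x)
    note ab = pathsD[OF that[unfolded e]]
    show ?thesis
      unfolding e by (rule path_pair_in_span[OF path_deriv_mono[OF ab(1)] path_deriv_mono[OF ab(2)]]) auto
  qed
  then have "embedded_operad path_operad \<iota> (module.span pair_scale (range basic_path))"
    using \<iota> P.subspace_span[of "range basic_path"] by unfold_locales auto
  then show thesis by (rule that)
qed

lemma path_deriv_segment:
  "x \<in> ops C I d \<Longrightarrow> y \<in> ops C I d \<Longrightarrow> path_deriv (ops C I d) (\<lambda>t. x + pm_scale t y) (\<lambda>t. y)"
  using path_deriv_add[OF path_deriv_const path_deriv_monom[of y _ 1]] by simp

text \<open>
  The straight segment; in degree 0 its derivative \<open>w x - x\<close> has to be a boundary, which holds as
  \<open>w\<close> induces the identity in homology.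
\<close>

lemma exists_path_from:
  assumes x: "x \<in> ops C I d"
  shows "\<exists>a b. (a, b) \<in> paths I d \<and> a 0 = x"
proof -
  have seg: "path_deriv (ops C I d) (\<lambda>t. x + pm_scale t (w x - x)) (\<lambda>t. w x - x)"
    by (rule path_deriv_segment[OF x ops_diff[OF w_ops[OF x] x]])
  obtain z where z: "z \<in> ops C I (Suc d)" "d = 0 \<Longrightarrow> w x - x = dif C z"
  proof (cases "d = 0")
    case True
    then show ?thesis using w_homotopic[of x I] x that by (auto simp: boundaries_def)
  next
    case False
    then show ?thesis using that[OF ops_zero] by auto
  qed
  have "(\<lambda>t. x + pm_scale t (w x - x), \<lambda>t. z) \<in> paths I d"
    by (rule pathsI[OF seg path_deriv_const[OF z(1)]]) (use z(2) in auto)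
  then show ?thesis by force
qed

lemma start_morphism: "operad_morphism path_operad C (\<lambda>(a, b). a 0)"
  by (rule operad_morphismI) (auto simp: pair_scale_def scl_C dest: pathsD(5))

text \<open>
  If \<open>a 0 = dz\<close>, the primitive of \<open>b\<close> that starts at \<open>z\<close> is mapped to
  \<open>(a, b)\<close> by the differential.  Its end point misses the required \<open>w z\<close> by a cycle
  of positive degree, hence by a boundary \<open>dv\<close>, and this is corrected linearly in
  \<open>t\<close>.
\<close>

lemma cycle_from_boundary:
  assumes ab: "(a, b) \<in> paths I d" and "dif path_operad (a, b) = 0" and "a 0 \<in> boundaries C I d"
  shows "(a, b) \<in> boundaries path_operad I d"
proof -
  note x = pathsD[OF ab]
  have da: "dif C (a t) = 0" and a': "deriv a = (\<lambda>t. dif C (b t))" for t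
    using assms(2) by (auto simp: zero_prod_def fun_eq_iff)
  obtain z where z: "z \<in> ops C I (Suc d)" "a 0 = dif C z"
    using assms(3) by (auto simp: boundaries_def)
  obtain B where B: "path_deriv (ops C I (Suc d)) B b" "B 0 = 0"
    using path_deriv_antideriv[OF x(2) sub] by blast
  note Bt = path_deriv_values(1)[OF B(1) sub]
  have A0: "path_deriv (ops C I (Suc d)) (\<lambda>t. z + B t) b"
    using path_deriv_add[OF path_deriv_const[OF z(1)] B(1)] by simp
  have A0t: "z + B t \<in> ops C I (Suc d)" for t
    by (rule ops_add[OF z(1) Bt])
  have dA0: "dif C (z + B t) = a t" for t
  proof -
    have "path_deriv (ops C I d) (\<lambda>t. dif C (z + B t) - a t) (\<lambda>t. 0)"
      using path_deriv_diff[OF path_deriv_dif[OF A0] x(1)] by (simp add: a')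
    from path_deriv_zero_imp_const[OF this, of t 0] show ?thesis
      using B(2) z(2) by simp
  qed
  let ?e = "z + B 1 - w z"
  have e: "?e \<in> ops C I (Suc d)"
    by (rule ops_diff[OF A0t w_ops[OF z(1)]])
  have "dif C ?e = 0"
    using dif_diff[OF A0t w_ops[OF z(1)]] dA0[of 1] x(3) z by (simp add: morphism_dif[OF w_morphism z(1), symmetric])
  then obtain v where v: "v \<in> ops C I (Suc (Suc d))" "?e = dif C v"
    using acyclic[of ?e I d] e by (auto simp: cycles_def boundaries_def)
  let ?A = "\<lambda>t. (z + B t) - (0 + pm_scale t ?e)"
  have A: "path_deriv (ops C I (Suc d)) ?A (\<lambda>t. b t - ?e)"
    by (rule path_deriv_diff[OF A0 path_deriv_segment[OF ops_zero e]])
  have mem: "(?A, \<lambda>t. - v) \<in> paths I (Suc d)"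
    by (rule pathsI[OF A path_deriv_const[OF ops_uminus[OF v(1)]]]) (auto simp: B(2))
  have eq: "dif path_operad (?A, \<lambda>t. - v) = (a, b)"
  proof -
    have "dif C (- v) = - dif C v"
      using dif_diff[OF ops_zero v(1)] by simp
    moreover have "dif C (?A t) = a t" for t
    proof -
      have "pm_scale t ?e \<in> ops C I (Suc d)" using ops_scl[OF e, of t] by (simp add: scl_C)
      moreover have "dif C (pm_scale t ?e) = 0"
        using dif_scl[OF e, of t] \<open>dif C ?e = 0\<close> by (simp add: scl_C)
      ultimately show ?thesis using dif_diff[OF A0t, of "pm_scale t ?e" t] dA0 by simp
    qed
    ultimately show ?thesis
      unfolding path_operad_simps deriv_eq[OF A] v(2)[symmetric] by simp
  qed
  show ?thesis
    unfolding boundaries_def path_operad_simps(1) using imageI[OF mem, of "dif path_operad"] unfolding eq .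
qed

text \<open>
  The kernel consists of the paths that join 0 to 0; its homology is that of \<open>C\<close> shifted down by
  one degree, which is zero as \<open>C\<close> has homology in degree 0 only.
\<close>

lemma start_acyclic_fibration: "acyclic_fibration path_operad C (\<lambda>(a, b). a 0)"
proof -
  have onto: "(\<lambda>(a, b). a 0) ` paths I d = ops C I d" for I d
    using exists_path_from[of _ I d] pathsD(5)[of _ _ I d 0] by (force simp: image_iff)
  have zero_boundary: "0 \<in> boundaries C I d" for I d
    unfolding boundaries_def using ops_zero dif_zero by (metis image_eqI)
  have "\<exists>x\<in>cycles path_operad I d. y - (case x of (a, b) \<Rightarrow> a 0) \<in> boundaries C I d" if y: "y \<in> cycles C I d" for y I d
  proof (cases d)
    case 0
    obtain a b where ab: "(a, b) \<in> paths I d" "a 0 = y"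
      using exists_path_from[of y I d] y by (auto simp: cycles_def)
    then have "(a, b) \<in> cycles path_operad I d"
      using paths_dif_0 0 by (simp add: cycles_def del: path_operad_simps(6))
    then show ?thesis using ab(2) zero_boundary by force
  next
    case (Suc d')
    then have "y \<in> boundaries C I d" using acyclic y by simp
    moreover have "0 \<in> cycles path_operad I d"
      using dg_operad.dif_zero[OF dg_operad_path_operad] paths_zero by (simp add: cycles_def)
    ultimately show ?thesis by (force simp: zero_prod_def)
  qed
  moreover have "x \<in> boundaries path_operad I d"
    if "x \<in> cycles path_operad I d" "(case x of (a, b) \<Rightarrow> a 0) \<in> boundaries C I d" for x I d
    using that cycle_from_boundary by (cases x) (auto simp: cycles_def simp del: path_operad_simps(6))
  ultimately show ?thesis
    unfolding acyclic_fibration_def quasi_iso_def using start_morphism onto by simp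
qed

text \<open>
  A section of the projection to the starting point: a natural choice of a path from \<open>x\<close> to
  \<open>w x\<close>.
\<close>

lemma exists_homotopy:
  assumes "cofibrant C"
  obtains L where "operad_morphism C path_operad L" "\<And>I d x. x \<in> ops C I d \<Longrightarrow> fst (L x) 0 = x"
proof -
  obtain \<iota> :: "('k \<Rightarrow> 'u \<Rightarrow>\<^sub>0 'k) \<times> ('k \<Rightarrow> 'u \<Rightarrow>\<^sub>0 'k) \<Rightarrow> ('u \<Rightarrow>\<^sub>0 'k)" and W
    where emb: "embedded_operad path_operad \<iota> W" by (rule path_operad_embedded)
  have "embedded_operad C (\<lambda>x. x) UNIV"
    using subspace_UNIV by unfold_locales (auto simp: scl_C)
  from cofibrant_lift[OF assms emb this start_acyclic_fibration operad_morphism_id]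
  obtain L where "operad_morphism C path_operad L"
    "\<And>I d x. x \<in> ops C I d \<Longrightarrow> (case L x of (a, b) \<Rightarrow> a 0) = id x" by metis
  then show thesis using that by (simp add: case_prod_beta)
qed

end

section \<open>Derivations and homotopies\<close>

definition integral01 :: "('k::field_char_0 \<Rightarrow> 'u \<Rightarrow>\<^sub>0 'k) \<Rightarrow> 'u \<Rightarrow>\<^sub>0 'k" where
  "integral01 b = (THE x. \<exists>B. path_deriv UNIV B b \<and> x = B 1 - B 0)"

text \<open>
  Two primitives differ by a constant.
\<close>

lemma integral01_eq:
  fixes b :: "'k::field_char_0 \<Rightarrow> 'u \<Rightarrow>\<^sub>0 'k"
  assumes "path_deriv S B b"
  shows "integral01 b = B 1 - B 0"
  unfolding integral01_def
proof (rule the_equality)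
  interpret vector_space "pm_scale :: 'k \<Rightarrow> ('u \<Rightarrow>\<^sub>0 'k) \<Rightarrow> _" by (rule vector_space_pm_scale)
  have B: "path_deriv UNIV B b" using path_deriv_mono[OF assms] by simp
  then show "\<exists>B'. path_deriv UNIV B' b \<and> B 1 - B 0 = B' 1 - B' 0" by blast
  fix x assume "\<exists>B'. path_deriv UNIV B' b \<and> x = B' 1 - B' 0"
  then obtain B' where B': "path_deriv UNIV B' b" "x = B' 1 - B' 0" by blast
  have "path_deriv UNIV (\<lambda>t. - B t) (\<lambda>t. - b t)"
    using path_deriv_linear[OF B, of uminus UNIV]
    by (auto intro!: poly_mapping_eqI simp: pm_lookup_scale subspace_UNIV)
  from path_deriv_add[OF B'(1) this] have "path_deriv UNIV (\<lambda>t. B' t - B t) (\<lambda>t. 0)" by simp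
  from path_deriv_zero_imp_const[OF this, of 1 0] show "x = B 1 - B 0"
    using B'(2) by (metis add_diff_cancel_left diff_add_cancel diff_diff_eq2 diff_eq_diff_eq)
qed

lemma integral01_in:
  fixes b :: "'k::field_char_0 \<Rightarrow> 'u \<Rightarrow>\<^sub>0 'k"
  assumes "path_deriv S b b'" "module.subspace pm_scale S"
  shows "integral01 b \<in> S"
proof -
  interpret vector_space "pm_scale :: 'k \<Rightarrow> ('u \<Rightarrow>\<^sub>0 'k) \<Rightarrow> _" by (rule vector_space_pm_scale)
  obtain B where B: "path_deriv S B b" using path_deriv_antideriv[OF assms] by blast
  show ?thesis
    unfolding integral01_eq[OF B]
    by (rule subspace_diff[OF assms(2) path_deriv_values(1)[OF B assms(2)] path_deriv_values(1)[OF B assms(2)]])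
qed

lemma integral01_add:
  fixes b :: "'k::field_char_0 \<Rightarrow> 'u \<Rightarrow>\<^sub>0 'k"
  assumes "path_deriv S b b'" "path_deriv S c c'" "module.subspace pm_scale S"
  shows "integral01 (\<lambda>t. b t + c t) = integral01 b + integral01 c"
proof -
  obtain B where B: "path_deriv S B b" using path_deriv_antideriv[OF assms(1,3)] by blast
  obtain C where C: "path_deriv S C c" using path_deriv_antideriv[OF assms(2,3)] by blast
  show ?thesis
    unfolding integral01_eq[OF B] integral01_eq[OF C] integral01_eq[OF path_deriv_add[OF B C]] by simp
qed

lemma integral01_linear:
  fixes b :: "'k::field_char_0 \<Rightarrow> 'u \<Rightarrow>\<^sub>0 'k" and L :: "('u \<Rightarrow>\<^sub>0 'k) \<Rightarrow> ('u \<Rightarrow>\<^sub>0 'k)"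
  assumes b: "path_deriv S b b'" and S: "module.subspace pm_scale S"
    and add: "\<And>x y. x \<in> S \<Longrightarrow> y \<in> S \<Longrightarrow> L (x + y) = L x + L y"
    and scl: "\<And>c x. x \<in> S \<Longrightarrow> L (pm_scale c x) = pm_scale c (L x)"
  shows "integral01 (\<lambda>t. L (b t)) = L (integral01 b)"
proof -
  interpret vector_space "pm_scale :: 'k \<Rightarrow> ('u \<Rightarrow>\<^sub>0 'k) \<Rightarrow> _" by (rule vector_space_pm_scale)
  obtain B where B: "path_deriv S B b" using path_deriv_antideriv[OF b S] by blast
  note Bt = path_deriv_values(1)[OF B S]
  have LB: "path_deriv UNIV (\<lambda>t. L (B t)) (\<lambda>t. L (b t))"
    using path_deriv_linear[OF B S, of L UNIV] add scl by simp
  have "L (B 1) = L (B 1 - B 0) + L (B 0)"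
    using add[OF subspace_diff[OF S Bt Bt] Bt, of 1 0 0] by simp
  then show ?thesis
    unfolding integral01_eq[OF B] integral01_eq[OF LB] by simp
qed

lemma derivationsD:
  assumes "\<theta> \<in> derivations s M \<rho> k"
  shows derivation_support: "x \<notin> (\<Union>I. ops M I k) \<Longrightarrow> \<theta> x = 0"
    and derivation_ops: "x \<in> ops M I k \<Longrightarrow> \<theta> x \<in> ops (End_op s) I 0"
    and derivation_add: "x \<in> ops M I k \<Longrightarrow> y \<in> ops M I k \<Longrightarrow> \<theta> (x + y) = \<theta> x + \<theta> y"
    and derivation_scl: "x \<in> ops M I k \<Longrightarrow> \<theta> (scl M c x) = scl (End_op s) c (\<theta> x)"
    and derivation_ren: "x \<in> ops M I k \<Longrightarrow> inj_on f I \<Longrightarrow> \<theta> (ren M f x) = ren (End_op s) f (\<theta> x)"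
    and derivation_comp: "x \<in> ops M I d \<Longrightarrow> y \<in> ops M J e \<Longrightarrow> i \<in> I \<Longrightarrow> J \<inter> (I - {i}) = {} \<Longrightarrow>
      \<theta> (pcomp M i x y) = pcomp (End_op s) i (\<theta> x) (\<rho> y) + pcomp (End_op s) i (\<rho> x) (\<theta> y)"
proof -
  note m = assms[unfolded derivations_def mem_Collect_eq]
  show "x \<notin> (\<Union>I. ops M I k) \<Longrightarrow> \<theta> x = 0"
    by (rule m[THEN conjunct1, rule_format])
  show "x \<in> ops M I k \<Longrightarrow> \<theta> x \<in> ops (End_op s) I 0"
    by (rule m[THEN conjunct2, THEN conjunct1, rule_format])
  show "x \<in> ops M I k \<Longrightarrow> y \<in> ops M I k \<Longrightarrow> \<theta> (x + y) = \<theta> x + \<theta> y"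
    by (rule m[THEN conjunct2, THEN conjunct2, THEN conjunct1, rule_format])
  show "x \<in> ops M I k \<Longrightarrow> \<theta> (scl M c x) = scl (End_op s) c (\<theta> x)"
    by (rule m[THEN conjunct2, THEN conjunct2, THEN conjunct2, THEN conjunct1, rule_format])
  show "x \<in> ops M I k \<Longrightarrow> inj_on f I \<Longrightarrow> \<theta> (ren M f x) = ren (End_op s) f (\<theta> x)"
    by (rule m[THEN conjunct2, THEN conjunct2, THEN conjunct2, THEN conjunct2, THEN conjunct1, rule_format])
  show "x \<in> ops M I d \<Longrightarrow> y \<in> ops M J e \<Longrightarrow> i \<in> I \<Longrightarrow> J \<inter> (I - {i}) = {} \<Longrightarrow>
      \<theta> (pcomp M i x y) = pcomp (End_op s) i (\<theta> x) (\<rho> y) + pcomp (End_op s) i (\<rho> x) (\<theta> y)"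
    using m[THEN conjunct2, THEN conjunct2, THEN conjunct2, THEN conjunct2, THEN conjunct2, rule_format, of x I d y J e i]
    by blast
qed

lemma derivationsI:
  assumes "\<And>x. x \<notin> (\<Union>I. ops M I k) \<Longrightarrow> \<theta> x = 0"
    and "\<And>I x. x \<in> ops M I k \<Longrightarrow> \<theta> x \<in> ops (End_op s) I 0"
    and "\<And>I x y. x \<in> ops M I k \<Longrightarrow> y \<in> ops M I k \<Longrightarrow> \<theta> (x + y) = \<theta> x + \<theta> y"
    and "\<And>I c x. x \<in> ops M I k \<Longrightarrow> \<theta> (scl M c x) = scl (End_op s) c (\<theta> x)"
    and "\<And>I f x. x \<in> ops M I k \<Longrightarrow> inj_on f I \<Longrightarrow> \<theta> (ren M f x) = ren (End_op s) f (\<theta> x)"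
    and "\<And>I d J e i x y. x \<in> ops M I d \<Longrightarrow> y \<in> ops M J e \<Longrightarrow> i \<in> I \<Longrightarrow> J \<inter> (I - {i}) = {} \<Longrightarrow>
      \<theta> (pcomp M i x y) = pcomp (End_op s) i (\<theta> x) (\<rho> y) + pcomp (End_op s) i (\<rho> x) (\<theta> y)"
  shows "\<theta> \<in> derivations s M \<rho> k"
  unfolding derivations_def mem_Collect_eq
  by (intro conjI allI ballI impI; (elim conjE)?) (rule assms; assumption)+

lemma End_op_simps [simp]:
  "scl (End_op s) c F = (\<lambda>a. s c (F a))" "pcomp (End_op s) i F G = (\<lambda>a. F (a(i := G a)))"
  "ren (End_op s) f F = (\<lambda>a. F (a \<circ> f))"
  by (simp_all add: End_op_def)

lemma boundaries_JJss: "boundaries JJss I d = {0}"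
  by (auto simp: boundaries_def JJss_def)

context vector_space
begin

lemma End_ops_linear:
  assumes "F \<in> ops (End_op scale) I 0" "i \<in> I"
  shows "F (a(i := x + y)) = F (a(i := x)) + F (a(i := y))" "F (a(i := scale c x)) = scale c (F (a(i := x)))"
    "F (a(i := 0)) = 0" "F (a(i := x - y)) = F (a(i := x)) - F (a(i := y))"
proof -
  have *: "F (a(i := x + y)) = F (a(i := x)) + F (a(i := y)) \<and> F (a(i := scale c x)) = scale c (F (a(i := x)))" for x y c
    using assms by (auto simp: End_op_def multilinear_on_def split: if_splits)
  then show "F (a(i := x + y)) = F (a(i := x)) + F (a(i := y))" "F (a(i := scale c x)) = scale c (F (a(i := x)))"
    by blast+
  show "F (a(i := 0)) = 0" using *[of 0 0 0] by simp
  show "F (a(i := x - y)) = F (a(i := x)) - F (a(i := y))"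
    using *[of "x - y" y 0] by (simp add: algebra_simps)
qed

lemma End_ops_zero: "0 \<in> ops (End_op scale) I 0"
  by (simp add: End_op_def multilinear_on_def)

lemma End_ops_diff: "F \<in> ops (End_op scale) I 0 \<Longrightarrow> G \<in> ops (End_op scale) I 0 \<Longrightarrow> F - G \<in> ops (End_op scale) I 0"
  by (auto simp: End_op_def multilinear_on_def scale_right_diff_distrib algebra_simps split: if_splits) metis+

end

text \<open>
  A cofibrant resolution of the operad together with a Jacobi-Jordan algebra.
\<close>

locale jj_resolution = jj_algebra s mul + M: dg_operad M
  for s :: "'k::field_char_0 \<Rightarrow> 'a::ab_group_add \<Rightarrow> 'a" and mul
    and M :: "('k, 'u::infinite \<Rightarrow>\<^sub>0 'k) operad" +
  fixes \<epsilon> :: "('u \<Rightarrow>\<^sub>0 'k) \<Rightarrow> 'k jjvec"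
  assumes scl_M: "scl M = pm_scale"
    and cofib: "cofibrant M"
    and resolution: "quasi_iso M JJss \<epsilon>"
begin

abbreviation \<rho> :: "('u \<Rightarrow>\<^sub>0 'k) \<Rightarrow> (nat \<Rightarrow> 'a) \<Rightarrow> 'a" where
  "\<rho> \<equiv> jj_action s mul \<circ> \<epsilon>"

lemma \<epsilon>_morphism: "operad_morphism M JJss \<epsilon>"
  using resolution by (simp add: quasi_iso_def)

lemma \<epsilon>_0: "x \<in> ops M I 0 \<Longrightarrow> \<epsilon> x \<in> jj_multilinear I"
  using morphism_ops[OF \<epsilon>_morphism, of x I 0] by (simp add: JJss_def)

lemma \<epsilon>_pos: "x \<in> ops M I d \<Longrightarrow> d > 0 \<Longrightarrow> \<epsilon> x = 0"
  using morphism_ops[OF \<epsilon>_morphism, of x I d] by (simp add: JJss_def)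

lemma \<epsilon>_dif: "x \<in> ops M I d \<Longrightarrow> \<epsilon> (dif M x) = 0"
  using morphism_dif[OF \<epsilon>_morphism, of x I d] by (simp add: JJss_def)

lemma acyclic: "x \<in> cycles M I (Suc d) \<Longrightarrow> x \<in> boundaries M I (Suc d)"
  using resolution \<epsilon>_pos[of x I "Suc d"]
  by (auto simp: quasi_iso_def cycles_def boundaries_JJss)

lemma kernel: "x \<in> ops M I 0 \<Longrightarrow> \<epsilon> x = 0 \<Longrightarrow> x \<in> boundaries M I 0"
  using resolution M.dif_degree_0[of x I]
  by (auto simp: quasi_iso_def cycles_def boundaries_JJss)

lemma \<epsilon>_onto: "\<epsilon> ` ops M I d = ops JJss I d"
proof
  show "\<epsilon> ` ops M I d \<subseteq> ops JJss I d"
    using morphism_ops[OF \<epsilon>_morphism] by auto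
  show "ops JJss I d \<subseteq> \<epsilon> ` ops M I d"
  proof
    fix y :: "'k jjvec" assume "y \<in> ops JJss I d"
    then have "y \<in> cycles JJss I d" by (simp add: cycles_def JJss_def)
    then obtain x where "x \<in> cycles M I d" "y - \<epsilon> x \<in> boundaries JJss I d"
      using resolution unfolding quasi_iso_def by blast
    then show "y \<in> \<epsilon> ` ops M I d"
      by (auto simp: cycles_def boundaries_JJss)
  qed
qed

lemma \<epsilon>_acyclic_fibration: "acyclic_fibration M JJss \<epsilon>"
  unfolding acyclic_fibration_def using resolution \<epsilon>_onto by simp

text \<open>
  The axioms are inherited from any resolution, since it maps onto the operad.
\<close>

lemma dg_operad_JJss: "dg_operad (JJss :: ('k, 'k jjvec) operad)"
proof (rule dg_operad_image[OF M.dg_operad_axioms \<epsilon>_morphism \<epsilon>_onto])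
  show "vector_space (scl JJss :: 'k \<Rightarrow> 'k jjvec \<Rightarrow> _)"
    by (simp add: JJss_def vector_space_jj_scale)
  show "ops JJss I d \<inter> ops JJss I' d' = {0 :: 'k jjvec}" if "(I, d) \<noteq> (I', d')" for I d I' d'
    using that jj_multilinear_disjoint[of I I'] by (auto simp: JJss_def zero_jj_multilinear)
  show "ren JJss g x = ren JJss h x"
    if x: "x \<in> ops JJss I d" and gh: "\<And>i. i \<in> I \<Longrightarrow> g i = h i" for x :: "'k jjvec" and I d g h
  proof -
    have "x = 0 \<or> x \<in> jj_multilinear I"
      using x by (auto simp: JJss_def split: if_splits)
    then have "x \<in> jj_multilinear I" using zero_jj_multilinear by auto
    then obtain y where y: "x = abs_jjvec y"
      "\<And>t. t \<in> Poly_Mapping.keys y \<Longrightarrow> finite I \<and> leaves t = mset_set I"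
      by (auto simp: jj_multilinear_def)
    have rel: "relabel g t = relabel h t" if "\<And>i. i \<in># leaves t \<Longrightarrow> g i = h i" for t
      using that by (induction t) auto
    have "relabel g t = relabel h t" if "t \<in> Poly_Mapping.keys y" for t
      using y(2)[OF that] gh by (intro rel) simp
    then have "relabel_vec g y = relabel_vec h y"
      unfolding relabel_vec_def pm_linear_def by (intro sum.cong) auto
    then show ?thesis by (simp add: JJss_def y(1) jj_relabel.abs_eq)
  qed
qed

lemma \<rho>_ops: "x \<in> ops M I d \<Longrightarrow> \<rho> x \<in> ops (End_op s) I 0"
  using \<epsilon>_0[of x I] \<epsilon>_pos[of x I d] jj_action_multilinear_End[of "\<epsilon> x" I]
  by (cases "d = 0") (auto intro: jj_action_multilinear_End zero_jj_multilinear)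

lemma \<rho>_zero: "\<epsilon> x = 0 \<Longrightarrow> \<rho> x = 0"
  by (simp add: fun_eq_iff)

lemma derivation_zero: "\<theta> \<in> derivations s M \<rho> k \<Longrightarrow> \<theta> 0 = 0"
  using derivation_add[of \<theta> s M \<rho> k 0 "{}" 0] M.ops_zero by simp

lemma derivation_other:
  assumes "\<theta> \<in> derivations s M \<rho> k" "x \<in> ops M I d" "d \<noteq> k"
  shows "\<theta> x = 0"
proof (cases "x = 0")
  case True
  then show ?thesis using derivation_zero[OF assms(1)] by simp
next
  case False
  then have "x \<notin> (\<Union>I. ops M I k)" using M.ops_unique[OF assms(2)] assms(3) by blast
  then show ?thesis by (rule derivation_support[OF assms(1)])
qed

lemma derivation_ops': "\<theta> \<in> derivations s M \<rho> k \<Longrightarrow> x \<in> ops M I d \<Longrightarrow> \<theta> x \<in> ops (End_op s) I 0"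
  using derivation_ops[of \<theta> s M \<rho> k x I] derivation_other[of \<theta> k x I d] End_ops_zero by (cases "d = k") auto

lemma derivation_diff:
  assumes "\<theta> \<in> derivations s M \<rho> k" "x \<in> ops M I k" "y \<in> ops M I k"
  shows "\<theta> (x - y) = \<theta> x - \<theta> y"
  using derivation_add[OF assms(1) M.ops_diff[OF assms(2,3)] assms(3)] by (simp add: algebra_simps)

lemma derivations_diff:
  assumes "\<theta> \<in> derivations s M \<rho> k" "\<tau> \<in> derivations s M \<rho> k"
  shows "\<theta> - \<tau> \<in> derivations s M \<rho> k"
proof (rule derivationsI)
  note t = derivationsD[OF assms(1)] and u = derivationsD[OF assms(2)]
  show "(\<theta> - \<tau>) x = 0" if "x \<notin> (\<Union>I. ops M I k)" for x using t(1)[OF that] u(1)[OF that] by simp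
  show "(\<theta> - \<tau>) x \<in> ops (End_op s) I 0" if "x \<in> ops M I k" for I x
    using End_ops_diff[OF t(2)[OF that] u(2)[OF that]] by simp
  show "(\<theta> - \<tau>) (x + y) = (\<theta> - \<tau>) x + (\<theta> - \<tau>) y" if "x \<in> ops M I k" "y \<in> ops M I k" for I x y
    using t(3)[OF that] u(3)[OF that] by simp
  show "(\<theta> - \<tau>) (scl M c x) = scl (End_op s) c ((\<theta> - \<tau>) x)" if "x \<in> ops M I k" for I c x
    using t(4)[OF that] u(4)[OF that] by (simp add: fun_eq_iff scale_right_diff_distrib)
  show "(\<theta> - \<tau>) (ren M f x) = ren (End_op s) f ((\<theta> - \<tau>) x)" if "x \<in> ops M I k" "inj_on f I" for I f x
    using t(5)[OF that] u(5)[OF that] by (simp add: fun_eq_iff)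
  show "(\<theta> - \<tau>) (pcomp M i x y) = pcomp (End_op s) i ((\<theta> - \<tau>) x) (\<rho> y) + pcomp (End_op s) i (\<rho> x) ((\<theta> - \<tau>) y)"
    if "x \<in> ops M I d" "y \<in> ops M J e" "i \<in> I" "J \<inter> (I - {i}) = {}" for I d J e i x y
    using t(6)[OF that] u(6)[OF that] End_ops_linear(4)[OF \<rho>_ops[OF that(1)] that(3)]
    by (simp add: fun_eq_iff algebra_simps)
qed

lemma derivations_uminus: "\<theta> \<in> derivations s M \<rho> k \<Longrightarrow> - \<theta> \<in> derivations s M \<rho> k"
  using derivations_diff[OF derivations_diff, of \<theta> k \<theta> \<theta>] by simp

lemma endomorphism_over:
  assumes w: "operad_morphism M M w" and over: "\<And>I d x. x \<in> ops M I d \<Longrightarrow> \<epsilon> (w x) = \<epsilon> x"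
  shows "endomorphism_over M w"
proof unfold_locales
  show "w x - x \<in> boundaries M I 0" if x: "x \<in> ops M I 0" for x I
  proof (rule kernel)
    note wx = morphism_ops[OF w x]
    show d: "w x - x \<in> ops M I 0" by (rule M.ops_diff[OF wx x])
    show "\<epsilon> (w x - x) = 0"
      using morphism_add[OF \<epsilon>_morphism d x] over[OF x] by simp
  qed
qed (use scl_M w acyclic in auto)

lemma derivation_comp_zero:
  assumes \<theta>: "\<theta> \<in> derivations s M \<rho> k"
    and x: "x \<in> ops M I d" "\<epsilon> x = 0" and y: "y \<in> ops M J e" "\<epsilon> y = 0"
    and i: "i \<in> I" "J \<inter> (I - {i}) = {}"
  shows "\<theta> (pcomp M i x y) = 0"
  using derivation_comp[OF \<theta> x(1) y(1) i] End_ops_linear(3)[OF derivation_ops'[OF \<theta> x(1)] i(1)]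
  by (simp add: x(2) y(2) fun_eq_iff)

text \<open>
  The integral has all its coefficients in the subspace of operations that \<open>\<theta>\<close> kills:
  where \<open>\<epsilon>\<close> vanishes on both factors, both terms of the Leibniz rule vanish.
\<close>

lemma derivation_integral_zero:
  assumes \<theta>: "\<theta> \<in> derivations s M \<rho> k"
    and a: "path_deriv S a a'" "module.subspace pm_scale S" "S \<subseteq> ops M I d" "\<And>x. x \<in> S \<Longrightarrow> \<epsilon> x = 0"
    and b: "path_deriv T b b'" "module.subspace pm_scale T" "T \<subseteq> ops M J e" "\<And>x. x \<in> T \<Longrightarrow> \<epsilon> x = 0"
    and i: "i \<in> I" "J \<inter> (I - {i}) = {}" and k: "d + e = k"
  shows "\<theta> (integral01 (\<lambda>t. pcomp M i (a t) (b t))) = 0"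
proof -
  let ?K = "{z \<in> ops M ((I - {i}) \<union> J) k. \<theta> z = 0}"
  have "M.subspace ?K"
    unfolding M.subspace_def
    by (auto simp: M.ops_add M.ops_scl derivation_zero[OF \<theta>] derivation_add[OF \<theta>] derivation_scl[OF \<theta>] fun_eq_iff)
  then have K: "module.subspace pm_scale ?K" by (simp add: scl_M)
  have "path_deriv ?K (\<lambda>t. pcomp M i (a t) (b t)) (\<lambda>t. pcomp M i (a' t) (b t) + pcomp M i (a t) (b' t))"
  proof (rule path_deriv_bilinear[OF a(1) b(1) a(2) b(2)])
    show "pcomp M i x y \<in> ?K" if "x \<in> S" "y \<in> T" for x y
      using M.comp_closed[OF i subsetD[OF a(3) that(1)] subsetD[OF b(3) that(2)]] k
        derivation_comp_zero[OF \<theta> subsetD[OF a(3) that(1)] a(4)[OF that(1)] subsetD[OF b(3) that(2)] b(4)[OF that(2)] i]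
      by simp
    show "pcomp M i (x + x') y = pcomp M i x y + pcomp M i x' y" if "x \<in> S" "x' \<in> S" "y \<in> T" for x x' y
      using M.comp_add_left[OF i subsetD[OF a(3) that(1)] subsetD[OF a(3) that(2)] subsetD[OF b(3) that(3)]] .
    show "pcomp M i x (y + y') = pcomp M i x y + pcomp M i x y'" if "x \<in> S" "y \<in> T" "y' \<in> T" for x y y'
      using M.comp_add_right[OF i subsetD[OF a(3) that(1)] subsetD[OF b(3) that(2)] subsetD[OF b(3) that(3)]] .
    show "pcomp M i (pm_scale c x) y = pm_scale c (pcomp M i x y)" if "x \<in> S" "y \<in> T" for c x y
      using M.comp_scl_left[OF i subsetD[OF a(3) that(1)] subsetD[OF b(3) that(2)]] by (simp add: scl_M)
    show "pcomp M i x (pm_scale c y) = pm_scale c (pcomp M i x y)" if "x \<in> S" "y \<in> T" for c x y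
      using M.comp_scl_right[OF i subsetD[OF a(3) that(1)] subsetD[OF b(3) that(2)]] by (simp add: scl_M)
  qed
  then show ?thesis using integral01_in[OF _ K] by blast
qed

lemma kernel_subspace: "module.subspace pm_scale {z \<in> ops M I d. \<epsilon> z = 0}"
proof -
  interpret J: vector_space "jj_scale :: 'k \<Rightarrow> 'k jjvec \<Rightarrow> _" by (rule vector_space_jj_scale)
  have "M.subspace {z \<in> ops M I d. \<epsilon> z = 0}"
    unfolding M.subspace_def
  proof (intro conjI ballI allI)
    show "0 \<in> {z \<in> ops M I d. \<epsilon> z = 0}"
      by (simp add: M.morphism_zero[OF \<epsilon>_morphism])
    show "x + y \<in> {z \<in> ops M I d. \<epsilon> z = 0}"
      if "x \<in> {z \<in> ops M I d. \<epsilon> z = 0}" "y \<in> {z \<in> ops M I d. \<epsilon> z = 0}" for x y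
      using that morphism_add[OF \<epsilon>_morphism, of x I d y] by (simp add: M.ops_add)
    show "scl M c x \<in> {z \<in> ops M I d. \<epsilon> z = 0}" if "x \<in> {z \<in> ops M I d. \<epsilon> z = 0}" for c x
      using that morphism_scl[OF \<epsilon>_morphism, of x I d c] by (simp add: M.ops_scl JJss_def)
  qed
  then show ?thesis by (simp add: scl_M)
qed

text \<open>
  The derivation \<open>\<tau> x = \<theta> (\<integral> b x)\<close>, where \<open>(a x, b x)\<close> is the
  chosen path from \<open>x\<close> to \<open>w x\<close>.  The identity \<open>\<tau> (d x) = \<theta> (w x)
  - \<theta> x\<close> is the fundamental theorem of calculus, as \<open>b (d x) = \<partial>(a x) /
  \<partial>t - d (b x)\<close> and \<open>\<theta>\<close> kills boundaries.  For the Leibniz rule,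
  \<open>\<rho>\<close> has to be constant along paths in degree 0, and it is, because they move by
  boundaries.
\<close>

lemma homotopic_derivations:
  assumes w: "operad_morphism M M w" and over: "\<And>I d x. x \<in> ops M I d \<Longrightarrow> \<epsilon> (w x) = \<epsilon> x"
    and \<theta>: "\<theta> \<in> derivations s M \<rho> (Suc k)"
    and cocycle: "\<And>I x. x \<in> ops M I (Suc (Suc k)) \<Longrightarrow> \<theta> (dif M x) = 0"
  shows "\<exists>\<tau>\<in>derivations s M \<rho> k. \<forall>I. \<forall>x\<in>ops M I (Suc k). \<theta> (w x) - \<theta> x = \<tau> (dif M x)"
proof -
  interpret W: endomorphism_over M w by (rule endomorphism_over[OF w over])
  obtain L where L: "operad_morphism M W.path_operad L"
    and start: "\<And>I d x. x \<in> ops M I d \<Longrightarrow> fst (L x) 0 = x"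
    using W.exists_homotopy[OF cofib] by metis
  define a where "a x = fst (L x)" for x
  define b where "b x = snd (L x)" for x
  have Lx: "L x = (a x, b x)" for x by (simp add: a_def b_def)
  have path: "(a x, b x) \<in> W.paths I d" if "x \<in> ops M I d" for x I d
    using morphism_ops[OF L that] by (simp add: Lx)
  note pD = W.pathsD[OF path]
  have a0: "a x 0 = x" if "x \<in> ops M I d" for x I d using start[OF that] by (simp add: a_def)
  have sub: "module.subspace pm_scale (ops M I d)" for I d by (rule W.sub)
  define T where "T x = \<theta> (integral01 (b x))" for x
  have int_ops: "integral01 (b x) \<in> ops M I (Suc d)" if "x \<in> ops M I d" for x I d
    by (rule integral01_in[OF pD(2)[OF that] sub])
  have L0: "L 0 = 0" using M.morphism_zero[OF L] .
  have T0: "T x = 0" if "x \<in> ops M I d" "d \<noteq> k" for x I d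
    unfolding T_def using derivation_other[OF \<theta> int_ops[OF that(1)]] that(2) by simp
  have T_End: "T x \<in> ops (End_op s) I 0" if "x \<in> ops M I d" for x I d
    unfolding T_def by (rule derivation_ops'[OF \<theta> int_ops[OF that]])
  define \<tau> where "\<tau> x = (if x \<in> (\<Union>I. ops M I k) then T x else 0)" for x
  have \<tau>: "\<tau> x = T x" if "x \<in> ops M I d" for x I d
    using that T0[OF that] by (cases "d = k") (auto simp: \<tau>_def)
  have comp_b: "b (pcomp M i x y) = (\<lambda>t. pcomp M i (b x t) (a y t) + pcomp M i (W.parity (a x t)) (b y t))"
    if "x \<in> ops M I d" "y \<in> ops M J e" "i \<in> I" "J \<inter> (I - {i}) = {}" for x y I J d e i
    using morphism_comp[OF L that] by (simp add: Lx b_def[symmetric])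
  \<comment> \<open>the path differs from a constant one by elements on which \<open>\<rho>\<close> vanishes: in degree 0 by boundaries\<close>
  have near: "\<exists>y\<in>ops M I d. \<rho> y = \<rho> x
      \<and> (\<exists>c c'. path_deriv {z \<in> ops M I d. \<epsilon> z = 0} c c' \<and> a x = (\<lambda>t. y + c t))
      \<and> (\<exists>c c'. path_deriv {z \<in> ops M I d. \<epsilon> z = 0} c c' \<and> (\<lambda>t. W.parity (a x t)) = (\<lambda>t. y + c t))"
    if x: "x \<in> ops M I d" for x I d
  proof (cases d)
    case 0
    note x0 = x[unfolded 0]
    obtain B where B: "path_deriv (ops M I 1) B (b x)" "B 0 = 0"
      using path_deriv_antideriv[OF pD(2)[OF x0] sub] by auto
    let ?c = "\<lambda>t. dif M (B t)"
    have c: "path_deriv {z \<in> ops M I 0. \<epsilon> z = 0} ?c (\<lambda>t. dif M (b x t))"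
      by (rule path_deriv_linear[THEN conjunct1, OF B(1) sub])
         (auto simp: M.dif_closed \<epsilon>_dif M.dif_add M.dif_scl[unfolded scl_M])
    have "path_deriv (ops M I 0) ?c (\<lambda>t. dif M (b x t))"
      by (rule path_deriv_mono[OF c]) auto
    from W.path_deriv_diff[OF pD(1)[OF x0] this]
    have d: "path_deriv (ops M I 0) (\<lambda>t. a x t - dif M (B t)) (\<lambda>t. 0)"
      using pD(4)[OF x0] by simp
    have "a x = (\<lambda>t. x + ?c t)"
      using path_deriv_zero_imp_const[OF d, of _ 0] a0[OF x] B(2) by (auto simp: algebra_simps fun_eq_iff)
    moreover have "W.parity (a x t) = a x t" for t
      using W.parity_eq[OF pD(5)[OF x0]] by simp
    ultimately have "(\<exists>c c'. path_deriv {z \<in> ops M I d. \<epsilon> z = 0} c c' \<and> a x = (\<lambda>t. x + c t))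
      \<and> (\<exists>c c'. path_deriv {z \<in> ops M I d. \<epsilon> z = 0} c c' \<and> (\<lambda>t. W.parity (a x t)) = (\<lambda>t. x + c t))"
      using c 0 by metis
    then show ?thesis using x by blast
  next
    case (Suc d')
    have "{z \<in> ops M I d. \<epsilon> z = 0} = ops M I d" using \<epsilon>_pos Suc by auto
    moreover have "\<rho> 0 = \<rho> x"
      using \<epsilon>_pos[OF x] M.morphism_zero[OF \<epsilon>_morphism] Suc by simp
    ultimately show ?thesis
      using pD(1)[OF x] W.path_deriv_parity[OF pD(1)[OF x]] by (intro bexI[of _ 0]) auto
  qed
  have comp_left: "\<theta> (integral01 (\<lambda>t. pcomp M i (b x t) (a y t))) = (\<lambda>v. T x (v(i := \<rho> y v)))"
    if x: "x \<in> ops M I d" and y: "y \<in> ops M J e" and i: "i \<in> I" "J \<inter> (I - {i}) = {}" and k: "d + e = k"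
    for x y I J d e i
  proof -
    obtain y' c c' where y': "y' \<in> ops M J e" "\<rho> y' = \<rho> y"
      and c: "path_deriv {z \<in> ops M J e. \<epsilon> z = 0} c c'" "a y = (\<lambda>t. y' + c t)"
      using near[OF y] by blast
    have c0: "path_deriv (ops M J e) c c'" by (rule path_deriv_mono[OF c(1)]) auto
    have "pcomp M i (b x t) (y' + c t) = pcomp M i (b x t) y' + pcomp M i (b x t) (c t)" for t
      by (rule M.comp_add_right[OF i pD(6)[OF x] y'(1) path_deriv_values(1)[OF c0 sub]])
    moreover note const = W.path_deriv_comp[OF pD(2)[OF x] path_deriv_const[OF y'(1)] i, unfolded add_Suc k]
    moreover note rest = W.path_deriv_comp[OF pD(2)[OF x] c0 i, unfolded add_Suc k]
    ultimately have "integral01 (\<lambda>t. pcomp M i (b x t) (a y t))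
        = integral01 (\<lambda>t. pcomp M i (b x t) y') + integral01 (\<lambda>t. pcomp M i (b x t) (c t))"
      using integral01_add[OF const rest sub] by (simp add: c(2))
    moreover have "integral01 (\<lambda>t. pcomp M i (b x t) y') = pcomp M i (integral01 (b x)) y'"
      by (rule integral01_linear[OF pD(2)[OF x] sub])
         (auto simp: M.comp_add_left[OF i _ _ y'(1)] M.comp_scl_left[OF i _ y'(1), unfolded scl_M])
    moreover have "\<theta> (integral01 (\<lambda>t. pcomp M i (b x t) (c t))) = 0"
      by (rule derivation_integral_zero[OF \<theta> pD(2)[OF x] sub order.refl _ c(1) kernel_subspace _ _ i])
         (use k in \<open>auto intro: \<epsilon>_pos\<close>)
    moreover have "\<theta> (pcomp M i (integral01 (b x)) y') = (\<lambda>v. T x (v(i := \<rho> y v)))"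
      using derivation_comp[OF \<theta> int_ops[OF x] y'(1) i] \<rho>_zero[OF \<epsilon>_pos[OF int_ops[OF x]]] y'(2)
      by (simp add: T_def fun_eq_iff)
    ultimately show ?thesis
      using derivation_add[OF \<theta> integral01_in[OF const sub] integral01_in[OF rest sub]] by simp
  qed
  have comp_right: "\<theta> (integral01 (\<lambda>t. pcomp M i (W.parity (a x t)) (b y t))) = (\<lambda>v. \<rho> x (v(i := T y v)))"
    if x: "x \<in> ops M I d" and y: "y \<in> ops M J e" and i: "i \<in> I" "J \<inter> (I - {i}) = {}" and k: "d + e = k"
    for x y I J d e i
  proof -
    obtain x' c c' where x': "x' \<in> ops M I d" "\<rho> x' = \<rho> x"
      and c: "path_deriv {z \<in> ops M I d. \<epsilon> z = 0} c c'" "(\<lambda>t. W.parity (a x t)) = (\<lambda>t. x' + c t)"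
      using near[OF x] by blast
    have c0: "path_deriv (ops M I d) c c'" by (rule path_deriv_mono[OF c(1)]) auto
    have "pcomp M i (x' + c t) (b y t) = pcomp M i x' (b y t) + pcomp M i (c t) (b y t)" for t
      by (rule M.comp_add_left[OF i x'(1) path_deriv_values(1)[OF c0 sub] pD(6)[OF y]])
    moreover note const = W.path_deriv_comp[OF path_deriv_const[OF x'(1)] pD(2)[OF y] i, unfolded add_Suc_right k]
    moreover note rest = W.path_deriv_comp[OF c0 pD(2)[OF y] i, unfolded add_Suc_right k]
    ultimately have "integral01 (\<lambda>t. pcomp M i (W.parity (a x t)) (b y t))
        = integral01 (\<lambda>t. pcomp M i x' (b y t)) + integral01 (\<lambda>t. pcomp M i (c t) (b y t))"
      using integral01_add[OF const rest sub] by (simp add: fun_cong[OF c(2)])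
    moreover have "integral01 (\<lambda>t. pcomp M i x' (b y t)) = pcomp M i x' (integral01 (b y))"
      by (rule integral01_linear[OF pD(2)[OF y] sub])
         (auto simp: M.comp_add_right[OF i x'(1)] M.comp_scl_right[OF i x'(1), unfolded scl_M])
    moreover have "\<theta> (integral01 (\<lambda>t. pcomp M i (c t) (b y t))) = 0"
      by (rule derivation_integral_zero[OF \<theta> c(1) kernel_subspace _ _ pD(2)[OF y] sub order.refl _ i])
         (use k in \<open>auto intro: \<epsilon>_pos\<close>)
    moreover have "\<theta> (pcomp M i x' (integral01 (b y))) = (\<lambda>v. \<rho> x (v(i := T y v)))"
      using derivation_comp[OF \<theta> x'(1) int_ops[OF y] i] \<rho>_zero[OF \<epsilon>_pos[OF int_ops[OF y]]] x'(2)
        End_ops_linear(3)[OF derivation_ops'[OF \<theta> x'(1)] i(1)]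
      by (simp add: T_def fun_eq_iff)
    ultimately show ?thesis
      using derivation_add[OF \<theta> integral01_in[OF const sub] integral01_in[OF rest sub]] by simp
  qed
  have "\<tau> \<in> derivations s M \<rho> k"
  proof (rule derivationsI)
    show "\<tau> x = 0" if "x \<notin> (\<Union>I. ops M I k)" for x using that by (simp add: \<tau>_def)
    show "\<tau> x \<in> ops (End_op s) I 0" if "x \<in> ops M I k" for I x
      using T_End[OF that] by (simp add: \<tau>[OF that])
    show "\<tau> (x + y) = \<tau> x + \<tau> y" if xy: "x \<in> ops M I k" "y \<in> ops M I k" for I x y
    proof -
      have "b (x + y) = (\<lambda>t. b x t + b y t)"
        using morphism_add[OF L xy] by (simp add: Lx plus_fun_def)
      then have "integral01 (b (x + y)) = integral01 (b x) + integral01 (b y)"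
        using integral01_add[OF pD(2)[OF xy(1)] pD(2)[OF xy(2)] sub] by simp
      then show ?thesis
        using derivation_add[OF \<theta> int_ops[OF xy(1)] int_ops[OF xy(2)]]
        by (simp add: \<tau>[OF xy(1)] \<tau>[OF xy(2)] \<tau>[OF M.ops_add[OF xy]] T_def)
    qed
    show "\<tau> (scl M c x) = scl (End_op s) c (\<tau> x)" if x: "x \<in> ops M I k" for I c x
    proof -
      have "b (scl M c x) = (\<lambda>t. pm_scale c (b x t))"
        using morphism_scl[OF L x, of c] by (simp add: Lx pair_scale_def)
      then have "integral01 (b (scl M c x)) = scl M c (integral01 (b x))"
        using integral01_linear[OF pD(2)[OF x] sub, of "pm_scale c"]
        by (simp add: scl_M pm_scale_add pm_scale_scale mult.commute)
      then show ?thesis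
        using derivation_scl[OF \<theta> int_ops[OF x]] by (simp add: \<tau>[OF x] \<tau>[OF M.ops_scl[OF x]] T_def)
    qed
    show "\<tau> (ren M f x) = ren (End_op s) f (\<tau> x)" if x: "x \<in> ops M I k" and f: "inj_on f I" for I f x
    proof -
      have "b (ren M f x) = (\<lambda>t. ren M f (b x t))"
        using morphism_ren[OF L x f] by (simp add: Lx)
      then have "integral01 (b (ren M f x)) = ren M f (integral01 (b x))"
        using integral01_linear[OF pD(2)[OF x] sub, of "ren M f"] f
        by (simp add: M.ren_add M.ren_scl[unfolded scl_M])
      then show ?thesis
        using derivation_ren[OF \<theta> int_ops[OF x] f] by (simp add: \<tau>[OF x] \<tau>[OF M.ren_closed[OF f x]] T_def)
    qed
    show "\<tau> (pcomp M i x y) = pcomp (End_op s) i (\<tau> x) (\<rho> y) + pcomp (End_op s) i (\<rho> x) (\<tau> y)"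
      if x: "x \<in> ops M I d" and y: "y \<in> ops M J e" and i: "i \<in> I" "J \<inter> (I - {i}) = {}" for I d J e i x y
    proof (cases "d + e = k")
      case True
      have 1: "path_deriv (ops M ((I - {i}) \<union> J) (Suc k)) (\<lambda>t. pcomp M i (b x t) (a y t))
          (\<lambda>t. pcomp M i (W.deriv (b x) t) (a y t) + pcomp M i (b x t) (W.deriv (a y) t))"
        using W.path_deriv_comp[OF pD(2)[OF x] pD(1)[OF y] i] True by simp
      have 2: "path_deriv (ops M ((I - {i}) \<union> J) (Suc k)) (\<lambda>t. pcomp M i (W.parity (a x t)) (b y t))
          (\<lambda>t. pcomp M i (W.parity (W.deriv (a x) t)) (b y t) + pcomp M i (W.parity (a x t)) (W.deriv (b y) t))"
        using W.path_deriv_comp[OF W.path_deriv_parity[OF pD(1)[OF x]] pD(2)[OF y] i] True by simp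
      have "T (pcomp M i x y) = \<theta> (integral01 (\<lambda>t. pcomp M i (b x t) (a y t)))
          + \<theta> (integral01 (\<lambda>t. pcomp M i (W.parity (a x t)) (b y t)))"
        unfolding T_def comp_b[OF x y i] integral01_add[OF 1 2 sub]
        by (rule derivation_add[OF \<theta> integral01_in[OF 1 sub] integral01_in[OF 2 sub]])
      then show ?thesis
        using comp_left[OF x y i True] comp_right[OF x y i True]
        by (simp add: \<tau>[OF x] \<tau>[OF y] \<tau>[OF M.comp_closed[OF i x y]])
    next
      case False
      have 1: "T (pcomp M i x y) = 0" by (rule T0[OF M.comp_closed[OF i x y] False])
      have 2: "(\<lambda>v. T x (v(i := \<rho> y v))) = 0"
      proof (cases "d = k")
        case True
        then have "\<rho> y = 0" using False \<rho>_zero \<epsilon>_pos[OF y] by simp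
        then show ?thesis using End_ops_linear(3)[OF T_End[OF x] i(1)] by (simp add: fun_eq_iff)
      qed (simp add: T0[OF x] fun_eq_iff)
      have 3: "(\<lambda>v. \<rho> x (v(i := T y v))) = 0"
      proof (cases "e = k")
        case True
        then have "\<rho> x = 0" using False \<rho>_zero \<epsilon>_pos[OF x] by simp
        then show ?thesis by (simp add: fun_eq_iff)
      next
        case False
        then show ?thesis
          using T0[OF y] End_ops_linear(3)[OF \<rho>_ops[OF x] i(1)] by (simp add: fun_eq_iff)
      qed
      show ?thesis
        using 1 2 3 by (simp add: \<tau>[OF x] \<tau>[OF y] \<tau>[OF M.comp_closed[OF i x y]])
    qed
  qed
  moreover have "\<theta> (w x) - \<theta> x = \<tau> (dif M x)" if x: "x \<in> ops M I (Suc k)" for I x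
  proof -
    note dx = M.dif_closed[OF x]
    have bd: "b (dif M x) = (\<lambda>t. W.deriv (a x) t - dif M (b x t))"
      using morphism_dif[OF L x] by (simp add: Lx)
    obtain B where B: "path_deriv (ops M I (Suc (Suc k))) B (b x)"
      using path_deriv_antideriv[OF pD(2)[OF x] sub] by blast
    note Bt = path_deriv_values(1)[OF B sub]
    have "integral01 (b (dif M x)) = (a x 1 - dif M (B 1)) - (a x 0 - dif M (B 0))"
      unfolding bd by (rule integral01_eq[OF W.path_deriv_diff[OF pD(1)[OF x] W.path_deriv_dif[OF B]]])
    also have "\<dots> = (w x - x) - dif M (B 1 - B 0)"
      using pD(3)[OF x] a0[OF x] by (simp add: M.dif_diff[OF Bt Bt])
    finally have "T (dif M x) = \<theta> ((w x - x) - dif M (B 1 - B 0))"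
      by (simp add: T_def)
    also have "\<dots> = \<theta> (w x) - \<theta> x"
      using derivation_diff[OF \<theta> M.ops_diff[OF W.w_ops[OF x] x] M.dif_closed[OF M.ops_diff[OF Bt Bt]]]
        derivation_diff[OF \<theta> W.w_ops[OF x] x] cocycle[OF M.ops_diff[OF Bt Bt]] by simp
    finally show ?thesis using \<tau>[OF dx] by simp
  qed
  ultimately show ?thesis by blast
qed

end

section \<open>Independence of the resolution\<close>

text \<open>
  The restriction to degree \<open>k\<close> is part of the notion of a derivation of degree \<open>k\<close>.
\<close>

definition pullback :: "('k, 'v) operad \<Rightarrow> nat \<Rightarrow> ('v \<Rightarrow> 'w) \<Rightarrow> ('w \<Rightarrow> 'b::zero) \<Rightarrow> 'v \<Rightarrow> 'b" where
  "pullback M k g \<theta> = (\<lambda>x. if x \<in> (\<Union>I. ops M I k) then \<theta> (g x) else 0)"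

lemma inner_derivation_eq:
  assumes M: "dg_operad M" and zero: "\<rho> 0 = (\<lambda>a. 0)" and f: "f 0 = 0" and x: "x \<in> ops M I 0"
  shows "inner_derivation M \<rho> f x = (\<lambda>a. f (\<rho> x a) - (\<Sum>i\<in>I. \<rho> x (a(i := f (a i)))))"
proof (cases "x = 0")
  case True
  have ex: "\<exists>I. x \<in> ops M I 0" using x by blast
  show ?thesis
    using ex by (simp only: inner_derivation_def if_True) (simp add: True zero f)
next
  case False
  have ex: "\<exists>I. x \<in> ops M I 0" using x by blast
  have "(SOME I. x \<in> ops M I 0) = I"
  proof (rule some_equality[of "\<lambda>I. x \<in> ops M I 0", OF x])
    show "J = I" if "x \<in> ops M J 0" for J
      using dg_operad.ops_unique[OF M that x False] by blast
  qed
  then show ?thesis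
    using ex by (simp only: inner_derivation_def if_True)
qed

text \<open>
  A morphism from the resolution \<open>M\<close> to the resolution \<open>R\<close> over the operad.
\<close>

locale jj_resolution_map = R: jj_resolution s mul R \<eta> + M: jj_resolution s mul M \<epsilon>
  for s :: "'k::field_char_0 \<Rightarrow> 'a::ab_group_add \<Rightarrow> 'a" and mul
    and R :: "('k, 'u::infinite \<Rightarrow>\<^sub>0 'k) operad" and \<eta>
    and M :: "('k, 'u \<Rightarrow>\<^sub>0 'k) operad" and \<epsilon> +
  fixes g :: "('u \<Rightarrow>\<^sub>0 'k) \<Rightarrow> ('u \<Rightarrow>\<^sub>0 'k)"
  assumes g: "operad_morphism M R g" and over: "x \<in> ops M I d \<Longrightarrow> \<eta> (g x) = \<epsilon> x"
begin

lemma \<rho>_g: "x \<in> ops M I d \<Longrightarrow> R.\<rho> (g x) = M.\<rho> x"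
  by (simp add: over)

lemma g_ops: "x \<in> ops M I d \<Longrightarrow> g x \<in> ops R I d"
  by (rule morphism_ops[OF g])

lemma pullback_eq:
  assumes \<theta>: "\<theta> \<in> derivations s R R.\<rho> k" and x: "x \<in> ops M I d"
  shows "pullback M k g \<theta> x = \<theta> (g x)"
  using x R.derivation_other[OF \<theta> g_ops[OF x]] by (cases "d = k") (auto simp: pullback_def)

lemma pullback_derivation:
  assumes \<theta>: "\<theta> \<in> derivations s R R.\<rho> k"
  shows "pullback M k g \<theta> \<in> derivations s M M.\<rho> k"
proof (rule derivationsI)
  note p = pullback_eq[OF \<theta>]
  show "pullback M k g \<theta> x = 0" if "x \<notin> (\<Union>I. ops M I k)" for x
    using that by (simp add: pullback_def)
  show "pullback M k g \<theta> x \<in> ops (End_op s) I 0" if x: "x \<in> ops M I k" for I x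
    unfolding p[OF x] by (rule derivation_ops[OF \<theta> g_ops[OF x]])
  show "pullback M k g \<theta> (x + y) = pullback M k g \<theta> x + pullback M k g \<theta> y"
    if xy: "x \<in> ops M I k" "y \<in> ops M I k" for I x y
    unfolding p[OF xy(1)] p[OF xy(2)] p[OF M.M.ops_add[OF xy]] morphism_add[OF g xy]
    by (rule derivation_add[OF \<theta> g_ops[OF xy(1)] g_ops[OF xy(2)]])
  show "pullback M k g \<theta> (scl M c x) = scl (End_op s) c (pullback M k g \<theta> x)" if x: "x \<in> ops M I k" for I c x
    unfolding p[OF x] p[OF M.M.ops_scl[OF x]] morphism_scl[OF g x] by (rule derivation_scl[OF \<theta> g_ops[OF x]])
  show "pullback M k g \<theta> (ren M f x) = ren (End_op s) f (pullback M k g \<theta> x)"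
    if x: "x \<in> ops M I k" and f: "inj_on f I" for I f x
    unfolding p[OF x] p[OF M.M.ren_closed[OF f x]] morphism_ren[OF g x f]
    by (rule derivation_ren[OF \<theta> g_ops[OF x] f])
  show "pullback M k g \<theta> (pcomp M i x y)
      = pcomp (End_op s) i (pullback M k g \<theta> x) (M.\<rho> y) + pcomp (End_op s) i (M.\<rho> x) (pullback M k g \<theta> y)"
    if x: "x \<in> ops M I d" and y: "y \<in> ops M J e" and i: "i \<in> I" "J \<inter> (I - {i}) = {}" for I d J e i x y
    unfolding p[OF x] p[OF y] p[OF M.M.comp_closed[OF i x y]] morphism_comp[OF g x y i]
      \<rho>_g[OF x, symmetric] \<rho>_g[OF y, symmetric]
    by (rule derivation_comp[OF \<theta> g_ops[OF x] g_ops[OF y] i])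
qed

lemma pullback_cocycle:
  assumes \<theta>: "\<theta> \<in> derivations s R R.\<rho> k" and cocycle: "\<And>I x. x \<in> ops R I (Suc k) \<Longrightarrow> \<theta> (dif R x) = 0"
    and x: "x \<in> ops M I (Suc k)"
  shows "pullback M k g \<theta> (dif M x) = 0"
  unfolding pullback_eq[OF \<theta> M.M.dif_closed[OF x]] morphism_dif[OF g x] by (rule cocycle[OF g_ops[OF x]])

lemma pullback_inner:
  assumes f: "f 0 = 0"
  shows "pullback M 0 g (inner_derivation R R.\<rho> f) = inner_derivation M M.\<rho> f"
proof
  fix x
  have zero: "R.\<rho> 0 = (\<lambda>a. 0)" "M.\<rho> 0 = (\<lambda>a. 0)"
    using R.M.morphism_zero[OF R.\<epsilon>_morphism] M.M.morphism_zero[OF M.\<epsilon>_morphism] by (simp_all add: fun_eq_iff)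
  show "pullback M 0 g (inner_derivation R R.\<rho> f) x = inner_derivation M M.\<rho> f x"
  proof (cases "x \<in> (\<Union>I. ops M I 0)")
    case True
    then obtain I where x: "x \<in> ops M I 0" by blast
    then have "pullback M 0 g (inner_derivation R R.\<rho> f) x = inner_derivation R R.\<rho> f (g x)"
      by (auto simp: pullback_def)
    then show ?thesis
      unfolding inner_derivation_eq[of M M.\<rho> f, OF M.M.dg_operad_axioms zero(2) f x]
        inner_derivation_eq[of R R.\<rho> f, OF R.M.dg_operad_axioms zero(1) f g_ops[OF x]] \<rho>_g[OF x] .
  next
    case False
    then show ?thesis by (auto simp: pullback_def inner_derivation_def)
  qed
qed

lemma pullback_coboundary:
  assumes "\<tau> \<in> derivations s R R.\<rho> k"
  shows "pullback M (Suc k) g (\<lambda>x. if x \<in> (\<Union>I. ops R I (Suc k)) then \<tau> (dif R x) else 0)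
    = (\<lambda>x. if x \<in> (\<Union>I. ops M I (Suc k)) then pullback M k g \<tau> (dif M x) else 0)"
proof
  fix x
  show "pullback M (Suc k) g (\<lambda>x. if x \<in> (\<Union>I. ops R I (Suc k)) then \<tau> (dif R x) else 0) x
    = (if x \<in> (\<Union>I. ops M I (Suc k)) then pullback M k g \<tau> (dif M x) else 0)"
  proof (cases "x \<in> (\<Union>I. ops M I (Suc k))")
    case True
    then obtain I where x: "x \<in> ops M I (Suc k)" by blast
    show ?thesis
      using True x g_ops[OF x] pullback_eq[OF assms M.M.dif_closed[OF x]] morphism_dif[OF g x]
      by (auto simp: pullback_def)
  qed (auto simp: pullback_def)
qed

end

context jj_resolution
begin

lemma cocycles_iff:
  "c \<in> def_cocycles s M \<rho> (Suc (Suc k)) \<longleftrightarrow>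
    (\<exists>\<theta>\<in>derivations s M \<rho> k. c = (0, \<theta>) \<and> (\<forall>I. \<forall>x\<in>ops M I (Suc k). \<theta> (dif M x) = 0))"
proof -
  obtain f \<theta> where c: "c = (f, \<theta>)" by (cases c)
  have "(\<lambda>x. if x \<in> (\<Union>I. ops M I (Suc k)) then \<theta> (dif M x) else 0) = 0
      \<longleftrightarrow> (\<forall>I. \<forall>x\<in>ops M I (Suc k). \<theta> (dif M x) = 0)" (is "?f = 0 \<longleftrightarrow> _")
  proof
    assume 0: "?f = 0"
    show "\<forall>I. \<forall>x\<in>ops M I (Suc k). \<theta> (dif M x) = 0"
    proof (intro allI ballI)
      fix I x assume "x \<in> ops M I (Suc k)"
      then have "?f x = \<theta> (dif M x)" by auto
      then show "\<theta> (dif M x) = 0" using fun_cong[OF 0, of x] by simp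
    qed
  next
    assume "\<forall>I. \<forall>x\<in>ops M I (Suc k). \<theta> (dif M x) = 0"
    then show "?f = 0" by (intro ext) auto
  qed
  then show ?thesis
    unfolding c def_cocycles_def def_cochains.simps by (auto simp: zero_prod_def)
qed

lemma coboundaries_2:
  "c \<in> def_coboundaries s M \<rho> (Suc (Suc 0)) \<longleftrightarrow>
    (\<exists>f. (\<forall>x y. f (x + y) = f x + f y) \<and> (\<forall>c x. f (s c x) = s c (f x)) \<and> c = (0, inner_derivation M \<rho> f))"
proof -
  have "F \<times> {0} = (\<lambda>f. (f, 0)) ` F" for F :: "('a \<Rightarrow> 'a) set" by auto
  then show ?thesis
    by (simp add: def_coboundaries_def image_image image_iff)
qed

lemma coboundaries_Suc:
  "c \<in> def_coboundaries s M \<rho> (Suc (Suc (Suc k))) \<longleftrightarrow>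
    (\<exists>\<tau>\<in>derivations s M \<rho> k. c = (0, \<lambda>x. if x \<in> (\<Union>I. ops M I (Suc k)) then \<tau> (dif M x) else 0))"
proof -
  have "{0} \<times> F = Pair 0 ` F" for F :: "(('u \<Rightarrow>\<^sub>0 'k) \<Rightarrow> (nat \<Rightarrow> 'a) \<Rightarrow> 'a) set" by auto
  then show ?thesis
    by (simp add: def_coboundaries_def image_image image_iff)
qed

text \<open>
  In degree 0 a derivation that kills boundaries does not even distinguish \<open>x\<close> from \<open>w
  x\<close>; in positive degrees the homotopy formula applies.  The second statement rewrites
  \<open>\<theta>\<close> as the difference of \<open>\<theta> \<circ> w\<close> and a coboundary.
\<close>

lemma homotopic_classes:
  assumes w: "operad_morphism M M w" and over: "\<And>I d x. x \<in> ops M I d \<Longrightarrow> \<epsilon> (w x) = \<epsilon> x"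
    and \<theta>: "\<theta> \<in> derivations s M \<rho> k"
    and cocycle: "\<And>I x. x \<in> ops M I (Suc k) \<Longrightarrow> \<theta> (dif M x) = 0"
  shows "(0, \<theta> - pullback M k w \<theta>) \<in> def_coboundaries s M \<rho> (Suc (Suc k))"
    and "(0, pullback M k w \<theta>) \<in> def_coboundaries s M \<rho> (Suc (Suc k)) \<Longrightarrow> (0, \<theta>) \<in> def_coboundaries s M \<rho> (Suc (Suc k))"
proof -
  have "(0, \<theta> - pullback M k w \<theta>) \<in> def_coboundaries s M \<rho> (Suc (Suc k)) \<and>
    ((0, pullback M k w \<theta>) \<in> def_coboundaries s M \<rho> (Suc (Suc k)) \<longrightarrow> (0, \<theta>) \<in> def_coboundaries s M \<rho> (Suc (Suc k)))"
  proof (cases k)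
    case 0
    interpret W: endomorphism_over M w by (rule endomorphism_over[OF w over])
    have "\<theta> x = pullback M k w \<theta> x" for x
    proof (cases "x \<in> (\<Union>I. ops M I k)")
      case True
      then obtain I where x: "x \<in> ops M I 0" using 0 by blast
      obtain z where z: "z \<in> ops M I 1" "w x - x = dif M z"
        using W.w_homotopic[OF x] by (auto simp: boundaries_def)
      have "\<theta> (w x) - \<theta> x = \<theta> (dif M z)"
        using derivation_diff[OF \<theta>[unfolded 0] W.w_ops[OF x] x] z by simp
      then show ?thesis using cocycle[of z I] z 0 True by (simp add: pullback_def)
    next
      case False
      then show ?thesis using derivation_support[OF \<theta> False] by (simp add: pullback_def)
    qed
    then have eq: "pullback M k w \<theta> = \<theta>" by (simp add: fun_eq_iff)
    have "inner_derivation M \<rho> (\<lambda>x. 0) = 0"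
    proof
      fix x
      show "inner_derivation M \<rho> (\<lambda>x. 0) x = 0 x"
      proof (cases "\<exists>I. x \<in> ops M I 0")
        case True
        then obtain I where x: "x \<in> ops M I 0" by blast
        have "\<rho> 0 = (\<lambda>a. 0)" using M.morphism_zero[OF \<epsilon>_morphism] by (simp add: fun_eq_iff)
        from inner_derivation_eq[of M \<rho> "\<lambda>x. 0", OF M.dg_operad_axioms this refl x] show ?thesis
          using End_ops_linear(3)[OF \<rho>_ops[OF x]] by (simp add: fun_eq_iff)
      qed (simp add: inner_derivation_def)
    qed
    then have "(0, 0) \<in> def_coboundaries s M \<rho> (Suc (Suc k))"
      unfolding 0 coboundaries_2 by (intro exI[of _ "\<lambda>x. 0"]) auto
    then show ?thesis by (simp add: eq)
  next
    case (Suc k')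
    let ?\<delta> = "\<lambda>\<tau> x. if x \<in> (\<Union>I. ops M I k) then \<tau> (dif M x) else 0"
    have "\<exists>\<tau>\<in>derivations s M \<rho> k'. \<forall>I. \<forall>x\<in>ops M I (Suc k'). \<theta> (w x) - \<theta> x = \<tau> (dif M x)"
    proof (rule homotopic_derivations[OF w _ \<theta>[unfolded Suc]])
      show "\<epsilon> (w x) = \<epsilon> x" if "x \<in> ops M I d" for I d x by (rule over[OF that])
      show "\<theta> (dif M x) = 0" if "x \<in> ops M I (Suc (Suc k'))" for I x
        using cocycle[of x I] that by (simp add: Suc)
    qed
    then obtain \<tau> where \<tau>: "\<tau> \<in> derivations s M \<rho> k'" "\<And>I x. x \<in> ops M I k \<Longrightarrow> \<theta> (w x) - \<theta> x = \<tau> (dif M x)"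
      using Suc by blast
    have eq: "pullback M k w \<theta> - \<theta> = ?\<delta> \<tau>"
    proof
      fix x
      show "(pullback M k w \<theta> - \<theta>) x = ?\<delta> \<tau> x"
        using derivation_support[OF \<theta>, of x] \<tau>(2)[of x] by (auto simp: pullback_def)
    qed
    have "\<theta> - pullback M k w \<theta> = ?\<delta> (- \<tau>)"
      using arg_cong[OF eq, of uminus] by (auto simp: fun_eq_iff)
    then have "(0, \<theta> - pullback M k w \<theta>) \<in> def_coboundaries s M \<rho> (Suc (Suc k))"
      unfolding Suc coboundaries_Suc using derivations_uminus[OF \<tau>(1)] by blast
    moreover have "(0, \<theta>) \<in> def_coboundaries s M \<rho> (Suc (Suc k))"
      if asm: "(0, pullback M k w \<theta>) \<in> def_coboundaries s M \<rho> (Suc (Suc k))"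
    proof -
      obtain \<sigma> where \<sigma>: "\<sigma> \<in> derivations s M \<rho> k'" "pullback M k w \<theta> = ?\<delta> \<sigma>"
        using asm unfolding Suc coboundaries_Suc by blast
      have "\<theta> = pullback M k w \<theta> - (pullback M k w \<theta> - \<theta>)" by simp
      also have "\<dots> = ?\<delta> (\<sigma> - \<tau>)" unfolding eq unfolding \<sigma>(2) by (auto simp: fun_eq_iff)
      finally show ?thesis
        unfolding Suc coboundaries_Suc using derivations_diff[OF \<sigma>(1) \<tau>(1)] by blast
    qed
    ultimately show ?thesis by blast
  qed
  then show "(0, \<theta> - pullback M k w \<theta>) \<in> def_coboundaries s M \<rho> (Suc (Suc k))"
    and "(0, pullback M k w \<theta>) \<in> def_coboundaries s M \<rho> (Suc (Suc k)) \<Longrightarrow> (0, \<theta>) \<in> def_coboundaries s M \<rho> (Suc (Suc k))"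
    by blast+
qed

end

context jj_resolution_map
begin

lemma pullback_coboundaries:
  assumes "(0, \<theta>) \<in> def_coboundaries s R R.\<rho> (Suc (Suc k))"
  shows "(0, pullback M k g \<theta>) \<in> def_coboundaries s M M.\<rho> (Suc (Suc k))"
proof (cases k)
  case 0
  obtain f where f: "\<And>x y. f (x + y) = f x + f y" "\<And>c x. f (s c x) = s c (f x)" "\<theta> = inner_derivation R R.\<rho> f"
    using assms unfolding 0 R.coboundaries_2 by auto
  have "f 0 = 0" using f(1)[of 0 0] by auto
  then show ?thesis
    unfolding 0 M.coboundaries_2 f(3) using pullback_inner[of f] f(1,2) by auto
next
  case (Suc k')
  obtain \<tau> where t: "\<tau> \<in> derivations s R R.\<rho> k'"
      "\<theta> = (\<lambda>x. if x \<in> (\<Union>I. ops R I (Suc k')) then \<tau> (dif R x) else 0)"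
    using assms unfolding Suc R.coboundaries_Suc by auto
  show ?thesis
    unfolding Suc M.coboundaries_Suc t(2) pullback_coboundary[OF t(1)]
    using pullback_derivation[OF t(1)] by blast
qed

end

lemma resolution_lift:
  fixes s :: "'k::field_char_0 \<Rightarrow> 'a::ab_group_add \<Rightarrow> 'a"
    and R M :: "('k, 'u::infinite \<Rightarrow>\<^sub>0 'k) operad"
  assumes "jj_resolution s mul R \<eta>" "jj_resolution s mul M \<epsilon>"
  obtains g where "jj_resolution_map s mul R \<eta> M \<epsilon> g"
proof -
  interpret R: jj_resolution s mul R \<eta> by fact
  interpret M: jj_resolution s mul M \<epsilon> by fact
  obtain \<iota> :: "'k jjvec \<Rightarrow> 'u \<Rightarrow>\<^sub>0 'k" where \<iota>: "embedded_operad JJss \<iota> UNIV"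
    by (rule JJss_embedded[OF R.dg_operad_JJss])
  have "embedded_operad R (\<lambda>x. x) UNIV"
    using R.M.subspace_UNIV by unfold_locales (auto simp: R.scl_M)
  from cofibrant_lift[OF M.cofib this \<iota> R.\<epsilon>_acyclic_fibration M.\<epsilon>_morphism]
  obtain g where "operad_morphism M R g" "\<And>I d x. x \<in> ops M I d \<Longrightarrow> \<eta> (g x) = \<epsilon> x" by metis
  then have "jj_resolution_map s mul R \<eta> M \<epsilon> g" by unfold_locales
  then show thesis by (rule that)
qed

lemma pullback_pullback:
  assumes "operad_morphism M R g"
  shows "pullback M k g (pullback R k h \<theta>) = pullback M k (h \<circ> g) \<theta>"
  using morphism_ops[OF assms] by (fastforce simp: pullback_def fun_eq_iff)

text \<open>
  Precomposition with \<open>g\<close> is injective and surjective on cohomology since \<open>g \<circ>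
  h\<close> and \<open>h \<circ> g\<close> act as the identity.
\<close>

lemma same_cohomology_from_homotopy_inverses:
  fixes s :: "'k::field_char_0 \<Rightarrow> 'a::ab_group_add \<Rightarrow> 'a"
    and R M :: "('k, 'u::infinite \<Rightarrow>\<^sub>0 'k) operad"
  assumes "jj_resolution_map s mul R \<eta> M \<epsilon> g" "jj_resolution_map s mul M \<epsilon> R \<eta> h"
  shows "same_deformation_cohomology s mul R \<eta> M \<epsilon> (Suc (Suc k))"
proof -
  interpret g: jj_resolution_map s mul R \<eta> M \<epsilon> g by fact
  interpret h: jj_resolution_map s mul M \<epsilon> R \<eta> h by fact
  let ?\<Phi> = "\<lambda>(f :: 'a \<Rightarrow> 'a, \<theta>). (0 :: 'a \<Rightarrow> 'a, pullback M k g \<theta>)"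
  have hg: "\<epsilon> ((h \<circ> g) x) = \<epsilon> x" if "x \<in> ops M I d" for x I d
    using h.over[OF g.g_ops[OF that]] g.over[OF that] by simp
  have gh: "\<eta> ((g \<circ> h) x) = \<eta> x" if "x \<in> ops R I d" for x I d
    using g.over[OF h.g_ops[OF that]] h.over[OF that] by simp
  note Z = g.R.cocycles_iff[of _ k] and Z' = g.M.cocycles_iff[of _ k]
  show ?thesis
    unfolding same_deformation_cohomology_def subquotients_isomorphic_def
  proof (intro exI[of _ ?\<Phi>] conjI ballI allI)
    fix x assume x: "x \<in> def_cocycles s R g.R.\<rho> (Suc (Suc k))"
    obtain \<theta> where \<theta>: "\<theta> \<in> derivations s R g.R.\<rho> k" "x = (0, \<theta>)"
      and cocycle: "\<And>I x. x \<in> ops R I (Suc k) \<Longrightarrow> \<theta> (dif R x) = 0"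
      using x unfolding Z by blast
    show "?\<Phi> x \<in> def_cocycles s M g.M.\<rho> (Suc (Suc k))"
      unfolding Z' using g.pullback_derivation[OF \<theta>(1)] g.pullback_cocycle[OF \<theta>(1) cocycle] \<theta>(2) by auto
    show "?\<Phi> (cochain_scale s c x) = cochain_scale s c (?\<Phi> x)" for c
      by (auto simp: \<theta>(2) cochain_scale_def pullback_def fun_eq_iff)
    show "?\<Phi> x \<in> def_coboundaries s M g.M.\<rho> (Suc (Suc k)) \<longleftrightarrow> x \<in> def_coboundaries s R g.R.\<rho> (Suc (Suc k))"
    proof
      assume "x \<in> def_coboundaries s R g.R.\<rho> (Suc (Suc k))"
      then show "?\<Phi> x \<in> def_coboundaries s M g.M.\<rho> (Suc (Suc k))"
        using g.pullback_coboundaries[of \<theta> k] by (simp add: \<theta>(2))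
    next
      assume "?\<Phi> x \<in> def_coboundaries s M g.M.\<rho> (Suc (Suc k))"
      then have "(0, pullback R k h (pullback M k g \<theta>)) \<in> def_coboundaries s R g.R.\<rho> (Suc (Suc k))"
        using h.pullback_coboundaries[of "pullback M k g \<theta>" k] by (simp add: \<theta>(2))
      then have 1: "(0, pullback R k (g \<circ> h) \<theta>) \<in> def_coboundaries s R g.R.\<rho> (Suc (Suc k))"
        by (simp only: pullback_pullback[OF h.g])
      show "x \<in> def_coboundaries s R g.R.\<rho> (Suc (Suc k))"
        unfolding \<theta>(2)
      proof (rule g.R.homotopic_classes(2)[OF _ _ \<theta>(1) _ 1])
        show "operad_morphism R R (g \<circ> h)" by (rule operad_morphism_comp[OF h.g g.g])
      qed (use gh cocycle in auto)
    qed
  next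
    fix x y assume "x \<in> def_cocycles s R g.R.\<rho> (Suc (Suc k))" "y \<in> def_cocycles s R g.R.\<rho> (Suc (Suc k))"
    then show "?\<Phi> (x + y) = ?\<Phi> x + ?\<Phi> y"
      by (auto simp: Z pullback_def fun_eq_iff)
  next
    fix y assume y: "y \<in> def_cocycles s M g.M.\<rho> (Suc (Suc k))"
    obtain \<theta> where \<theta>: "\<theta> \<in> derivations s M g.M.\<rho> k" "y = (0, \<theta>)"
      and cocycle: "\<And>I x. x \<in> ops M I (Suc k) \<Longrightarrow> \<theta> (dif M x) = 0"
      using y unfolding Z' by blast
    have "(0, pullback R k h \<theta>) \<in> def_cocycles s R g.R.\<rho> (Suc (Suc k))"
      unfolding Z using h.pullback_derivation[OF \<theta>(1)] h.pullback_cocycle[OF \<theta>(1) cocycle] by auto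
    moreover have "(0, \<theta> - pullback M k (h \<circ> g) \<theta>) \<in> def_coboundaries s M g.M.\<rho> (Suc (Suc k))"
    proof (rule g.M.homotopic_classes(1)[OF _ _ \<theta>(1)])
      show "operad_morphism M M (h \<circ> g)" by (rule operad_morphism_comp[OF g.g h.g])
    qed (use hg cocycle in auto)
    ultimately show "\<exists>x\<in>def_cocycles s R g.R.\<rho> (Suc (Suc k)). y - ?\<Phi> x \<in> def_coboundaries s M g.M.\<rho> (Suc (Suc k))"
      by (intro bexI[of _ "(0, pullback R k h \<theta>)"]) (auto simp: \<theta>(2) pullback_pullback[OF g.g])
  qed
qed

text \<open>
  In degree 1 the cohomology consists of the derivations of the algebra, which depend only on the image of the
  resolution in the operad.
\<close>

lemma same_cohomology_degrees_0_1:
  fixes s :: "'k::field_char_0 \<Rightarrow> 'a::ab_group_add \<Rightarrow> 'a"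
    and R M :: "('k, 'u::infinite \<Rightarrow>\<^sub>0 'k) operad"
  assumes "jj_resolution_map s mul R \<eta> M \<epsilon> g" "jj_resolution_map s mul M \<epsilon> R \<eta> h"
  shows "same_deformation_cohomology s mul R \<eta> M \<epsilon> 0"
    and "same_deformation_cohomology s mul R \<eta> M \<epsilon> (Suc 0)"
proof -
  interpret g: jj_resolution_map s mul R \<eta> M \<epsilon> g by fact
  interpret h: jj_resolution_map s mul M \<epsilon> R \<eta> h by fact
  show "same_deformation_cohomology s mul R \<eta> M \<epsilon> 0"
    unfolding same_deformation_cohomology_def subquotients_isomorphic_def
    by (intro exI[of _ "\<lambda>_. 0"])
       (auto simp: def_cocycles_def def_coboundaries_def cochain_scale_def zero_prod_def fun_eq_iff)
  have inner: "inner_derivation R g.R.\<rho> f = 0 \<longleftrightarrow> inner_derivation M g.M.\<rho> f = 0" if "f 0 = 0" for f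
    using g.pullback_inner[of f, OF that] h.pullback_inner[of f, OF that]
    by (auto simp: pullback_def fun_eq_iff split: if_splits)
  have Z: "c \<in> def_cocycles s R g.R.\<rho> (Suc 0) \<longleftrightarrow> (\<exists>f. c = (f, 0) \<and> (\<forall>x y. f (x + y) = f x + f y) \<and>
      (\<forall>c x. f (s c x) = s c (f x)) \<and> inner_derivation R g.R.\<rho> f = 0)" for c
    by (cases c) (auto simp: def_cocycles_def zero_prod_def)
  have Z': "c \<in> def_cocycles s M g.M.\<rho> (Suc 0) \<longleftrightarrow> (\<exists>f. c = (f, 0) \<and> (\<forall>x y. f (x + y) = f x + f y) \<and>
      (\<forall>c x. f (s c x) = s c (f x)) \<and> inner_derivation M g.M.\<rho> f = 0)" for c
    by (cases c) (auto simp: def_cocycles_def zero_prod_def)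
  have B: "def_coboundaries s R g.R.\<rho> (Suc 0) = {0}" "def_coboundaries s M g.M.\<rho> (Suc 0) = {0}"
    by (auto simp: def_coboundaries_def)
  have f0: "f 0 = 0" if "\<forall>x y. f (x + y) = f x + f y" for f :: "'a \<Rightarrow> 'a"
    using that[rule_format, of 0 0] by simp
  let ?\<Phi> = "\<lambda>(f :: 'a \<Rightarrow> 'a, _ :: ('u \<Rightarrow>\<^sub>0 'k) \<Rightarrow> (nat \<Rightarrow> 'a) \<Rightarrow> 'a). (f, 0 :: ('u \<Rightarrow>\<^sub>0 'k) \<Rightarrow> (nat \<Rightarrow> 'a) \<Rightarrow> 'a)"
  show "same_deformation_cohomology s mul R \<eta> M \<epsilon> (Suc 0)"
    unfolding same_deformation_cohomology_def subquotients_isomorphic_def B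
  proof (intro exI[of _ ?\<Phi>] conjI ballI allI)
    fix x assume x: "x \<in> def_cocycles s R g.R.\<rho> (Suc 0)"
    obtain f where f: "x = (f, 0)" "\<forall>x y. f (x + y) = f x + f y"
      "\<forall>c x. f (s c x) = s c (f x)" "inner_derivation R g.R.\<rho> f = 0"
      using x unfolding Z by blast
    show "?\<Phi> x \<in> def_cocycles s M g.M.\<rho> (Suc 0)"
      unfolding Z' using f inner[of f, OF f0[OF f(2)]] by auto
    show "?\<Phi> (cochain_scale s c x) = cochain_scale s c (?\<Phi> x)" for c
      by (simp add: f(1) cochain_scale_def fun_eq_iff)
    show "?\<Phi> x \<in> {0} \<longleftrightarrow> x \<in> {0}"
      by (simp add: f(1) zero_prod_def)
  next
    fix x y assume "x \<in> def_cocycles s R g.R.\<rho> (Suc 0)" "y \<in> def_cocycles s R g.R.\<rho> (Suc 0)"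
    then show "?\<Phi> (x + y) = ?\<Phi> x + ?\<Phi> y"
      by (auto simp: Z)
  next
    fix y assume y: "y \<in> def_cocycles s M g.M.\<rho> (Suc 0)"
    obtain f where f: "y = (f, 0)" "\<forall>x y. f (x + y) = f x + f y"
      "\<forall>c x. f (s c x) = s c (f x)" "inner_derivation M g.M.\<rho> f = 0"
      using y unfolding Z' by blast
    have "(f, 0) \<in> def_cocycles s R g.R.\<rho> (Suc 0)"
      unfolding Z using f inner[of f, OF f0[OF f(2)]] by auto
    then show "\<exists>x\<in>def_cocycles s R g.R.\<rho> (Suc 0). y - ?\<Phi> x \<in> {0}"
      using f(1) by force
  qed
qed

theorem deformation_cohomology_independent:
  fixes s :: "'k::field_char_0 \<Rightarrow> 'a::ab_group_add \<Rightarrow> 'a"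
    and R M :: "('k, 'u::infinite \<Rightarrow>\<^sub>0 'k) operad"
  assumes A: "jacobi_jordan_algebra s mul"
    and R: "cofibrant_resolution JJss R \<eta>" and M: "cofibrant_resolution JJss M \<epsilon>"
  shows "same_deformation_cohomology s mul R \<eta> M \<epsilon> n"
proof -
  have res: "jj_resolution s mul Q \<gamma>" if "cofibrant_resolution JJss Q \<gamma>"
    for Q :: "('k, 'u \<Rightarrow>\<^sub>0 'k) operad" and \<gamma>
  proof (intro jj_resolution.intro jj_resolution_axioms.intro)
    have Q: "cofibrant Q" "quasi_iso Q JJss \<gamma>" using that by (simp_all add: cofibrant_resolution_def)
    then show "cofibrant Q" "quasi_iso Q JJss \<gamma>" by simp_all
    have "small_dg_operad Q" using Q(1) unfolding cofibrant_def by (rule conjunct1)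
    then show "dg_operad Q" "scl Q = pm_scale" by (simp_all add: small_dg_operad_def)
    show "jj_algebra s mul" using A by (simp add: jj_algebra_iff)
  qed
  obtain g where g: "jj_resolution_map s mul R \<eta> M \<epsilon> g"
    by (rule resolution_lift[OF res[OF R] res[OF M]])
  obtain h where h: "jj_resolution_map s mul M \<epsilon> R \<eta> h"
    by (rule resolution_lift[OF res[OF M] res[OF R]])
  consider "n = 0" | "n = Suc 0" | k where "n = Suc (Suc k)" by (metis not0_implies_Suc)
  then show ?thesis
    using same_cohomology_degrees_0_1[OF g h] same_cohomology_from_homotopy_inverses[OF g h] by cases auto
qed

section \<open>A cohomology class off the diagonal\<close>

context jj_algebra
begin

text \<open>
  Let \<open>S\<close> be the sum.  The Jacobi identity for \<open>a, b, ck\<close> and its cyclic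
  permutations gives \<open>S = - \<Sigma> (ab)(ck)\<close>.  The Jacobi identity for \<open>ab, c, k\<close>,
  combined with those for \<open>a, b, k\<close> and for \<open>a, b, c\<close>, gives \<open>\<Sigma>
  (ab)(ck) = S\<close>.
\<close>

lemma sum_permutations_left_mult_zero:
  assumes "(2 :: 'k) \<noteq> 0"
  shows "mul a (mul b (mul c k)) + mul a (mul c (mul b k)) + mul b (mul a (mul c k))
    + mul b (mul c (mul a k)) + mul c (mul a (mul b k)) + mul c (mul b (mul a k)) = 0" (is "?S = 0")
proof -
  have j1: "mul x (mul y (mul z k)) + mul y (mul x (mul z k)) = - mul (mul x y) (mul z k)" for x y z
    using mul_jacobi[of x y "mul z k"] by (simp add: mul_commute eq_neg_iff_add_eq_0)
  have j2: "mul (mul x y) (mul z k) = mul z (mul x (mul y k)) + mul z (mul y (mul x k)) - mul k (mul (mul x y) z)" for x y z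
  proof -
    have "mul z (mul x (mul y k) + mul y (mul x k)) + mul z (mul k (mul x y)) = mul z 0"
      unfolding mul_add_right[symmetric] using mul_jacobi[of x y k] by (simp add: mul_commute)
    then have "mul z (mul k (mul x y)) + (mul z (mul x (mul y k)) + mul z (mul y (mul x k))) = 0"
      by (simp add: mul_add_right add.commute)
    then have "mul z (mul k (mul x y)) = - (mul z (mul x (mul y k)) + mul z (mul y (mul x k)))"
      by (simp only: eq_neg_iff_add_eq_0)
    moreover have "mul (mul x y) (mul z k) = - (mul z (mul k (mul x y)) + mul k (mul (mul x y) z))"
      using mul_jacobi[of "mul x y" z k] by (simp only: eq_neg_iff_add_eq_0 add.assoc)
    ultimately show ?thesis by simp
  qed
  have "mul k (mul (mul a b) c + mul (mul b c) a + mul (mul c a) b) = 0"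
    using mul_jacobi[of a b c] by (simp add: mul_commute add_ac)
  then have j3: "mul k (mul (mul a b) c) + mul k (mul (mul b c) a) + mul k (mul (mul c a) b) = 0"
    by (simp add: mul_add_right)
  have "?S = (mul a (mul b (mul c k)) + mul b (mul a (mul c k))) + (mul b (mul c (mul a k)) + mul c (mul b (mul a k)))
      + (mul c (mul a (mul b k)) + mul a (mul c (mul b k)))"
    by (simp only: add_ac)
  also have "\<dots> = - (mul (mul a b) (mul c k) + mul (mul b c) (mul a k) + mul (mul c a) (mul b k))"
    unfolding j1 by simp
  also have "\<dots> = - ?S + (mul k (mul (mul a b) c) + mul k (mul (mul b c) a) + mul k (mul (mul c a) b))"
    unfolding j2 by (simp add: algebra_simps)
  finally have "?S = - ?S" unfolding j3 add_0_right .
  then have "?S + ?S = 0" by (metis add.right_inverse)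
  then have "s 2 ?S = 0" by (metis one_add_one scale_left_distrib scale_one)
  then show ?thesis using assms by simp
qed

end

type_synonym 'k five = "'k \<times> 'k \<times> 'k \<times> 'k \<times> 'k"

definition scale5 :: "'k::field \<Rightarrow> 'k five \<Rightarrow> 'k five" where
  "scale5 c = (\<lambda>(x, y, u, v, w). (c * x, c * y, c * u, c * v, c * w))"

text \<open>
  The coordinates belong to \<open>x\<close>, \<open>y\<close>, \<open>u = xx\<close>, \<open>v = xy\<close>
  and \<open>w = x(xy)\<close>; the Jacobi identity for \<open>x, x, y\<close> forces \<open>yu = - 2
  w\<close>, and the products \<open>yy\<close> and \<open>yv\<close> are set to 0.
\<close>

definition mul5 :: "'k::field five \<Rightarrow> 'k five \<Rightarrow> 'k five" where
  "mul5 = (\<lambda>(x, y, u, v, w) (x', y', u', v', w').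
     (0, 0, x * x', x * y' + y * x', x * v' + v * x' - 2 * (y * u' + u * y')))"

lemma mul5_tuple:
  "mul5 (x, y, u, v, w) (x', y', u', v', w')
    = (0, 0, x * x', x * y' + y * x', x * v' + v * x' - 2 * (y * u' + u * y'))"
  by (simp add: mul5_def)

interpretation five: jj_algebra scale5 mul5
proof
  show "mul5 (scale5 c p) q = scale5 c (mul5 p q)" for c :: 'a and p q :: "'a five"
    by (cases p; cases q) (simp add: mul5_def scale5_def right_diff_distrib distrib_left mult.left_commute mult.assoc)
  show "mul5 p (mul5 q r) + mul5 q (mul5 r p) + mul5 r (mul5 p q) = 0" for p q r :: "'a five"
    by (cases p; cases q; cases r) (simp add: mul5_def zero_prod_def algebra_simps)
qed (auto simp: scale5_def mul5_def algebra_simps split: prod.splits)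

text \<open>
  For a binary operation this is its coefficient; it vanishes on operations of other arities.
\<close>

definition coefU :: "'k::field jjvec \<Rightarrow> 'k" where
  "coefU q = (fst \<circ> snd \<circ> snd) (jj_action scale5 mul5 q (\<lambda>_. (1, 0, 0, 0, 0)))"

text \<open>
  On operations with three inputs this is the linear form that is symmetric in the inputs other than
  \<open>v\<close>; it takes the value 1 at \<open>i(jv)\<close> and \<open>- 2\<close> at
  \<open>v(ij)\<close>.  It vanishes on operations of other arities.
\<close>

definition coefW :: "nat \<Rightarrow> 'k::field jjvec \<Rightarrow> 'k" where
  "coefW v q = (snd \<circ> snd \<circ> snd \<circ> snd)
     (jj_action scale5 mul5 q (\<lambda>i. if i = v then (0, 1, 0, 0, 0) else (1, 0, 0, 0, 0)))"

lemma coef_add: "coefU (x + y) = coefU x + coefU y" "coefW v (x + y) = coefW v x + coefW v y"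
  by (simp_all add: coefU_def coefW_def five.jj_action_add)

lemma coef_scale: "coefU (jj_scale c x) = c * coefU x" "coefW v (jj_scale c x) = c * coefW v x"
  by (simp_all add: coefU_def coefW_def five.jj_action_scale scale5_def split: prod.splits)

abbreviation comb2 :: "nat \<Rightarrow> nat \<Rightarrow> 'k::field jjvec" where
  "comb2 i j \<equiv> jj_tree (Node (Leaf i) (Leaf j))"

abbreviation comb3 :: "nat \<Rightarrow> nat \<Rightarrow> nat \<Rightarrow> 'k::field jjvec" where
  "comb3 i j l \<equiv> jj_tree (Node (Leaf i) (Node (Leaf j) (Leaf l)))"

abbreviation comb4 :: "nat \<Rightarrow> nat \<Rightarrow> nat \<Rightarrow> nat \<Rightarrow> 'k::field jjvec" where
  "comb4 i j l m \<equiv> jj_tree (Node (Leaf i) (Node (Leaf j) (Node (Leaf l) (Leaf m))))"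

lemma jj_tree_action: "jj_action scale5 mul5 (jj_tree t) a = eval_tree mul5 a t"
  by (simp add: five.jj_action_abs)

lemma jj_tree_multilinear:
  assumes "finite I" "leaves t = mset_set I"
  shows "jj_tree t \<in> jj_multilinear I"
proof -
  have "t' \<in> Poly_Mapping.keys (Poly_Mapping.single t (1::'a)) \<Longrightarrow> t' = t" for t'
    by (simp add: keys_single)
  then show ?thesis
    unfolding jj_multilinear_def using assms by (intro imageI) auto
qed

lemma jj_tree_commute: "jj_tree (Node t u) = jj_tree (Node u t)"
  by (simp add: jjvec.abs_eq_iff jj_ideal.comm)

lemma leaves_two:
  assumes "leaves t = {#i, j#}"
  shows "t = Node (Leaf i) (Leaf j) \<or> t = Node (Leaf j) (Leaf i)"
proof (cases t)
  case (Leaf l)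
  then show ?thesis using assms by simp
next
  case (Node a b)
  have size: "size (leaves t) \<ge> 1" for t by (induction t) auto
  have leaf: "size (leaves t) = 1 \<Longrightarrow> \<exists>l. t = Leaf l" for t
  proof (cases t)
    case (Node t1 t2)
    assume "size (leaves t) = 1"
    then show ?thesis using Node size[of t1] size[of t2] by simp
  qed simp
  have "size (leaves a) + size (leaves b) = 2"
    using assms Node by (metis leaves.simps(2) numeral_2_eq_2 size_add_mset size_empty size_union)
  then have "size (leaves a) = 1" "size (leaves b) = 1" using size[of a] size[of b] by auto
  then obtain l m where "a = Leaf l" "b = Leaf m" using leaf by blast
  then show ?thesis using assms Node by (auto simp: add_eq_conv_ex)
qed

lemma binary_operation:
  fixes x :: "'k::field jjvec"
  assumes "x \<in> jj_multilinear {i, j}" "i \<noteq> j"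
  shows "x = jj_scale (coefU x) (comb2 i j)"
proof -
  interpret J: vector_space "jj_scale :: 'k \<Rightarrow> _" by (rule vector_space_jj_scale)
  let ?m = "comb2 i j :: 'k jjvec"
  obtain y :: "btree \<Rightarrow>\<^sub>0 'k" where x: "x = abs_jjvec y"
    and y: "\<And>t. t \<in> Poly_Mapping.keys y \<Longrightarrow> leaves t = mset_set {i, j}"
    using assms(1) by (auto simp: jj_multilinear_def)
  have "jj_tree t = ?m" if "t \<in> Poly_Mapping.keys y" for t
  proof -
    have "t = Node (Leaf i) (Leaf j) \<or> t = Node (Leaf j) (Leaf i)"
      using y[OF that] assms(2) by (intro leaves_two) simp
    then show ?thesis using jj_tree_commute by blast
  qed
  then have "x = (\<Sum>t\<in>Poly_Mapping.keys y. jj_scale (Poly_Mapping.lookup y t) ?m)"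
    unfolding x abs_jjvec_expand[of y] by (intro sum.cong) auto
  then have "x = jj_scale (sum (Poly_Mapping.lookup y) (Poly_Mapping.keys y)) ?m"
    by (simp only: J.scale_sum_left)
  then obtain c where "x = jj_scale c ?m" by blast
  moreover have "coefU ?m = 1"
    by (simp add: coefU_def jj_tree_action mul5_tuple)
  ultimately show ?thesis by (simp add: coef_scale)
qed

text \<open>
  With one input set to \<open>y\<close> and the others to \<open>x\<close>, the composite of two products is
  \<open>y(xx) = - 2 w\<close> or \<open>x(xy) = w\<close>, according to whether \<open>y\<close> is placed at
  the lower or the upper vertex.
\<close>

lemma binary_composite:
  fixes x y :: "'k::field jjvec"
  assumes x: "x \<in> jj_multilinear N" "card N = 2" "k \<in> N" and y: "y \<in> jj_multilinear N'" "card N' = 2"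
    and disj: "N' \<inter> (N - {k}) = {}"
  shows "coefU (jj_comp k x y) = 0"
    and "v \<in> N' \<Longrightarrow> coefW v (jj_comp k x y) = coefU x * coefU y"
    and "v \<in> N - {k} \<Longrightarrow> coefW v (jj_comp k x y) = - 2 * (coefU x * coefU y)"
proof -
  obtain i' j' where "N = {i', j'}" "i' \<noteq> j'" using x(2) by (auto simp: card_2_iff)
  then obtain l where N: "N = {k, l}" "k \<noteq> l" using x(3) by auto
  obtain i j where N': "N' = {i, j}" "i \<noteq> j" using y(2) by (auto simp: card_2_iff)
  have X: "x = jj_scale (coefU x) (comb2 k l)"
    using binary_operation x(1) N by blast
  have Y: "y = jj_scale (coefU y) (comb2 i j)"
    using binary_operation y(1) N' by blast
  have act: "jj_action scale5 mul5 (jj_comp k x y) a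
      = scale5 (coefU x * coefU y) (mul5 (mul5 (a i) (a j)) (a l))" for a
    unfolding five.jj_action_comp
    by (subst X, subst Y)
       (simp add: five.jj_action_scale jj_tree_action N(2)[symmetric] five.mul_scale_left)
  show "coefU (jj_comp k x y) = 0"
    by (simp add: coefU_def act scale5_def mul5_tuple)
  show "v \<in> N' \<Longrightarrow> coefW v (jj_comp k x y) = coefU x * coefU y"
    "v \<in> N - {k} \<Longrightarrow> coefW v (jj_comp k x y) = - 2 * (coefU x * coefU y)"
    using N N' disj by (auto simp: coefW_def act scale5_def mul5_tuple)
qed

lemma binary_coefW:
  assumes "x \<in> jj_multilinear N" "card N = 2"
  shows "coefW v x = 0"
proof -
  obtain i j where N: "N = {i, j}" "i \<noteq> j" using assms(2) by (auto simp: card_2_iff)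
  have X: "x = jj_scale (coefU x) (comb2 i j)"
    using binary_operation assms(1) N by blast
  show ?thesis
    by (subst X) (simp add: coef_scale, simp add: coefW_def jj_tree_action mul5_tuple)
qed

lemma JJss_simps [simp]:
  "ops JJss I 0 = jj_multilinear I" "scl JJss = jj_scale" "pcomp JJss = jj_comp"
  by (simp_all add: JJss_def)

lemma trees_finite: "T \<in> trees I \<Longrightarrow> finite I \<Longrightarrow> finite T"
  by (rule finite_subset[of _ "Pow I"]) (auto simp: trees_def)

lemma parent_eq: "W \<in> T \<Longrightarrow> V \<subset> W \<Longrightarrow> (\<And>U. U \<in> T \<Longrightarrow> V \<subset> U \<Longrightarrow> W \<subseteq> U) \<Longrightarrow> parent T V = W"
  unfolding parent_def by blast

lemma Min_of_smaller:
  assumes "finite D" "U \<subseteq> D" "Min D \<in> U"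
  shows "Min U = Min (D :: nat set)"
  using assms by (intro Min_eqI) (auto intro: finite_subset)

lemma inputs_leaf: "(\<And>U. U \<in> T \<Longrightarrow> \<not> U \<subset> V) \<Longrightarrow> inputs T V = V"
  unfolding inputs_def by blast

text \<open>
  An input of a vertex is labelled by the minimum of the leaves above it, so a single maximal subtree
  \<open>D\<close> contributes \<open>Min D\<close>.
\<close>

lemma inputs_one:
  assumes "D \<in> T" "D \<subset> V" "finite D" "D \<noteq> {}" "\<And>U. U \<in> T \<Longrightarrow> U \<subset> V \<Longrightarrow> U \<subseteq> D"
  shows "inputs T V = insert (Min D) (V - D)"
proof
  show "inputs T V \<subseteq> insert (Min D) (V - D)"
    using assms(1,2) unfolding inputs_def by blast
  have D: "Min D \<in> V" using assms(2-4) Min_in by blast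
  show "insert (Min D) (V - D) \<subseteq> inputs T V"
  proof
    fix v assume v: "v \<in> insert (Min D) (V - D)"
    have "v = Min U" if U: "U \<in> T" "U \<subset> V" "v \<in> U" for U
    proof -
      have "U \<subseteq> D" using assms(5) U by blast
      then have "v = Min D" using v U(3) by blast
      then show ?thesis using Min_of_smaller[OF assms(3) \<open>U \<subseteq> D\<close>] U(3) by simp
    qed
    then show "v \<in> inputs T V" using v D unfolding inputs_def by blast
  qed
qed

lemma inputs_two:
  assumes "D \<in> T" "D \<subset> V" "finite D" "D \<noteq> {}" "E \<in> T" "E \<subset> V" "finite E" "E \<noteq> {}" "D \<inter> E = {}"
    "\<And>U. U \<in> T \<Longrightarrow> U \<subset> V \<Longrightarrow> U \<subseteq> D \<or> U \<subseteq> E"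
  shows "inputs T V = insert (Min D) (insert (Min E) (V - D - E))"
proof
  show "inputs T V \<subseteq> insert (Min D) (insert (Min E) (V - D - E))"
    using assms(1,2,5,6) unfolding inputs_def by blast
  have D: "Min D \<in> D" "Min E \<in> E" using Min_in[OF assms(3,4)] Min_in[OF assms(7,8)] by auto
  show "insert (Min D) (insert (Min E) (V - D - E)) \<subseteq> inputs T V"
  proof
    fix v assume v: "v \<in> insert (Min D) (insert (Min E) (V - D - E))"
    have "v = Min U" if U: "U \<in> T" "U \<subset> V" "v \<in> U" for U
    proof -
      from assms(10)[OF U(1,2)] show ?thesis
      proof
        assume "U \<subseteq> D"
        then have "v = Min D" using v U(3) D assms(9) by blast
        then show ?thesis using Min_of_smaller[OF assms(3) \<open>U \<subseteq> D\<close>] U(3) by simp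
      next
        assume "U \<subseteq> E"
        then have "v = Min E" using v U(3) D assms(9) by blast
        then show ?thesis using Min_of_smaller[OF assms(7) \<open>U \<subseteq> E\<close>] U(3) by simp
      qed
    qed
    then show "v \<in> inputs T V" using v D assms(2,6) unfolding inputs_def by blast
  qed
qed

lemma set_encode_psubset: "U \<subset> V \<Longrightarrow> finite V \<Longrightarrow> set_encode U < set_encode V"
proof -
  assume *: "U \<subset> V" "finite V"
  then obtain x where "x \<in> V" "x \<notin> U" by blast
  then show ?thesis
    unfolding set_encode_def using * by (intro sum_strict_mono2[of V U x]) auto
qed

lemma set_encode_neq: "finite U \<Longrightarrow> finite V \<Longrightarrow> U \<noteq> V \<Longrightarrow> set_encode U \<noteq> set_encode V"
  by (simp add: set_encode_eq)

text \<open>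
  The sign with which the contraction of the edge below \<open>V\<close> enters the differential, when
  \<open>S\<close> is the set of vertices other than the root.
\<close>

definition edge_sign :: "nat set set \<Rightarrow> nat set \<Rightarrow> 'k::field" where
  "edge_sign S V = (\<Prod>U\<in>S. if set_encode U < set_encode V then - 1 else 1)"

lemma edge_sign_eq: "finite S \<Longrightarrow> (- 1) ^ card {U \<in> S. set_encode U < set_encode V} = edge_sign S V"
proof -
  assume S: "finite S"
  have "{U \<in> S. set_encode U < set_encode V} = S \<inter> {U. set_encode U < set_encode V}" by auto
  then show ?thesis using S by (simp add: edge_sign_def prod.If_cases)
qed

lemma dual_dif_eq:
  "finite T \<Longrightarrow> dual_dif P I \<phi> (T, p) = (\<Sum>V\<in>T - {I}. edge_sign (T - {I}) V * \<phi> (contract P V (T, p)))"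
  unfolding dual_dif_def by (simp only: prod.case edge_sign_eq[OF finite_Diff])

text \<open>
  The coefficients solve the linear equations for closedness on the three shapes of binary trees with five
  leaves; up to a common factor they are determined by symmetry and closedness.  If the two vertices other
  than the root are nested, the weight is 3; if they both sit on the root, it is \<open>\<plusminus>
  2\<close>, and the edge sign makes the cochain independent of the labels.
\<close>

definition weight :: "nat set \<Rightarrow> nat set set \<Rightarrow> nat set \<Rightarrow> 'k::field" where
  "weight I T V = (if \<exists>U\<in>T. U \<subset> V \<or> V \<subset> U \<and> U \<noteq> I then 3 else - 2 * edge_sign (T - {I}) V)"

text \<open>
  The sum over the edges of a tree with three vertices.  The summand of the edge below \<open>V\<close> is
  nonzero only if the parent of \<open>V\<close> is the ternary vertex, as the forms vanish on operations of
  the wrong arity.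
\<close>

definition jj_cocycle :: "nat set \<Rightarrow> nat set set \<times> (nat set \<Rightarrow> 'k::field jjvec) \<Rightarrow> 'k" where
  "jj_cocycle I = (\<lambda>(T, p). \<Sum>V\<in>T - {I}. weight I T V *
     (\<Prod>U\<in>T. if U = parent T V then coefW (Min V) (p U) else coefU (p U)))"

lemma jj_cocycle_nested:
  assumes "Y \<subset> X" "X \<subset> I"
  shows "jj_cocycle I ({I, X, Y}, p) = 3 * (coefW (Min X) (p I) * coefU (p X) * coefU (p Y))
    + 3 * (coefU (p I) * coefW (Min Y) (p X) * coefU (p Y))"
proof -
  have d: "X \<noteq> I" "Y \<noteq> I" "Y \<noteq> X" "I \<noteq> X" "I \<noteq> Y" "X \<noteq> Y" and T: "{I, X, Y} - {I} = {X, Y}" using assms by auto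
  have par: "parent {I, X, Y} X = I" "parent {I, X, Y} Y = X"
    by (rule parent_eq; use assms in blast)+
  have "weight I {I, X, Y} X = (3 :: 'a)" "weight I {I, X, Y} Y = (3 :: 'a)"
    using assms d by (auto simp: weight_def)
  then show ?thesis
    unfolding jj_cocycle_def by (simp add: T par d mult.assoc)
qed

lemma jj_cocycle_disjoint:
  assumes "X \<subset> I" "Y \<subset> I" "X \<noteq> Y" "\<not> X \<subset> Y" "\<not> Y \<subset> X" "finite I"
  shows "jj_cocycle I ({I, X, Y}, p) = - 2 * (if set_encode Y < set_encode X then - 1 else 1)
    * (coefW (Min X) (p I) - coefW (Min Y) (p I)) * coefU (p X) * coefU (p Y)"
proof -
  have d: "X \<noteq> I" "Y \<noteq> I" "I \<noteq> X" "I \<noteq> Y" "Y \<noteq> X" and T: "{I, X, Y} - {I} = {X, Y}" using assms by auto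
  have par: "parent {I, X, Y} X = I" "parent {I, X, Y} Y = I"
    by (rule parent_eq; use assms in blast)+
  have e: "set_encode X \<noteq> set_encode Y"
    using assms by (intro set_encode_neq) (auto intro: finite_subset)
  have "weight I {I, X, Y} X = - 2 * (if set_encode Y < set_encode X then - 1 else 1 :: 'a)"
    "weight I {I, X, Y} Y = - 2 * (if set_encode X < set_encode Y then - 1 else 1 :: 'a)"
    using assms d by (auto simp: weight_def T edge_sign_def)
  then show ?thesis
    unfolding jj_cocycle_def using e assms(3) by (auto simp: T par d algebra_simps)
qed

lemma prod_fun_upd:
  assumes "finite T" "V \<in> T"
  shows "(\<Prod>U\<in>T. F U ((p(V := x)) U)) = F V x * (\<Prod>U\<in>T - {V}. F U (p U))"
  using assms by (subst prod.remove[of T V]) (auto intro!: prod.cong)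

lemma jj_cocycle_dual_cochain:
  assumes "finite I"
  shows "(jj_cocycle I :: _ \<Rightarrow> 'k::field) \<in> dual_cochains JJss I s"
  unfolding dual_cochains_def mem_Collect_eq
proof (intro ballI impI)
  fix T and p :: "nat set \<Rightarrow> 'k jjvec" and V x
  assume T: "T \<in> trees I" and V: "V \<in> T"
  have fin: "finite T" by (rule trees_finite[OF T assms])
  define F where "F V' U z = (if U = parent T V' then coefW (Min V') z else coefU z)" for V' U and z :: "'k jjvec"
  have F: "F V' U (z + z') = F V' U z + F V' U z'" "F V' U (jj_scale c z) = c * F V' U z" for V' U z z' c
    by (simp_all add: F_def coef_add coef_scale)
  have val: "jj_cocycle I (T, p(V := z))
      = (\<Sum>V'\<in>T - {I}. weight I T V' * (F V' V z * (\<Prod>U\<in>T - {V}. F V' U (p U))))" for z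
    unfolding jj_cocycle_def prod.case F_def[symmetric] prod_fun_upd[OF fin V] ..
  show "(\<forall>y\<in>ops JJss (inputs T V) 0. jj_cocycle I (T, p(V := x + y)) = jj_cocycle I (T, p(V := x)) + jj_cocycle I (T, p(V := y)))
      \<and> (\<forall>c. jj_cocycle I (T, p(V := scl JJss c x)) = c * jj_cocycle I (T, p(V := x)))"
    unfolding val JJss_simps F
    by (simp add: distrib_left distrib_right sum.distrib sum_distrib_left mult_ac)
qed

text \<open>
  The reduced trees with five leaves and four vertices are binary.  Taking a vertex \<open>A\<close> other
  than the root with the most leaves above it, each of the other two is contained in \<open>A\<close> or
  disjoint from it, and the number of leaves fixes all sizes.
\<close>

lemma three_vertex_shapes:
  assumes I: "finite I" "card I = 5" and T: "T \<in> trees I" "card T = 4"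
  obtains
    (comb) A B C where "T = {I, A, B, C}" "C \<subset> B" "B \<subset> A" "A \<subset> I" "card C = 2" "card B = 3" "card A = 4"
  | (fork) B C D where "T = {I, B, C, D}" "C \<subset> B" "B \<subset> I" "D \<subset> I" "B \<inter> D = {}" "card C = 2" "card B = 3" "card D = 2"
  | (cherries) A C D where "T = {I, A, C, D}" "C \<subset> A" "D \<subset> A" "A \<subset> I" "C \<inter> D = {}" "card C = 2" "card D = 2" "card A = 4"
proof -
  have IT: "I \<in> T" and sub: "\<And>V. V \<in> T \<Longrightarrow> V \<subseteq> I" and two: "\<And>V. V \<in> T \<Longrightarrow> card V \<ge> 2"
    and lam: "\<And>U V. U \<in> T \<Longrightarrow> V \<in> T \<Longrightarrow> U \<inter> V = {} \<or> U \<subseteq> V \<or> V \<subseteq> U"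
    using T(1) by (auto simp: trees_def)
  have fin: "finite V" if "V \<in> T" for V using sub[OF that] I(1) finite_subset by blast
  have "card (T - {I}) = 3" using IT T(2) by simp
  then obtain X Y Z where XYZ: "T - {I} = {X, Y, Z}" "X \<noteq> Y" "X \<noteq> Z" "Y \<noteq> Z"
    by (auto simp: card_3_iff)
  have ne: "Y \<noteq> X" "Z \<noteq> X" "Z \<noteq> Y" using XYZ(2-4) by simp_all
  have "\<exists>A P Q. T - {I} = {A, P, Q} \<and> A \<noteq> P \<and> A \<noteq> Q \<and> P \<noteq> Q \<and> card P \<le> card A \<and> card Q \<le> card A"
  proof -
    consider "card Y \<le> card X" "card Z \<le> card X" | "card X \<le> card Y" "card Z \<le> card Y" | "card X \<le> card Z" "card Y \<le> card Z"
      by linarith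
    then show ?thesis
    proof cases
      case 1
      show ?thesis by (intro exI[of _ X] exI[of _ Y] exI[of _ Z] conjI; fact)
    next
      case 2
      have "T - {I} = {Y, X, Z}" unfolding XYZ(1) by (rule insert_commute)
      show ?thesis by (intro exI[of _ Y] exI[of _ X] exI[of _ Z] conjI; fact)
    next
      case 3
      have "T - {I} = {Z, X, Y}" unfolding XYZ(1) by blast
      show ?thesis by (intro exI[of _ Z] exI[of _ X] exI[of _ Y] conjI; fact)
    qed
  qed
  then obtain A P Q where e: "T - {I} = {A, P, Q}" and d: "A \<noteq> P" "A \<noteq> Q" "P \<noteq> Q"
    and le: "card P \<le> card A" "card Q \<le> card A" by (elim exE conjE) (rule that; assumption)
  have "{A, P, Q} \<subseteq> T - {I}" unfolding e ..
  then have inT: "A \<in> T" "P \<in> T" "Q \<in> T" and neI: "A \<noteq> I" "P \<noteq> I" "Q \<noteq> I" by simp_all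
  have "T = insert I (T - {I})" using IT by (rule insert_Diff[symmetric])
  then have Teq: "T = {I, A, P, Q}" unfolding e .
  have psub: "V \<subset> I" if "V \<in> T" "V \<noteq> I" for V using sub[OF that(1)] that(2) by blast
  have less5: "card V < 5" if "V \<in> T" "V \<noteq> I" for V
    using psubset_card_mono[OF I(1) psub[OF that]] I(2) by simp
  have less: "card U < card V" if "U \<subset> V" "V \<in> T" for U V
    using psubset_card_mono[OF fin[OF that(2)] that(1)] .
  have disj: "card U + card V \<le> 5" if "U \<in> T" "V \<in> T" "U \<inter> V = {}" for U V
    using card_mono[OF I(1), of "U \<union> V"] card_Un_disjoint[OF fin[OF that(1)] fin[OF that(2)] that(3)] sub[OF that(1)] sub[OF that(2)] I(2)
    by simp
  have c1: thesis if "T = {I, A', B, C}" "C \<subset> B" "B \<subset> A'" "A' \<in> T" "B \<in> T" "C \<in> T" "A' \<noteq> I" for A' B C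
  proof (rule comb[OF that(1-3)])
    show "A' \<subset> I" by (rule psub[OF that(4,7)])
    show "card C = 2" "card B = 3" "card A' = 4"
      using less[OF that(2,5)] less[OF that(3,4)] less5[OF that(4,7)] two[OF that(6)] by linarith+
  qed
  have c2: thesis if "T = {I, B, C, D}" "C \<subset> B" "B \<inter> D = {}" "B \<in> T" "C \<in> T" "D \<in> T" "B \<noteq> I" "D \<noteq> I" for B C D
  proof (rule fork[OF that(1,2)])
    show "B \<subset> I" "D \<subset> I" by (rule psub[OF that(4,7)]) (rule psub[OF that(6,8)])
    show "B \<inter> D = {}" by fact
    show "card C = 2" "card B = 3" "card D = 2"
      using less[OF that(2,4)] two[OF that(5)] two[OF that(6)] disj[OF that(4,6,3)] by linarith+
  qed
  have c3: thesis if "T = {I, A', C, D}" "C \<subset> A'" "D \<subset> A'" "C \<inter> D = {}" "A' \<in> T" "C \<in> T" "D \<in> T" "A' \<noteq> I" for A' C D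
  proof (rule cherries[OF that(1-3) _ that(4)])
    show "A' \<subset> I" by (rule psub[OF that(5,8)])
    have "card (C \<union> D) \<le> card A'" using that(2,3) by (intro card_mono[OF fin[OF that(5)]]) auto
    then have "card C + card D \<le> card A'" using card_Un_disjoint[OF fin[OF that(6)] fin[OF that(7)] that(4)] by simp
    then show "card C = 2" "card D = 2" "card A' = 4"
      using less5[OF that(5,8)] two[OF that(6)] two[OF that(7)] by linarith+
  qed
  have rel: "U \<subset> A \<or> A \<inter> U = {}" if "U \<in> T" "U \<noteq> A" "card U \<le> card A" for U
  proof -
    have "\<not> A \<subset> U" using less[of A U] that by auto
    then show ?thesis using lam[OF inT(1) that(1)] that(2) by blast
  qed
  have PA: "P \<subset> A \<or> A \<inter> P = {}" and QA: "Q \<subset> A \<or> A \<inter> Q = {}"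
    using rel[OF inT(2) d(1)[symmetric] le(1)] rel[OF inT(3) d(2)[symmetric] le(2)] .
  have PQ: "P \<subset> Q \<or> Q \<subset> P \<or> P \<inter> Q = {}" using lam[OF inT(2,3)] d(3) by blast
  have perm: "T = {I, A, Q, P}" "T = {I, Q, P, A}" "T = {I, P, Q, A}" using Teq by auto
  show thesis
  proof (cases "P \<subset> A"; cases "Q \<subset> A")
    assume s: "P \<subset> A" "Q \<subset> A"
    then show thesis using PQ c1[OF perm(1) _ s(2) inT(1,3,2) neI(1)] c1[OF Teq _ s(1) inT(1,2,3) neI(1)]
        c3[OF Teq s _ inT(1,2,3) neI(1)] by blast
  next
    assume s: "P \<subset> A" "\<not> Q \<subset> A"
    then show thesis using QA c2[OF Teq s(1) _ inT(1,2,3) neI(1,3)] by blast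
  next
    assume s: "\<not> P \<subset> A" "Q \<subset> A"
    then show thesis using PA c2[OF perm(1) s(2) _ inT(1,3,2) neI(1,2)] by blast
  next
    assume s: "\<not> P \<subset> A" "\<not> Q \<subset> A"
    then have dis: "A \<inter> P = {}" "A \<inter> Q = {}" using PA QA by auto
    have "P \<inter> Q \<noteq> {}"
    proof
      assume "P \<inter> Q = {}"
      then have "card (A \<union> P \<union> Q) = card A + card P + card Q"
        using dis fin[OF inT(1)] fin[OF inT(2)] fin[OF inT(3)] by (subst card_Un_disjoint) (auto simp: card_Un_disjoint)
      moreover have "card (A \<union> P \<union> Q) \<le> 5"
        using card_mono[OF I(1), of "A \<union> P \<union> Q"] sub inT I(2) by auto
      ultimately show False using two[OF inT(1)] two[OF inT(2)] two[OF inT(3)] by linarith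
    qed
    then show thesis
      using PQ c2[OF perm(2) _ _ inT(3,2,1) neI(3,1)] c2[OF perm(3) _ _ inT(2,3,1) neI(2,1)] dis by blast
  qed
qed

lemma contract_eq:
  "parent T V = W \<Longrightarrow> W \<in> T - {V} \<Longrightarrow> contract JJss V (T, p) =
    (T - {V}, restrict (p(W := jj_comp (Min V) (p W) (p V))) (T - {V}))"
  by (simp add: contract_def)

lemma card_inputs_one:
  fixes D V :: "nat set"
  assumes "D \<subset> V" "finite V" "D \<noteq> {}" "card V = Suc (card D)"
  shows "card (insert (Min D) (V - D)) = 2"
proof -
  have fin: "finite D" using assms(1,2) finite_subset by blast
  have "card (V - D) = 1" using assms by (simp add: card_Diff_subset fin psubset_imp_subset)
  then show ?thesis using Min_in[OF fin assms(3)] assms(2) by simp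
qed

text \<open>
  Contracting the edge below \<open>C\<close> leaves a ternary vertex without subtrees, so it contributes 0;
  the edges below \<open>A\<close> and \<open>B\<close> have opposite signs and both contribute 3.
\<close>

lemma jj_cocycle_closed_comb:
  fixes p :: "nat set \<Rightarrow> 'k::field jjvec"
  assumes I: "finite I" "card I = 5" and T: "T = {I, A, B, C}" "C \<subset> B" "B \<subset> A" "A \<subset> I"
    and cards: "card C = 2" "card B = 3" "card A = 4" and p: "\<And>V. V \<in> T \<Longrightarrow> p V \<in> jj_multilinear (inputs T V)"
  shows "dual_dif JJss I (jj_cocycle I) (T, p) = 0"
proof -
  have fin: "finite A" "finite B" "finite C" using T(2-4) I(1) by (meson finite_subset psubset_imp_subset)+
  have ne: "A \<noteq> {}" "B \<noteq> {}" "C \<noteq> {}" using cards by auto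
  have d: "A \<noteq> I" "B \<noteq> I" "C \<noteq> I" "A \<noteq> B" "A \<noteq> C" "B \<noteq> C" "I \<noteq> A" "I \<noteq> B" "I \<noteq> C" "B \<noteq> A" "C \<noteq> A" "C \<noteq> B"
    using T by auto
  have diff: "T - {I} = {A, B, C}" "T - {A} = {I, B, C}" "T - {B} = {I, A, C}" "T - {C} = {I, A, B}"
    unfolding T(1) using d by auto
  have par: "parent T A = I" "parent T B = A" "parent T C = B"
    unfolding T(1) by (rule parent_eq; use T(2-4) in blast)+
  have "inputs T I = insert (Min A) (I - A)" "inputs T A = insert (Min B) (A - B)" "inputs T B = insert (Min C) (B - C)"
    unfolding T(1) by (rule inputs_one; use T(2-4) fin ne in blast)+
  note inp = this
  have card2: "card (inputs T I) = 2" "card (inputs T A) = 2" "card (inputs T B) = 2"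
    unfolding inp by (rule card_inputs_one; use T(2-4) fin ne I cards in simp)+
  have pV: "p I \<in> jj_multilinear (inputs T I)" "p A \<in> jj_multilinear (inputs T A)" "p B \<in> jj_multilinear (inputs T B)"
    by (rule p; simp add: T(1))+
  have Min: "Min A \<in> A" "Min B \<in> B" "Min C \<in> C" using fin ne by simp_all
  have merge_A: "coefW (Min C) (jj_comp (Min B) (p A) (p B)) = coefU (p A) * coefU (p B)"
  proof -
    have "Min B \<in> inputs T A" "inputs T B \<inter> (inputs T A - {Min B}) = {}" "Min C \<in> inputs T B"
      unfolding inp using T(2-4) Min by auto
    then show ?thesis by (intro binary_composite(2)[OF pV(2) card2(2) _ pV(3) card2(3)])
  qed
  have merge_I: "coefW (Min B) (jj_comp (Min A) (p I) (p A)) = coefU (p I) * coefU (p A)"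
    "coefU (jj_comp (Min A) (p I) (p A)) = 0"
  proof -
    have *: "Min A \<in> inputs T I" "inputs T A \<inter> (inputs T I - {Min A}) = {}" "Min B \<in> inputs T A"
      unfolding inp using T(2-4) Min by auto
    note comp = binary_composite[OF pV(1) card2(1) *(1) pV(2) card2(2) *(2)]
    show "coefW (Min B) (jj_comp (Min A) (p I) (p A)) = coefU (p I) * coefU (p A)"
      "coefU (jj_comp (Min A) (p I) (p A)) = 0"
      by (rule comp(2)[OF *(3)]) (rule comp(1))
  qed
  have merge_B: "coefU (jj_comp (Min C) (p B) (p C)) = 0"
  proof -
    have C: "inputs T C = C" unfolding T(1) by (rule inputs_leaf) (use T(2-4) in blast)
    have "Min C \<in> inputs T B" "C \<inter> (inputs T B - {Min C}) = {}" unfolding inp using Min by auto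
    moreover have "p C \<in> jj_multilinear C" using p[of C] by (simp add: C) (simp add: T(1))
    ultimately show ?thesis
      by (intro binary_composite(1)[OF pV(3) card2(3) _ _ cards(1)])
  qed
  have W0: "coefW v (p I) = 0" for v by (rule binary_coefW[OF pV(1) card2(1)])
  have conC: "jj_cocycle I (contract JJss C (T, p)) = 0"
    using T(2-4) by (simp add: contract_eq[OF par(3)] diff d jj_cocycle_nested merge_B W0)
  have conB: "jj_cocycle I (contract JJss B (T, p)) = 3 * (coefU (p I) * coefU (p A) * coefU (p B) * coefU (p C))"
  proof -
    have "C \<subset> A" using T by blast
    then show ?thesis
      using T(4) by (simp add: contract_eq[OF par(2)] diff d jj_cocycle_nested merge_A W0 mult.assoc)
  qed
  have conA: "jj_cocycle I (contract JJss A (T, p)) = 3 * (coefU (p I) * coefU (p A) * coefU (p B) * coefU (p C))"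
  proof -
    have "B \<subset> I" using T by blast
    then show ?thesis
      using T(2) by (simp add: contract_eq[OF par(1)] diff d jj_cocycle_nested merge_I mult.assoc)
  qed
  have enc: "set_encode C < set_encode B" "set_encode B < set_encode A" "set_encode C < set_encode A"
    using set_encode_psubset[OF T(2) fin(2)] set_encode_psubset[OF T(3) fin(1)] by auto
  have sign: "edge_sign {A, B, C} A = (1 :: 'k)" "edge_sign {A, B, C} B = (- 1 :: 'k)" "edge_sign {A, B, C} C = (1 :: 'k)"
    using enc d by (simp_all add: edge_sign_def)
  show ?thesis
    unfolding dual_dif_eq[of T, OF finite.intros(2)[of "{A, B, C}" I, folded T(1), simplified]]
    by (simp add: diff d sign conA conB conC)
qed

text \<open>
  Contracting the edge below \<open>B\<close> puts \<open>C\<close> and \<open>D\<close> on the root and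
  contributes \<open>\<plusminus> 2 \<cdot> (1 + 2)\<close>; contracting the edge below \<open>D\<close>
  contributes \<open>\<plusminus> 3 \<cdot> 2\<close>.
\<close>

lemma jj_cocycle_closed_fork:
  fixes p :: "nat set \<Rightarrow> 'k::field jjvec"
  assumes I: "finite I" "card I = 5" and T: "T = {I, B, C, D}" "C \<subset> B" "B \<subset> I" "D \<subset> I" "B \<inter> D = {}"
    and cards: "card C = 2" "card B = 3" "card D = 2" and p: "\<And>V. V \<in> T \<Longrightarrow> p V \<in> jj_multilinear (inputs T V)"
  shows "dual_dif JJss I (jj_cocycle I) (T, p) = 0"
proof -
  have fin: "finite B" "finite C" "finite D" using T(2-4) I(1) by (meson finite_subset psubset_imp_subset)+
  have ne: "B \<noteq> {}" "C \<noteq> {}" "D \<noteq> {}" using cards by auto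
  have BD: "\<not> B \<subset> D" "\<not> D \<subset> B" "\<not> C \<subset> D" "\<not> D \<subset> C" "B \<noteq> D" "C \<noteq> D" "C \<inter> D = {}"
    using T(2,5) ne by blast+
  have CI: "C \<subset> I" using T by blast
  have d: "B \<noteq> I" "C \<noteq> I" "D \<noteq> I" "B \<noteq> C" "I \<noteq> B" "I \<noteq> C" "I \<noteq> D" "C \<noteq> B" "D \<noteq> B" "D \<noteq> C" "B \<noteq> D" "C \<noteq> D"
    using T(2-4) CI BD by auto
  have diff: "T - {I} = {B, C, D}" "T - {B} = {I, C, D}" "T - {C} = {I, B, D}" "T - {D} = {I, B, C}"
    unfolding T(1) using d by auto
  have par: "parent T B = I" "parent T C = B" "parent T D = I"
    unfolding T(1) by (rule parent_eq; use T(2-5) BD CI in blast)+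
  have "card (B \<union> D) = 5" using card_Un_disjoint[OF fin(1,3) T(5)] cards by simp
  then have BDI: "B \<union> D = I" using card_subset_eq[OF I(1), of "B \<union> D"] T(3,4) I(2) by auto
  have "inputs T I = insert (Min B) (insert (Min D) (I - B - D))"
    unfolding T(1) by (rule inputs_two; use T(2-5) fin ne in blast)
  moreover have "I - B - D = {}" using BDI by blast
  ultimately have inpI: "inputs T I = {Min B, Min D}" by simp
  have inpB: "inputs T B = insert (Min C) (B - C)"
    unfolding T(1) by (rule inputs_one; use T(2-5) BD fin ne in blast)
  have inpC: "inputs T C = C" unfolding T(1) by (rule inputs_leaf) (use T(2-5) BD in blast)
  have inpD: "inputs T D = D" unfolding T(1) by (rule inputs_leaf) (use T(2-5) BD in blast)
  have Min: "Min B \<in> B" "Min C \<in> C" "Min D \<in> D" using fin ne by simp_all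
  have BDne: "Min B \<noteq> Min D" using Min T(5) by (metis disjoint_iff)
  have card2: "card (inputs T I) = 2" "card (inputs T B) = 2" "card (inputs T D) = 2" "card (inputs T C) = 2"
    using BDne cards card_inputs_one[of C B] T(2) fin ne by (simp_all add: inpI inpB inpC inpD)
  have pV: "p I \<in> jj_multilinear (inputs T I)" "p B \<in> jj_multilinear (inputs T B)"
    "p C \<in> jj_multilinear (inputs T C)" "p D \<in> jj_multilinear (inputs T D)"
    by (rule p; simp add: T(1))+
  have merge_B: "coefU (jj_comp (Min C) (p B) (p C)) = 0"
  proof -
    have *: "Min C \<in> inputs T B" "inputs T C \<inter> (inputs T B - {Min C}) = {}"
      unfolding inpB inpC using Min by auto
    show ?thesis by (rule binary_composite(1)[OF pV(2) card2(2) *(1) pV(3) card2(4) *(2)])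
  qed
  have merge_IB: "coefW (Min C) (jj_comp (Min B) (p I) (p B)) = coefU (p I) * coefU (p B)"
    "coefW (Min D) (jj_comp (Min B) (p I) (p B)) = - 2 * (coefU (p I) * coefU (p B))"
  proof -
    have *: "Min B \<in> inputs T I" "inputs T B \<inter> (inputs T I - {Min B}) = {}" "Min C \<in> inputs T B"
      "Min D \<in> inputs T I - {Min B}"
      unfolding inpI inpB using Min BDne T(2,5) by auto
    note comp = binary_composite[OF pV(1) card2(1) *(1) pV(2) card2(2) *(2)]
    show "coefW (Min C) (jj_comp (Min B) (p I) (p B)) = coefU (p I) * coefU (p B)"
      "coefW (Min D) (jj_comp (Min B) (p I) (p B)) = - 2 * (coefU (p I) * coefU (p B))"
      by (rule comp(2)[OF *(3)]) (rule comp(3)[OF *(4)])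
  qed
  have merge_ID: "coefW (Min B) (jj_comp (Min D) (p I) (p D)) = - 2 * (coefU (p I) * coefU (p D))"
    "coefU (jj_comp (Min D) (p I) (p D)) = 0"
  proof -
    have *: "Min D \<in> inputs T I" "inputs T D \<inter> (inputs T I - {Min D}) = {}" "Min B \<in> inputs T I - {Min D}"
      unfolding inpI inpD using Min BDne T(5) by auto
    note comp = binary_composite[OF pV(1) card2(1) *(1) pV(4) card2(3) *(2)]
    show "coefW (Min B) (jj_comp (Min D) (p I) (p D)) = - 2 * (coefU (p I) * coefU (p D))"
      "coefU (jj_comp (Min D) (p I) (p D)) = 0"
      by (rule comp(3)[OF *(3)]) (rule comp(1))
  qed
  let ?c = "coefU (p I) * coefU (p B) * coefU (p C) * coefU (p D)"
  have conC: "jj_cocycle I (contract JJss C (T, p)) = 0"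
    by (simp add: contract_eq[OF par(2)] diff d jj_cocycle_disjoint[OF T(3,4) BD(5,1,2) I(1)] merge_B)
  have conB: "jj_cocycle I (contract JJss B (T, p)) = - 6 * (if set_encode D < set_encode C then - 1 else 1) * ?c"
    by (simp add: contract_eq[OF par(1)] diff d jj_cocycle_disjoint[OF CI T(4) BD(6,3,4) I(1)] merge_IB algebra_simps)
  have conD: "jj_cocycle I (contract JJss D (T, p)) = - 6 * ?c"
    by (simp add: contract_eq[OF par(3)] diff d jj_cocycle_nested[OF T(2,3)] merge_ID mult_ac)
  have enc: "set_encode C < set_encode B" "set_encode D \<noteq> set_encode B" "set_encode D \<noteq> set_encode C"
    using set_encode_psubset[OF T(2) fin(1)] set_encode_neq[OF fin(3,1) d(9)] set_encode_neq[OF fin(3,2) d(10)] by auto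
  have "finite T" by (simp add: T(1))
  moreover have "edge_sign {B, C, D} B * (- 6 * (if set_encode D < set_encode C then - 1 else 1) * ?c)
      + edge_sign {B, C, D} D * (- 6 * ?c) = 0"
    using enc d by (auto simp: edge_sign_def)
  ultimately show ?thesis
    by (simp add: dual_dif_eq diff d conB conC conD del: mult_minus_left)
qed

text \<open>
  Contracting the edge below \<open>C\<close> and the edge below \<open>D\<close> gives the same value with
  opposite signs.  Contracting the edge below \<open>A\<close> gives the difference of two equal values.
\<close>

lemma jj_cocycle_closed_cherries:
  fixes p :: "nat set \<Rightarrow> 'k::field jjvec"
  assumes I: "finite I" "card I = 5" and T: "T = {I, A, C, D}" "C \<subset> A" "D \<subset> A" "A \<subset> I" "C \<inter> D = {}"
    and cards: "card C = 2" "card D = 2" "card A = 4" and p: "\<And>V. V \<in> T \<Longrightarrow> p V \<in> jj_multilinear (inputs T V)"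
  shows "dual_dif JJss I (jj_cocycle I) (T, p) = 0"
proof -
  have fin: "finite A" "finite C" "finite D" using T(2-4) I(1) by (meson finite_subset psubset_imp_subset)+
  have ne: "A \<noteq> {}" "C \<noteq> {}" "D \<noteq> {}" using cards by auto
  have CD: "\<not> C \<subset> D" "\<not> D \<subset> C" "C \<noteq> D" using T(5) ne by blast+
  have sub: "C \<subset> I" "D \<subset> I" using T by blast+
  have d: "A \<noteq> I" "C \<noteq> I" "D \<noteq> I" "A \<noteq> C" "A \<noteq> D" "I \<noteq> A" "I \<noteq> C" "I \<noteq> D" "C \<noteq> A" "D \<noteq> A" "C \<noteq> D" "D \<noteq> C"
    using T(2-4) sub CD by auto
  have diff: "T - {I} = {A, C, D}" "T - {A} = {I, C, D}" "T - {C} = {I, A, D}" "T - {D} = {I, A, C}"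
    unfolding T(1) using d by auto
  have par: "parent T A = I" "parent T C = A" "parent T D = A"
    unfolding T(1) by (rule parent_eq; use T(2-5) CD sub in blast)+
  have "card (C \<union> D) = 4" using card_Un_disjoint[OF fin(2,3) T(5)] cards by simp
  then have CDA: "C \<union> D = A" using card_subset_eq[OF fin(1), of "C \<union> D"] T(2,3) cards by auto
  have "inputs T A = insert (Min C) (insert (Min D) (A - C - D))"
    unfolding T(1) by (rule inputs_two; use T(2-5) fin ne in blast)
  moreover have "A - C - D = {}" using CDA by blast
  ultimately have inpA: "inputs T A = {Min C, Min D}" by simp
  have inpI: "inputs T I = insert (Min A) (I - A)"
    unfolding T(1) by (rule inputs_one; use T(2-5) fin ne in blast)
  have inpC: "inputs T C = C" unfolding T(1) by (rule inputs_leaf) (use T(2-5) CD in blast)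
  have inpD: "inputs T D = D" unfolding T(1) by (rule inputs_leaf) (use T(2-5) CD in blast)
  have Min: "Min A \<in> A" "Min C \<in> C" "Min D \<in> D" using fin ne by simp_all
  have CDne: "Min C \<noteq> Min D" using Min T(5) by (metis disjoint_iff)
  have card2: "card (inputs T I) = 2" "card (inputs T A) = 2" "card (inputs T C) = 2" "card (inputs T D) = 2"
    using CDne cards card_inputs_one[of A I] T(4) I ne by (simp_all add: inpI inpA inpC inpD)
  have pV: "p I \<in> jj_multilinear (inputs T I)" "p A \<in> jj_multilinear (inputs T A)"
    "p C \<in> jj_multilinear (inputs T C)" "p D \<in> jj_multilinear (inputs T D)"
    by (rule p; simp add: T(1))+
  have merge_C: "coefW (Min D) (jj_comp (Min C) (p A) (p C)) = - 2 * (coefU (p A) * coefU (p C))"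
    "coefU (jj_comp (Min C) (p A) (p C)) = 0"
  proof -
    have *: "Min C \<in> inputs T A" "inputs T C \<inter> (inputs T A - {Min C}) = {}" "Min D \<in> inputs T A - {Min C}"
      unfolding inpA inpC using Min CDne T(5) by auto
    note comp = binary_composite[OF pV(2) card2(2) *(1) pV(3) card2(3) *(2)]
    show "coefW (Min D) (jj_comp (Min C) (p A) (p C)) = - 2 * (coefU (p A) * coefU (p C))"
      "coefU (jj_comp (Min C) (p A) (p C)) = 0"
      by (rule comp(3)[OF *(3)]) (rule comp(1))
  qed
  have merge_D: "coefW (Min C) (jj_comp (Min D) (p A) (p D)) = - 2 * (coefU (p A) * coefU (p D))"
    "coefU (jj_comp (Min D) (p A) (p D)) = 0"
  proof -
    have *: "Min D \<in> inputs T A" "inputs T D \<inter> (inputs T A - {Min D}) = {}" "Min C \<in> inputs T A - {Min D}"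
      unfolding inpA inpD using Min CDne T(5) by auto
    note comp = binary_composite[OF pV(2) card2(2) *(1) pV(4) card2(4) *(2)]
    show "coefW (Min C) (jj_comp (Min D) (p A) (p D)) = - 2 * (coefU (p A) * coefU (p D))"
      "coefU (jj_comp (Min D) (p A) (p D)) = 0"
      by (rule comp(3)[OF *(3)]) (rule comp(1))
  qed
  have merge_A: "coefW (Min C) (jj_comp (Min A) (p I) (p A)) = coefU (p I) * coefU (p A)"
    "coefW (Min D) (jj_comp (Min A) (p I) (p A)) = coefU (p I) * coefU (p A)"
  proof -
    have *: "Min A \<in> inputs T I" "inputs T A \<inter> (inputs T I - {Min A}) = {}" "Min C \<in> inputs T A" "Min D \<in> inputs T A"
      unfolding inpI inpA using Min T(2-4) by auto
    note comp = binary_composite(2)[OF pV(1) card2(1) *(1) pV(2) card2(2) *(2)]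
    show "coefW (Min C) (jj_comp (Min A) (p I) (p A)) = coefU (p I) * coefU (p A)"
      "coefW (Min D) (jj_comp (Min A) (p I) (p A)) = coefU (p I) * coefU (p A)"
      by (rule comp[OF *(3)]) (rule comp[OF *(4)])
  qed
  let ?c = "coefU (p I) * coefU (p A) * coefU (p C) * coefU (p D)"
  have conC: "jj_cocycle I (contract JJss C (T, p)) = - 6 * ?c"
    by (simp add: contract_eq[OF par(2)] diff d jj_cocycle_nested[OF T(3,4)] merge_C mult_ac)
  have conD: "jj_cocycle I (contract JJss D (T, p)) = - 6 * ?c"
    by (simp add: contract_eq[OF par(3)] diff d jj_cocycle_nested[OF T(2,4)] merge_D mult_ac)
  have conA: "jj_cocycle I (contract JJss A (T, p)) = 0"
    by (simp add: contract_eq[OF par(1)] diff d jj_cocycle_disjoint[OF sub CD(3,1,2) I(1)] merge_A)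
  have enc: "set_encode C < set_encode A" "set_encode D < set_encode A" "set_encode D \<noteq> set_encode C"
    using set_encode_psubset[OF T(2) fin(1)] set_encode_psubset[OF T(3) fin(1)] set_encode_neq[OF fin(3,2) d(12)] by auto
  have "finite T" by (simp add: T(1))
  moreover have "edge_sign {A, C, D} C * (- 6 * ?c) + edge_sign {A, C, D} D * (- 6 * ?c) = 0"
    using enc d by (auto simp: edge_sign_def)
  ultimately show ?thesis
    by (simp add: dual_dif_eq diff d conA conC conD del: mult_minus_left)
qed

lemma jj_cocycle_closed:
  assumes I: "finite I" "card I = 5"
  shows "dual_eq_on JJss I 4 (dual_dif JJss I (jj_cocycle I)) (\<lambda>_. 0 :: 'k::field)"
  unfolding dual_eq_on_def
proof (intro ballI impI)
  fix T and p :: "nat set \<Rightarrow> 'k jjvec"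
  assume T: "T \<in> trees I" "card T = 4" and p: "p \<in> (\<Pi>\<^sub>E V\<in>T. ops JJss (inputs T V) 0)"
  have pV: "p V \<in> jj_multilinear (inputs T V)" if "V \<in> T" for V
    using PiE_mem[OF p that] by simp
  from I T show "dual_dif JJss I (jj_cocycle I) (T, p) = 0"
  proof (cases rule: three_vertex_shapes)
    case (comb A B C)
    then show ?thesis using jj_cocycle_closed_comb[OF I comb] pV by blast
  next
    case (fork B C D)
    then show ?thesis using jj_cocycle_closed_fork[OF I fork] pV by blast
  next
    case (cherries A C D)
    then show ?thesis using jj_cocycle_closed_cherries[OF I cherries] pV by blast
  qed
qed

lift_definition jj_prod :: "'k::field jjvec \<Rightarrow> 'k jjvec \<Rightarrow> 'k jjvec" is graft
proof -
  fix x x' y y' :: "btree \<Rightarrow>\<^sub>0 'k"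
  assume "x - x' \<in> jj_ideal" "y - y' \<in> jj_ideal"
  then have "graft (x - x') y + graft x' (y - y') \<in> jj_ideal"
    by (intro jj_ideal.add jj_ideal_graft)
  then show "graft x y - graft x' y' \<in> jj_ideal"
    by (simp add: graft_minus_left graft_minus_right)
qed

text \<open>
  The identities that hold in all Jacobi-Jordan algebras can thus be read as identities between operations.
\<close>

lemma jj_algebra_jj_prod: "jj_algebra (jj_scale :: 'k::field \<Rightarrow> _) jj_prod"
proof (intro jj_algebra.intro vector_space_jj_scale jj_algebra_axioms.intro)
  fix x y z :: "'k jjvec" and c :: 'k
  show "jj_prod (x + y) z = jj_prod x z + jj_prod y z"
    by transfer (simp add: graft_def pm_linear_add jj_ideal.zero)
  show "jj_prod (jj_scale c x) y = jj_scale c (jj_prod x y)"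
    by transfer (simp add: graft_def pm_linear_scale jj_ideal.zero)
  show "jj_prod x y = jj_prod y x"
    by transfer (rule jj_ideal_comm)
  show "jj_prod x (jj_prod y z) + jj_prod y (jj_prod z x) + jj_prod z (jj_prod x y) = 0"
    by transfer (simp add: jj_ideal_jacobi)
qed

lemma jj_tree_Node: "jj_tree (Node t u) = jj_prod (jj_tree t) (jj_tree u)"
  by (simp add: jj_prod.abs_eq graft_def)

lemma jj_comp_tree: "jj_comp i (jj_tree t) y = (case t of Leaf j \<Rightarrow> if j = i then y else jj_tree (Leaf j)
    | Node t u \<Rightarrow> jj_prod (jj_comp i (jj_tree t) y) (jj_comp i (jj_tree u) y))"
proof (induction y)
  fix y :: "btree \<Rightarrow>\<^sub>0 'a"
  show "jj_comp i (jj_tree t) (abs_jjvec y) = (case t of Leaf j \<Rightarrow> if j = i then abs_jjvec y else jj_tree (Leaf j)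
    | Node t u \<Rightarrow> jj_prod (jj_comp i (jj_tree t) (abs_jjvec y)) (jj_comp i (jj_tree u) (abs_jjvec y)))"
    by (auto simp: jj_comp.abs_eq jj_prod.abs_eq split: btree.split)
qed

lemma jj_comp_at_deepest:
  "k \<noteq> a \<Longrightarrow> jj_comp k (comb2 a k) (jj_tree t) = jj_tree (Node (Leaf a) t)"
  "k \<noteq> a \<Longrightarrow> k \<noteq> b \<Longrightarrow> jj_comp k (comb3 a b k) (jj_tree t)
    = jj_tree (Node (Leaf a) (Node (Leaf b) t))"
  by (simp_all add: jj_comp_tree) (simp_all add: jj_tree_Node)

lemma jj_tree_cyclic_sum:
  "comb4 b c d e
    + comb4 b d e c
    + comb4 b e c d = (0 :: 'k::field jjvec)"
proof -
  interpret J: jj_algebra "jj_scale :: 'k \<Rightarrow> _" jj_prod by (rule jj_algebra_jj_prod)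
  show ?thesis
    unfolding jj_tree_Node J.mul_add_right[symmetric] J.mul_jacobi by simp
qed

lemma jj_tree_symmetric_sum:
  fixes k :: nat
  defines "N \<equiv> \<lambda>a b c. comb4 a b c k :: 'k::field_char_0 jjvec"
  shows "N a b c + N a c b + N b a c + N b c a + N c a b + N c b a = 0"
proof -
  interpret J: jj_algebra "jj_scale :: 'k \<Rightarrow> _" jj_prod by (rule jj_algebra_jj_prod)
  show ?thesis
    unfolding N_def jj_tree_Node by (rule J.sum_permutations_left_mult_zero) simp
qed

lemma dual_cochain_add:
  assumes "\<psi> \<in> dual_cochains P I n" "T \<in> trees I" "card T = n" "p \<in> (\<Pi>\<^sub>E V\<in>T. ops P (inputs T V) 0)"
    "V \<in> T" "x \<in> ops P (inputs T V) 0" "y \<in> ops P (inputs T V) 0"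
  shows "\<psi> (T, p(V := x + y)) = \<psi> (T, p(V := x)) + \<psi> (T, p(V := y))"
  using assms unfolding dual_cochains_def by blast

lemma dual_cochain_scale:
  assumes "\<psi> \<in> dual_cochains P I n" "T \<in> trees I" "card T = n" "p \<in> (\<Pi>\<^sub>E V\<in>T. ops P (inputs T V) 0)"
    "V \<in> T" "x \<in> ops P (inputs T V) 0"
  shows "\<psi> (T, p(V := scl P c x)) = c * \<psi> (T, p(V := x))"
  using assms unfolding dual_cochains_def by blast

lemma two_vertex_tree:
  assumes "finite I" "A \<subset> I" "card A \<ge> 2"
  shows "{I, A} \<in> trees I" "card {I, A} = 2" "inputs {I, A} I = insert (Min A) (I - A)" "inputs {I, A} A = A"
proof -
  have A: "finite A" "A \<noteq> {}" "A \<noteq> I" using assms finite_subset by auto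
  have "card I \<ge> 2" using card_mono[OF assms(1), of A] assms(2,3) by auto
  then show "{I, A} \<in> trees I" using assms A by (auto simp: trees_def)
  show "card {I, A} = 2" using A(3) by simp
  show "inputs {I, A} I = insert (Min A) (I - A)"
    by (rule inputs_one; use assms A in blast)
  show "inputs {I, A} A = A"
    by (rule inputs_leaf) (use assms in blast)
qed

lemma three_vertex_chain:
  assumes "finite I" "A \<subset> I" "C \<subset> A" "card C \<ge> 2"
  shows "{I, A, C} \<in> trees I" "card {I, A, C} = 3" "inputs {I, A, C} I = insert (Min A) (I - A)"
    "inputs {I, A, C} A = insert (Min C) (A - C)" "inputs {I, A, C} C = C"
    "parent {I, A, C} A = I" "parent {I, A, C} C = A"
proof -
  have A: "finite A" "A \<noteq> {}" "A \<noteq> I" "finite C" "C \<noteq> {}" "C \<noteq> A" "C \<noteq> I"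
    using assms finite_subset[of A I] finite_subset[of C A] by auto
  have "card A \<ge> 2" "card I \<ge> 2"
    using card_mono[OF A(1), of C] card_mono[OF assms(1), of A] assms(2-4) by auto
  then show "{I, A, C} \<in> trees I" using assms A by (auto simp: trees_def)
  show "card {I, A, C} = 3" using A by simp
  show "inputs {I, A, C} I = insert (Min A) (I - A)"
    by (rule inputs_one; use assms A in blast)
  show "inputs {I, A, C} A = insert (Min C) (A - C)"
    by (rule inputs_one; use assms A in blast)
  show "inputs {I, A, C} C = C"
    by (rule inputs_leaf) (use assms in blast)
  show "parent {I, A, C} A = I" "parent {I, A, C} C = A"
    by (rule parent_eq; use assms in blast)+
qed

text \<open>
  The labellings of the chain tree below by the five elements of \<open>I\<close>.
\<close>

definition orderings :: "nat set \<Rightarrow> (nat \<times> nat \<times> nat \<times> nat \<times> nat) set" where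
  "orderings I = {(a, b, c, d, e). distinct [a, b, c, d, e] \<and> {a, b, c, d, e} = I}"

lemma sum_orderings_reindex:
  "(\<Sum>(a, b, c, d, e)\<in>orderings I. g a b d e c) = (\<Sum>(a, b, c, d, e)\<in>orderings I. g a b c d e)"
  "(\<Sum>(a, b, c, d, e)\<in>orderings I. g b a c d e) = (\<Sum>(a, b, c, d, e)\<in>orderings I. g a b c d e)"
  "(\<Sum>(a, b, c, d, e)\<in>orderings I. g a c b d e) = (\<Sum>(a, b, c, d, e)\<in>orderings I. g a b c d e)"
proof -
  show "(\<Sum>(a, b, c, d, e)\<in>orderings I. g a b d e c) = (\<Sum>(a, b, c, d, e)\<in>orderings I. g a b c d e)"
    by (rule sum.reindex_bij_witness[of _ "\<lambda>(a, b, c, d, e). (a, b, e, c, d)" "\<lambda>(a, b, c, d, e). (a, b, d, e, c)"])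
       (auto simp: orderings_def)
  show "(\<Sum>(a, b, c, d, e)\<in>orderings I. g b a c d e) = (\<Sum>(a, b, c, d, e)\<in>orderings I. g a b c d e)"
    by (rule sum.reindex_bij_witness[of _ "\<lambda>(a, b, c, d, e). (b, a, c, d, e)" "\<lambda>(a, b, c, d, e). (b, a, c, d, e)"])
       (auto simp: orderings_def)
  show "(\<Sum>(a, b, c, d, e)\<in>orderings I. g a c b d e) = (\<Sum>(a, b, c, d, e)\<in>orderings I. g a b c d e)"
    by (rule sum.reindex_bij_witness[of _ "\<lambda>(a, b, c, d, e). (a, c, b, d, e)" "\<lambda>(a, b, c, d, e). (a, c, b, d, e)"])
       (auto simp: orderings_def)
qed

text \<open>
  The value of a cochain on the tree with vertices \<open>I\<close> and \<open>I - {a}\<close>, as a function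
  of the decoration of the upper vertex.
\<close>

definition upper_cochain :: "(nat set set \<times> (nat set \<Rightarrow> 'k::field jjvec) \<Rightarrow> 'k) \<Rightarrow> nat set \<Rightarrow> nat \<Rightarrow> 'k jjvec \<Rightarrow> 'k" where
  "upper_cochain \<psi> I a X = \<psi> ({I, I - {a}}, \<lambda>V\<in>{I, I - {a}}.
     if V = I then comb2 a (Min (I - {a})) else X)"

text \<open>
  The value of a cochain on the tree with vertices \<open>I\<close> and \<open>{d, e}\<close>, as a function
  of the decoration of the root.
\<close>

definition lower_cochain :: "(nat set set \<times> (nat set \<Rightarrow> 'k::field jjvec) \<Rightarrow> 'k) \<Rightarrow> nat set \<Rightarrow> nat \<Rightarrow> nat \<Rightarrow> 'k jjvec \<Rightarrow> 'k" where
  "lower_cochain \<psi> I d e Y = \<psi> ({I, {d, e}}, \<lambda>V\<in>{I, {d, e}}.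
     if V = I then Y else comb2 d e)"

lemma jj_tree2: "i \<noteq> j \<Longrightarrow> I = {i, j} \<Longrightarrow> comb2 i j \<in> jj_multilinear I"
  by (intro jj_tree_multilinear) auto

lemma jj_tree3: "distinct [i, j, l] \<Longrightarrow> I = {i, j, l} \<Longrightarrow> comb3 i j l \<in> jj_multilinear I"
  by (intro jj_tree_multilinear) auto

lemma jj_tree4: "distinct [i, j, l, m] \<Longrightarrow> I = {i, j, l, m} \<Longrightarrow>
    comb4 i j l m \<in> jj_multilinear I"
  by (intro jj_tree_multilinear) auto

lemma upper_cochain_linear:
  fixes \<psi> :: "nat set set \<times> (nat set \<Rightarrow> 'k::field jjvec) \<Rightarrow> 'k"
  assumes \<psi>: "\<psi> \<in> dual_cochains JJss I 2" and I: "finite I" "card I = 5" "a \<in> I"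
    and X: "X \<in> jj_multilinear (I - {a})" "Y \<in> jj_multilinear (I - {a})"
  shows "upper_cochain \<psi> I a (X + Y) = upper_cochain \<psi> I a X + upper_cochain \<psi> I a Y"
    and "upper_cochain \<psi> I a 0 = 0"
proof -
  interpret J: vector_space "jj_scale :: 'k \<Rightarrow> _" by (rule vector_space_jj_scale)
  let ?A = "I - {a}"
  have A: "?A \<subset> I" "card ?A \<ge> 2" "finite ?A" "?A \<noteq> {}"
  proof -
    have "card ?A = 4" using I by simp
    then show "card ?A \<ge> 2" "finite ?A" "?A \<noteq> {}" using card_gt_0_iff[of ?A] I(1) by auto
    show "?A \<subset> I" using I(3) by blast
  qed
  note T = two_vertex_tree[OF I(1) A(1,2)]
  have Min: "Min ?A \<in> ?A" by (rule Min_in[OF A(3,4)])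
  have ne: "?A \<noteq> I" using A(1) by blast
  define p where "p X = (\<lambda>V\<in>{I, ?A}. if V = I then comb2 a (Min ?A) else X)" for X :: "'k jjvec"
  have "I - ?A = {a}" using I(3) by blast
  then have "comb2 a (Min ?A) \<in> jj_multilinear (inputs {I, ?A} I)"
    using Min by (intro jj_tree2) (auto simp: T(3))
  then have p: "p X \<in> (\<Pi>\<^sub>E V\<in>{I, ?A}. ops JJss (inputs {I, ?A} V) 0)"
    using X(1) ne by (auto simp: p_def T(4))
  have upd: "(p X)(?A := Z) = p Z" for Z using ne by (auto simp: p_def fun_eq_iff)
  have eq: "upper_cochain \<psi> I a Z = \<psi> ({I, ?A}, p Z)" for Z
    by (simp add: upper_cochain_def p_def)
  show "upper_cochain \<psi> I a (X + Y) = upper_cochain \<psi> I a X + upper_cochain \<psi> I a Y"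
    using dual_cochain_add[OF \<psi> T(1,2) p, of ?A X Y] X by (simp add: T(4) upd eq)
  show "upper_cochain \<psi> I a 0 = 0"
    using dual_cochain_scale[OF \<psi> T(1,2) p, of ?A X 0] X by (simp add: T(4) upd eq)
qed

lemma lower_cochain_linear:
  fixes \<psi> :: "nat set set \<times> (nat set \<Rightarrow> 'k::field jjvec) \<Rightarrow> 'k"
  assumes \<psi>: "\<psi> \<in> dual_cochains JJss I 2" and I: "finite I" "card I = 5" "d \<in> I" "e \<in> I" "d \<noteq> e"
    and X: "X \<in> jj_multilinear (insert (Min {d, e}) (I - {d, e}))" "Y \<in> jj_multilinear (insert (Min {d, e}) (I - {d, e}))"
  shows "lower_cochain \<psi> I d e (X + Y) = lower_cochain \<psi> I d e X + lower_cochain \<psi> I d e Y"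
    and "lower_cochain \<psi> I d e 0 = 0"
proof -
  interpret J: vector_space "jj_scale :: 'k \<Rightarrow> _" by (rule vector_space_jj_scale)
  let ?C = "{d, e}"
  have card: "card ?C = 2" using I(5) by simp
  have ne: "?C \<noteq> I" using card I(2) by auto
  then have C: "?C \<subset> I" using I by auto
  note T = two_vertex_tree[OF I(1) C, unfolded card, OF order.refl]
  define p where "p X = (\<lambda>V\<in>{I, ?C}. if V = I then X else comb2 d e)" for X :: "'k jjvec"
  have "comb2 d e \<in> jj_multilinear (inputs {I, ?C} ?C)"
    using I(5) by (intro jj_tree2) (auto simp: T(4))
  then have p: "p X \<in> (\<Pi>\<^sub>E V\<in>{I, ?C}. ops JJss (inputs {I, ?C} V) 0)"
    using X(1) ne by (auto simp: p_def T(3))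
  have upd: "(p X)(I := Z) = p Z" for Z using ne by (auto simp: p_def fun_eq_iff)
  have eq: "lower_cochain \<psi> I d e Z = \<psi> ({I, ?C}, p Z)" for Z
    by (simp add: lower_cochain_def p_def)
  show "lower_cochain \<psi> I d e (X + Y) = lower_cochain \<psi> I d e X + lower_cochain \<psi> I d e Y"
    using dual_cochain_add[OF \<psi> T(1,2) p, of I X Y] X by (simp add: T(3) upd eq)
  show "lower_cochain \<psi> I d e 0 = 0"
    using dual_cochain_scale[OF \<psi> T(1,2) p, of I X 0] X by (simp add: T(3) upd eq)
qed

text \<open>
  The test tree is the chain of \<open>a\<cdot>\<close>, \<open>b(c\<cdot>)\<close> and \<open>de\<close>. 
  The form at the ternary vertex, evaluated at the subtree \<open>de\<close>, is 1 there, and the weight is 3.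
\<close>

lemma cocycle_on_chain:
  fixes \<psi> :: "nat set set \<times> (nat set \<Rightarrow> 'k::field jjvec) \<Rightarrow> 'k"
  assumes I: "finite I" and abcde: "distinct [a, b, c, d, e]" "I = {a, b, c, d, e}"
    and \<psi>: "dual_eq_on JJss I 3 (jj_cocycle I) (dual_dif JJss I \<psi>)"
  shows "3 = upper_cochain \<psi> I a (comb4 b c d e)
    - lower_cochain \<psi> I d e (comb4 a b c (Min {d, e}))"
proof -
  let ?A = "{b, c, d, e}" and ?C = "{d, e}"
  have sub: "?C \<subset> ?A" "?A \<subset> I" using abcde by auto
  have card: "card ?C = 2" using abcde by simp
  note T = three_vertex_chain[OF I sub(2,1), unfolded card, OF order.refl]
  have ne: "?A \<noteq> I" "?C \<noteq> I" "?C \<noteq> ?A" "I \<noteq> ?A" "I \<noteq> ?C" "?A \<noteq> ?C" using sub by auto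
  have IA: "I - {a} = ?A" using abcde by auto
  let ?k = "Min ?C" and ?l = "Min ?A"
  have k: "?k \<in> ?C" by (rule Min_in) auto
  have l: "?l \<in> ?A" by (rule Min_in) auto
  have kl: "?k \<noteq> a" "?k \<noteq> b" "?k \<noteq> c" "?l \<noteq> a" using k l abcde by auto
  define pI where "pI = (comb2 a ?l :: 'k jjvec)"
  define pA where "pA = (comb3 b c ?k :: 'k jjvec)"
  define pC where "pC = (comb2 d e :: 'k jjvec)"
  define p where "p = (\<lambda>V\<in>{I, ?A, ?C}. if V = I then pI else if V = ?A then pA else pC)"
  have pv: "p I = pI" "p ?A = pA" "p ?C = pC" using ne by (simp_all add: p_def)
  have diffs: "I - ?A = {a}" "?A - ?C = {b, c}" using abcde by auto
  have "pI \<in> jj_multilinear (inputs {I, ?A, ?C} I)"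
    unfolding pI_def T(3) diffs by (rule jj_tree2) (use kl in \<open>auto simp: insert_commute\<close>)
  moreover have "pA \<in> jj_multilinear (inputs {I, ?A, ?C} ?A)"
    unfolding pA_def T(4) diffs by (rule jj_tree3) (use kl abcde(1) in \<open>auto simp: insert_commute\<close>)
  moreover have "pC \<in> jj_multilinear (inputs {I, ?A, ?C} ?C)"
    unfolding pC_def T(5) by (rule jj_tree2) (use abcde(1) in auto)
  ultimately have "p V \<in> jj_multilinear (inputs {I, ?A, ?C} V)" if "V \<in> {I, ?A, ?C}" for V
    using that by (elim insertE) (simp_all only: pv empty_iff)
  then have p: "p \<in> (\<Pi>\<^sub>E V\<in>{I, ?A, ?C}. ops JJss (inputs {I, ?A, ?C} V) 0)"
    unfolding JJss_simps by (intro PiE_I) (simp_all only: p_def restrict_apply if_False)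
  have "jj_cocycle I ({I, ?A, ?C}, p) = 3"
    unfolding jj_cocycle_nested[OF sub] pv
    using kl by (simp add: pI_def pA_def pC_def coefU_def coefW_def jj_tree_action mul5_tuple)
  moreover have "dual_dif JJss I \<psi> ({I, ?A, ?C}, p)
      = upper_cochain \<psi> I a (comb4 b c d e)
      - lower_cochain \<psi> I d e (comb4 a b c ?k)"
  proof -
    have diff: "{I, ?A, ?C} - {I} = {?A, ?C}" "{I, ?A, ?C} - {?A} = {I, ?C}" "{I, ?A, ?C} - {?C} = {I, ?A}"
      using ne by auto
    have "set_encode ?C < set_encode ?A" by (rule set_encode_psubset[OF sub(1)]) simp
    then have sign: "edge_sign {?A, ?C} ?A = (- 1 :: 'k)" "edge_sign {?A, ?C} ?C = (1 :: 'k)"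
      using ne by (simp_all add: edge_sign_def)
    have comp_C: "jj_comp ?k pA pC = comb4 b c d e"
      unfolding pA_def pC_def by (rule jj_comp_at_deepest(2)[OF kl(2,3)])
    have comp_A: "jj_comp ?l pI pA = comb4 a b c ?k"
      unfolding pI_def pA_def by (rule jj_comp_at_deepest(1)[OF kl(4)])
    have "contract JJss ?C ({I, ?A, ?C}, p) = ({I, ?A}, restrict (p(?A := jj_comp ?k pA pC)) {I, ?A})"
      using contract_eq[OF T(7), of p] ne unfolding diff pv by simp
    also have "restrict (p(?A := jj_comp ?k pA pC)) {I, ?A} = (\<lambda>V\<in>{I, ?A}. if V = I then pI else jj_comp ?k pA pC)"
      using ne pv by (auto simp: restrict_def fun_eq_iff)
    finally have 1: "\<psi> (contract JJss ?C ({I, ?A, ?C}, p))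
        = upper_cochain \<psi> I a (comb4 b c d e)"
      by (simp only: upper_cochain_def IA comp_C pI_def)
    have "contract JJss ?A ({I, ?A, ?C}, p) = ({I, ?C}, restrict (p(I := jj_comp ?l pI pA)) {I, ?C})"
      using contract_eq[OF T(6), of p] ne unfolding diff pv by simp
    also have "restrict (p(I := jj_comp ?l pI pA)) {I, ?C} = (\<lambda>V\<in>{I, ?C}. if V = I then jj_comp ?l pI pA else pC)"
      using ne pv by (auto simp: restrict_def fun_eq_iff)
    finally have 2: "\<psi> (contract JJss ?A ({I, ?A, ?C}, p))
        = lower_cochain \<psi> I d e (comb4 a b c ?k)"
      by (simp only: lower_cochain_def comp_A pC_def)
    have "finite {I, ?A, ?C}" by simp
    from dual_dif_eq[OF this, of JJss I \<psi> p] show ?thesis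
      unfolding diff using ne by (simp add: sign 1 2)
  qed
  moreover have "jj_cocycle I ({I, ?A, ?C}, p) = dual_dif JJss I \<psi> ({I, ?A, ?C}, p)"
    using \<psi> T(1,2) p unfolding dual_eq_on_def by blast
  ultimately show ?thesis by simp
qed

lemma jj_multilinear_add:
  assumes "x \<in> jj_multilinear I" "x' \<in> jj_multilinear I"
  shows "x + x' \<in> jj_multilinear I"
proof -
  let ?D = "{x :: btree \<Rightarrow>\<^sub>0 'a. \<forall>t\<in>Poly_Mapping.keys x. finite I \<and> leaves t = mset_set I}"
  obtain y y' where y: "x = abs_jjvec y" "x' = abs_jjvec y'" "y \<in> ?D" "y' \<in> ?D"
    using assms by (auto simp: jj_multilinear_def)
  then have "y + y' \<in> ?D" using Poly_Mapping.keys_add[of y y'] by blast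
  moreover have "x + x' = abs_jjvec (y + y')" by (simp add: y(1,2) plus_jjvec.abs_eq)
  ultimately show ?thesis unfolding jj_multilinear_def by blast
qed

lemma additive_sum_list:
  assumes "\<And>X Y. X \<in> jj_multilinear I \<Longrightarrow> Y \<in> jj_multilinear I \<Longrightarrow> f (X + Y) = f X + f Y"
    and "f 0 = (0 :: 'b::comm_monoid_add)" and "set xs \<subseteq> jj_multilinear I"
  shows "f (sum_list xs) = sum_list (map f xs)"
proof -
  have "f (sum_list xs) = sum_list (map f xs) \<and> sum_list xs \<in> jj_multilinear I"
    using assms(3) by (induction xs) (auto simp: assms(1,2) zero_jj_multilinear jj_multilinear_add)
  then show ?thesis ..
qed

text \<open>
  Summing over all labellings turns the coboundary into sums over cyclic permutations of \<open>c, d,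
  e\<close> and over all permutations of \<open>a, b, c\<close>, each of which vanishes, while the cocycle
  sums to 3 times the number of labellings.
\<close>

lemma jj_cocycle_not_coboundary:
  fixes \<psi> :: "nat set set \<times> (nat set \<Rightarrow> 'k::field_char_0 jjvec) \<Rightarrow> 'k"
  assumes I: "finite I" "card I = 5" and \<psi>: "\<psi> \<in> dual_cochains JJss I 2"
  shows "\<not> dual_eq_on JJss I 3 (jj_cocycle I) (dual_dif JJss I \<psi>)"
proof
  assume eq: "dual_eq_on JJss I 3 (jj_cocycle I) (dual_dif JJss I \<psi>)"
  define G where "G a b c d e = upper_cochain \<psi> I a (comb4 b c d e)"
    for a b c d e
  define H where "H a b c d e = lower_cochain \<psi> I d e (comb4 a b c (Min {d, e}))"
    for a b c d e
  let ?S = "\<lambda>g :: nat \<Rightarrow> nat \<Rightarrow> nat \<Rightarrow> nat \<Rightarrow> nat \<Rightarrow> 'k. \<Sum>(a, b, c, d, e)\<in>orderings I. g a b c d e"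
  have G0: "G a b c d e + G a b d e c + G a b e c d = 0" if "distinct [a, b, c, d, e]" "{a, b, c, d, e} = I" for a b c d e
  proof -
    let ?t = "\<lambda>c d e. comb4 b c d e :: 'k jjvec"
    have A: "I - {a} = {b, c, d, e}" "a \<in> I" using that by auto
    have X: "?t c d e \<in> jj_multilinear (I - {a})" "?t d e c \<in> jj_multilinear (I - {a})" "?t e c d \<in> jj_multilinear (I - {a})"
      using that unfolding A by (auto intro!: jj_tree4)
    have "upper_cochain \<psi> I a (sum_list [?t c d e, ?t d e c, ?t e c d])
        = sum_list (map (upper_cochain \<psi> I a) [?t c d e, ?t d e c, ?t e c d])"
      by (rule additive_sum_list[where I = "I - {a}"])
         (use X upper_cochain_linear[OF \<psi> I A(2)] in auto)
    moreover have "sum_list [?t c d e, ?t d e c, ?t e c d] = 0"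
      using jj_tree_cyclic_sum[of b c d e] by (simp add: add.assoc)
    ultimately show ?thesis
      using upper_cochain_linear(2)[OF \<psi> I A(2) X(1,1)] by (simp add: G_def add.assoc)
  qed
  have H0: "H a b c d e + H a c b d e + H b a c d e + H b c a d e + H c a b d e + H c b a d e = 0"
    if "distinct [a, b, c, d, e]" "{a, b, c, d, e} = I" for a b c d e
  proof -
    let ?k = "Min {d, e}"
    let ?t = "\<lambda>a b c. comb4 a b c ?k :: 'k jjvec"
    let ?xs = "[?t a b c, ?t a c b, ?t b a c, ?t b c a, ?t c a b, ?t c b a]"
    have de: "d \<in> I" "e \<in> I" "d \<noteq> e" using that by auto
    have k: "?k \<in> {d, e}" by (rule Min_in) auto
    have "I - {d, e} = {a, b, c}" using that by auto
    then have D: "insert ?k (I - {d, e}) = {a, b, c, ?k}" by auto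
    have "distinct [a, b, c, ?k]" using that k by auto
    then have X: "set ?xs \<subseteq> jj_multilinear (insert ?k (I - {d, e}))"
      unfolding D by (auto intro!: jj_tree4)
    then have X1: "?t a b c \<in> jj_multilinear (insert ?k (I - {d, e}))" by simp
    have "lower_cochain \<psi> I d e (sum_list ?xs) = sum_list (map (lower_cochain \<psi> I d e) ?xs)"
    proof (rule additive_sum_list[OF _ _ X])
      show "lower_cochain \<psi> I d e (X + Y) = lower_cochain \<psi> I d e X + lower_cochain \<psi> I d e Y"
        if "X \<in> jj_multilinear (insert ?k (I - {d, e}))" "Y \<in> jj_multilinear (insert ?k (I - {d, e}))" for X Y
        by (rule lower_cochain_linear(1)[OF \<psi> I de that])
      show "lower_cochain \<psi> I d e 0 = 0"
        by (rule lower_cochain_linear(2)[OF \<psi> I de X1 X1])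
    qed
    moreover have "sum_list ?xs = 0"
      using jj_tree_symmetric_sum[of a b c ?k] by (simp add: add.assoc)
    ultimately show ?thesis
      using lower_cochain_linear(2)[OF \<psi> I de X1 X1] by (simp add: H_def add.assoc)
  qed
  have sum_add: "?S g + ?S h = ?S (\<lambda>a b c d e. g a b c d e + h a b c d e)" for g h
    unfolding sum.distrib[symmetric] by (intro sum.cong) auto
  have "3 * ?S G = ?S G + ?S (\<lambda>a b c d e. G a b d e c) + ?S (\<lambda>a b c d e. G a b e c d)"
    using sum_orderings_reindex(1)[of G I] sum_orderings_reindex(1)[of "\<lambda>a b c d e. G a b d e c" I] by simp
  also have "\<dots> = 0"
    unfolding sum_add by (rule sum.neutral) (auto simp: orderings_def G0)
  finally have SG: "?S G = 0" by simp
  have "6 * ?S H = ?S H + ?S (\<lambda>a b c. H a c b) + ?S (\<lambda>a b. H b a) + ?S (\<lambda>a b c. H b c a)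
      + ?S (\<lambda>a b c. H c a b) + ?S (\<lambda>a b c. H c b a)"
    using sum_orderings_reindex(2)[of H I] sum_orderings_reindex(3)[of H I]
      sum_orderings_reindex(2)[of "\<lambda>a b c. H a c b" I] sum_orderings_reindex(3)[of "\<lambda>a b. H b a" I]
      sum_orderings_reindex(3)[of "\<lambda>a b c. H b c a" I]
      sum_orderings_reindex(2)[of "\<lambda>a b c. H c a b" I]
    by simp
  also have "\<dots> = 0"
    unfolding sum_add by (rule sum.neutral) (auto simp: orderings_def H0)
  finally have SH: "?S H = 0" by simp
  have fin: "finite (orderings I)"
    by (rule finite_subset[of _ "I \<times> I \<times> I \<times> I \<times> I"]) (auto simp: orderings_def I(1))
  have "of_nat (card (orderings I)) * 3 = ?S (\<lambda>a b c d e. 3)" by (simp add: case_prod_beta)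
  also have "\<dots> = ?S (\<lambda>a b c d e. G a b c d e - H a b c d e)"
  proof (rule sum.cong[OF refl])
    fix t assume t: "t \<in> orderings I"
    obtain a b c d e where e: "t = (a, b, c, d, e)" by (cases t)
    have "distinct [a, b, c, d, e]" "I = {a, b, c, d, e}"
      using t unfolding e orderings_def by blast+
    from cocycle_on_chain[OF I(1) this eq]
    show "(case t of (a, b, c, d, e) \<Rightarrow> 3) = (case t of (a, b, c, d, e) \<Rightarrow> G a b c d e - H a b c d e)"
      unfolding e prod.case G_def H_def .
  qed
  also have "\<dots> = ?S G - ?S H"
    unfolding sum_subtractf[symmetric] by (intro sum.cong) auto
  also have "\<dots> = 0" by (simp add: SG SH)
  finally have "card (orderings I) = 0" by simp
  moreover have "orderings I \<noteq> {}"
  proof -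
    obtain xs where xs: "distinct xs" "set xs = I" using finite_distinct_list[OF I(1)] by auto
    then have "length xs = 5" using I(2) distinct_card by fastforce
    then obtain a b c d e where "xs = [a, b, c, d, e]"
      by (auto simp: length_Suc_conv eval_nat_numeral)
    then have "(a, b, c, d, e) \<in> orderings I" using xs by (simp add: orderings_def)
    then show ?thesis by blast
  qed
  ultimately show False using fin by simp
qed

theorem JJss_not_koszul: "\<not> koszul (JJss :: ('k::field_char_0, 'k jjvec) operad)"
proof
  assume K: "koszul (JJss :: ('k, 'k jjvec) operad)"
  let ?I = "{..<5} :: nat set" and ?\<phi> = "jj_cocycle {..<5} :: _ \<Rightarrow> 'k"
  have I: "finite ?I" "card ?I = 5" by simp_all
  have "dual_eq_on JJss ?I (3 + 1) (dual_dif JJss ?I ?\<phi>) (\<lambda>_. 0)"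
    using jj_cocycle_closed[OF I] by simp
  then obtain \<psi> where "\<psi> \<in> dual_cochains JJss ?I (3 - 1)" "dual_eq_on JJss ?I 3 ?\<phi> (dual_dif JJss ?I \<psi>)"
    using K[unfolded koszul_def, rule_format, of ?I 3 ?\<phi>] jj_cocycle_dual_cochain[OF I(1), of 3] by auto
  then show False using jj_cocycle_not_coboundary[OF I, of \<psi>] by simp
qed

theorem proposition37:
  fixes s :: "'k::field_char_0 \<Rightarrow> 'a::ab_group_add \<Rightarrow> 'a"
    and mul :: "'a \<Rightarrow> 'a \<Rightarrow> 'a"
    and M R :: "('k, 'u::infinite \<Rightarrow>\<^sub>0 'k) operad"
    and \<epsilon> \<eta> :: "('u \<Rightarrow>\<^sub>0 'k) \<Rightarrow> 'k jjvec"
  shows "\<not> koszul (JJss :: ('k, 'k jjvec) operad) \<and>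
    (jacobi_jordan_algebra s mul \<and> cofibrant_resolution JJss R \<eta> \<and> minimal_model JJss M \<epsilon>
      \<longrightarrow> (\<forall>n. same_deformation_cohomology s mul R \<eta> M \<epsilon> n))"
  using JJss_not_koszul deformation_cohomology_independent[of s mul R \<eta> M \<epsilon>]
  by (auto simp: minimal_model_def)

end
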